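(* For every positive integer $n$ there is a family $\{\mathrm{T}_\rho:\rho\in(0,1)\}$ of self-adjoint linear operators on $L^2(S_n)$ with the following properties. (1) For every $\rho\in(0,1)$, if $f\in V_{\le d}$ with $d\le 10^{-5}n$ then $\langle \mathrm{T}_\rho f,f\rangle\ge(\rho/72)^d\|f\|_2^2$. (2) For every $\rho\in(0,1)$, if $f\in L^2(S_n)$ is $(r,\gamma)$-global (with $r,\gamma>0$), $q\ge2$ and $\rho\le\frac{\log q}{16rq}$, then $\|\mathrm{T}_\rho f\|_q^q\le\gamma^{q-2}\|f\|_2^2$. (3) Each $\mathrm{T}_\rho$ commutes with the action of $S_n$ from both sides.
   Context: $L^2(S_n)$ is the space of real functions on $S_n$ with the uniform probability measure, $\langle f,g\rangle=\mathbb{E}_{\sigma\in S_n}[f(\sigma)g(\sigma)]$, and $\|f\|_p=(\mathbb{E}|f|^p)^{1/p}$. $\log$ is natural; $d$ ranges over non-negative integers, and $q$ over real numbers. The two actions of $S_n$ on $L^2(S_n)$ are ${}^\sigma f(x)=f(\sigma^{-1}x)$ (left) and $f^\sigma(x)=f(x\sigma)$ (right). Globalness: let $[n]_t$ be the set of $t$-tuples of distinct elements of $[n]$. For $I,J\in[n]_t$ let $U_{I\to J}=\{\sigma\in S_n:\sigma(I_s)=J_s \text{ for all } s\}$ and let $f_{I\to J}$ be the restriction of $f$ to $U_{I\to J}$, with norms taken with respect to the uniform probability measure on $U_{I\to J}$. $f$ is $(r,\gamma)$-global if $\|f_{I\to J}\|_2\le r^t\gamma$ for every $t$ (including $t=0$,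 i.e. $\|f\|_2\le\gamma$) and all $I,J\in[n]_t$. Degree: let $x_{i\to j}(\sigma)=1$ if $\sigma(i)=j$ and $0$ otherwise. $V_{\le d}\le L^2(S_n)$ is the space of functions expressible as polynomials of degree at most $d$ in the $n^2$ functions $x_{i\to j}$. *)

theory Defs
  imports "HOL-Probability.Probability" "HOL-Combinatorics.Permutations"
begin

text \<open>\<open>S\<^sub>n\<close> acts on \<open>[n] = {1..n}\<close> and its product is composition of functions.\<close>

definition sym_grp :: "nat \<Rightarrow> (nat \<Rightarrow> nat) set" where
  "sym_grp n = {\<sigma>. \<sigma> permutes {1..n}}"

text \<open>Real functions on \<open>S\<^sub>n\<close> are represented by functions on all of \<^typ>\<open>nat \<Rightarrow> nat\<close> that vanish
  outside \<open>S\<^sub>n\<close>, so that equality in \<open>L\<^sup>2(S\<^sub>n)\<close> is equality in HOL and pointwise operations stay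
  inside the space.\<close>

definition L2_sym :: "nat \<Rightarrow> ((nat \<Rightarrow> nat) \<Rightarrow> real) set" where
  "L2_sym n = {f. \<forall>\<sigma>. \<sigma> \<notin> sym_grp n \<longrightarrow> f \<sigma> = 0}"

text \<open>Expectations and norms are taken over a finite nonempty set \<open>A\<close> with its uniform probability
  measure: either all of \<open>S\<^sub>n\<close> or one of the sets \<open>U\<^bsub>I\<rightarrow>J\<^esub>\<close> below.\<close>

definition unif_expectation :: "'a set \<Rightarrow> ('a \<Rightarrow> real) \<Rightarrow> real" where
  "unif_expectation A f = measure_pmf.expectation (pmf_of_set A) f"

definition unif_norm :: "'a set \<Rightarrow> real \<Rightarrow> ('a \<Rightarrow> real) \<Rightarrow> real" where
  "unif_norm A p f = (unif_expectation A (\<lambda>x. \<bar>f x\<bar> powr p)) powr (1 / p)"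

definition sym_inner :: "nat \<Rightarrow> ((nat \<Rightarrow> nat) \<Rightarrow> real) \<Rightarrow> ((nat \<Rightarrow> nat) \<Rightarrow> real) \<Rightarrow> real" where
  "sym_inner n f g = unif_expectation (sym_grp n) (\<lambda>\<sigma>. f \<sigma> * g \<sigma>)"

definition sym_norm :: "nat \<Rightarrow> real \<Rightarrow> ((nat \<Rightarrow> nat) \<Rightarrow> real) \<Rightarrow> real" where
  "sym_norm n p f = unif_norm (sym_grp n) p f"

definition left_act :: "(nat \<Rightarrow> nat) \<Rightarrow> ((nat \<Rightarrow> nat) \<Rightarrow> real) \<Rightarrow> ((nat \<Rightarrow> nat) \<Rightarrow> real)" where
  "left_act \<sigma> f = (\<lambda>x. f (inv \<sigma> \<circ> x))"

definition right_act :: "(nat \<Rightarrow> nat) \<Rightarrow> ((nat \<Rightarrow> nat) \<Rightarrow> real) \<Rightarrow> ((nat \<Rightarrow> nat) \<Rightarrow> real)" where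
  "right_act \<sigma> f = (\<lambda>x. f (x \<circ> \<sigma>))"

definition distinct_tuples :: "nat \<Rightarrow> nat \<Rightarrow> nat list set" where
  "distinct_tuples n t = {I. length I = t \<and> distinct I \<and> set I \<subseteq> {1..n}}"

definition umvirate :: "nat \<Rightarrow> nat list \<Rightarrow> nat list \<Rightarrow> (nat \<Rightarrow> nat) set" where
  "umvirate n I J = {\<sigma> \<in> sym_grp n. \<forall>s < length I. \<sigma> (I ! s) = J ! s}"

definition is_global :: "nat \<Rightarrow> real \<Rightarrow> real \<Rightarrow> ((nat \<Rightarrow> nat) \<Rightarrow> real) \<Rightarrow> bool" where
  "is_global n r \<gamma> f \<longleftrightarrow>
     (\<forall>t. \<forall>I \<in> distinct_tuples n t. \<forall>J \<in> distinct_tuples n t.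
        unif_norm (umvirate n I J) 2 f \<le> r ^ t * \<gamma>)"

definition x_ind :: "nat \<Rightarrow> nat \<Rightarrow> (nat \<Rightarrow> nat) \<Rightarrow> real" where
  "x_ind i j \<sigma> = (if \<sigma> i = j then 1 else 0)"

text \<open>A polynomial in the variables indexed by \<open>[n] \<times> [n]\<close> is given by a finite set \<open>M\<close> of exponent
  vectors together with coefficients \<open>c\<close>; each monomial must have total degree at most \<open>d\<close>.\<close>

definition V_le :: "nat \<Rightarrow> nat \<Rightarrow> ((nat \<Rightarrow> nat) \<Rightarrow> real) set" where
  "V_le n d = {f \<in> L2_sym n. \<exists>(M :: (nat \<times> nat \<Rightarrow> nat) set) (c :: (nat \<times> nat \<Rightarrow> nat) \<Rightarrow> real).
     finite M \<and>
     (\<forall>m \<in> M. (\<Sum>v \<in> {1..n} \<times> {1..n}. m v) \<le> d) \<and>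
     (\<forall>\<sigma> \<in> sym_grp n. f \<sigma> = (\<Sum>m \<in> M. c m * (\<Prod>(i, j) \<in> {1..n} \<times> {1..n}. x_ind i j \<sigma> ^ m (i, j))))}"

definition linear_operator_L2 ::
    "nat \<Rightarrow> (((nat \<Rightarrow> nat) \<Rightarrow> real) \<Rightarrow> ((nat \<Rightarrow> nat) \<Rightarrow> real)) \<Rightarrow> bool" where
  "linear_operator_L2 n T \<longleftrightarrow>
     T \<in> L2_sym n \<rightarrow> L2_sym n \<and>
     (\<forall>f \<in> L2_sym n. \<forall>g \<in> L2_sym n. T (\<lambda>\<sigma>. f \<sigma> + g \<sigma>) = (\<lambda>\<sigma>. T f \<sigma> + T g \<sigma>)) \<and>
     (\<forall>a. \<forall>f \<in> L2_sym n. T (\<lambda>\<sigma>. a * f \<sigma>) = (\<lambda>\<sigma>. a * T f \<sigma>))"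

definition self_adjoint_L2 ::
    "nat \<Rightarrow> (((nat \<Rightarrow> nat) \<Rightarrow> real) \<Rightarrow> ((nat \<Rightarrow> nat) \<Rightarrow> real)) \<Rightarrow> bool" where
  "self_adjoint_L2 n T \<longleftrightarrow>
     (\<forall>f \<in> L2_sym n. \<forall>g \<in> L2_sym n. sym_inner n (T f) g = sym_inner n f (T g))"

definition commutes_with_actions ::
    "nat \<Rightarrow> (((nat \<Rightarrow> nat) \<Rightarrow> real) \<Rightarrow> ((nat \<Rightarrow> nat) \<Rightarrow> real)) \<Rightarrow> bool" where
  "commutes_with_actions n T \<longleftrightarrow>
     (\<forall>\<sigma> \<in> sym_grp n. \<forall>f \<in> L2_sym n.
        T (left_act \<sigma> f) = left_act \<sigma> (T f) \<and> T (right_act \<sigma> f) = right_act \<sigma> (T f))"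

end

theory Submission
  imports Defs
begin

text \<open>
  Draw \<open>N = n div 16\<close> independent uniform pairs \<open>y\<^sub>1, \<dots>, y\<^sub>N\<close> in \<open>[n] \<times> [n]\<close>, keep those sharing neither
  row nor column with another one, and let \<open>\<sigma>\<close> be uniform among the permutations whose graph
  contains the kept pairs. With \<open>C f y = \<bbbE>[f(\<sigma>) | y]\<close> and the noise operator on the \<open>y\<close>-space, put
  \<open>T\<^sub>\<rho> = C\<^sup>* \<circ> noise (\<rho>/2) \<circ> C\<close>; the construction is invariant under relabelling rows and columns.

  Upper bound: given some of the pairs, the law of \<open>\<sigma>\<close> is a mixture of uniform laws on sets
  \<open>U\<^bsub>I\<rightarrow>J\<^esub>\<close> with no more edges than there are given pairs (by Vandermonde's identity), so \<open>C f\<close>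
  inherits the globalness of \<open>f\<close>. On the product space hypercontractivity follows by induction on
  the coordinates from a scalar inequality; each step either moves a coordinate into the inner
  \<open>L\<^sup>2\<close> norm or replaces \<open>f\<close> by its derivative \<open>f - \<bbbE>\<^sub>i f\<close>, which costs a factor \<open>1 + r\<close> in globalness.

  Lower bound: for \<open>f\<close> of degree \<open>d\<close> orthogonal to lower degrees only the \<open>d\<close>-th level of \<open>C f\<close> is
  needed. The expectations of \<open>f\<close> on the sets \<open>U M\<close>, \<open>M\<close> a perfect matching between given rows and
  columns, are related to that level and to the norm of \<open>f\<close> by sums of averages over groups of
  column permutations. These are positive semidefinite, so all but their leading terms can be dropped.
\<close>

section \<open>Averages over independent coordinates\<close>

text \<open>The values of a random permutation are dependent, so product-space hypercontractivity
  does not apply to them directly. Dropping both partners of a conflict, not just one, keeps the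
  coupling free of any order on the positions; this symmetry makes \<sigma> exactly uniform and the
  kept pairs a uniform matching.

  The constants are a price per degree. With N about n/16, choosing positions costs 1/17, a quotient
  of factorials 17/18, and survival of the chosen pairs 1/2, together 1/36; the halved noise rate
  makes this 1/72. The halving is there because a derivative costs 1 + r in globalness, which is at
  most 2r if r \<ge> 1. For r < 1 another argument is used: fixing all n values bounds |f| by
  \<gamma>, and it is enough that the noise is a contraction.

  The eigenvalues of the operator are never computed. Commuting with the left action already forces
  it to preserve orthogonality to lower degrees, so the lower bound can be proved one degree at a
  time.\<close>

lemma convex_on_powr_nonneg:
  assumes q: "q \<ge> (1::real)"
  shows "convex_on {0..} (\<lambda>x::real. x powr q)"
proof (rule convex_onI)
  have half: "(t * x) powr q \<le> t * x powr q" if "0 < t" "t < 1" "0 \<le> x" for t x :: real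
    using that q powr_mono'[of 1 q t] by (simp add: powr_mult mult_right_mono)
  fix t x y :: real
  assume t: "0 < t" "t < 1" and xy: "x \<in> {0..}" "y \<in> {0..}"
  show "((1 - t) *\<^sub>R x + t *\<^sub>R y) powr q \<le> (1 - t) * x powr q + t * y powr q"
  \<comment> \<open>At two positive points this is \<open>powr_convex\<close>. If one point is 0,
    its power is 0 and the claim shrinks to \<open>half\<close>.\<close>
  proof (cases "x = 0 \<or> y = 0")
    case True
    then show ?thesis using half[of t y] half[of "1 - t" x] t xy q by auto
  next
    case False
    then show ?thesis
      using convex_onD[OF powr_convex[OF q], of t x y] t xy by auto
  qed
qed simp

locale finite_alphabet =
  fixes Om :: "'w set"
  assumes fin_Om: "finite Om" and ne_Om: "Om \<noteq> {}"
begin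

lemma card_Om: "real (card Om) > 0"
  using fin_Om ne_Om by (simp add: card_gt_0_iff)

text \<open>Resampling coordinate \<open>i\<close> is conditional expectation given the others. The
  result stays a function of all coordinates, so that such averages compose freely.\<close>

definition av :: "nat \<Rightarrow> ((nat \<Rightarrow> 'w) \<Rightarrow> real) \<Rightarrow> (nat \<Rightarrow> 'w) \<Rightarrow> real" where
  "av i f y = (\<Sum>w\<in>Om. f (y(i := w))) / real (card Om)"

text \<open>The fold does not depend on an order because the \<open>av i\<close> commute; they are
  also idempotent, so overlapping unions cause no trouble.\<close>

definition Av :: "nat set \<Rightarrow> ((nat \<Rightarrow> 'w) \<Rightarrow> real) \<Rightarrow> (nat \<Rightarrow> 'w) \<Rightarrow> real" where
  "Av A f = Finite_Set.fold av f A"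

definition valid :: "(nat \<Rightarrow> 'w) set" where
  "valid = {y. \<forall>i. y i \<in> Om}"

lemma valid_upd: "y \<in> valid \<Longrightarrow> w \<in> Om \<Longrightarrow> y(i := w) \<in> valid"
  by (auto simp: valid_def)

lemma av_av_same: "av i (av i f) = av i f"
  using card_Om by (auto simp: av_def fun_eq_iff)

lemma av_commute: "av i (av j f) = av j (av i f)"
proof (cases "i = j")
  case False
  show ?thesis
  proof
    fix y
    have "av i (av j f) y = (\<Sum>v\<in>Om. \<Sum>w\<in>Om. f (y(i := v, j := w))) / real (card Om) / real (card Om)"
      by (simp add: av_def sum_divide_distrib)
    also have "\<dots> = (\<Sum>w\<in>Om. \<Sum>v\<in>Om. f (y(j := w, i := v))) / real (card Om) / real (card Om)"
      by (subst sum.swap) (simp add: fun_upd_twist[OF False])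
    also have "\<dots> = av j (av i f) y"
      by (simp add: av_def sum_divide_distrib)
    finally show "av i (av j f) y = av j (av i f) y" .
  qed
qed simp

lemma comp_fun_idem_av: "comp_fun_idem av"
  by standard (simp_all add: fun_eq_iff av_commute av_av_same)

interpretation avf: comp_fun_idem av
  by (rule comp_fun_idem_av)

lemma Av_empty [simp]: "Av {} f = f"
  by (simp add: Av_def)

lemma Av_insert: "finite A \<Longrightarrow> Av (insert i A) f = av i (Av A f)"
  by (simp add: Av_def avf.fold_insert_idem)

lemma Av_insert2: "finite A \<Longrightarrow> Av (insert i A) f = Av A (av i f)"
  by (induction A rule: finite_induct) (auto simp: Av_insert insert_commute[of i] av_commute[of i])

lemma Av_Un: "finite A \<Longrightarrow> finite B \<Longrightarrow> Av (A \<union> B) f = Av A (Av B f)"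
  by (induction A rule: finite_induct) (auto simp: Av_insert)

lemma Av_av_commute: "finite A \<Longrightarrow> Av A (av i f) = av i (Av A f)"
  by (metis Av_insert Av_insert2)

lemma Av_absorb: "finite A \<Longrightarrow> i \<in> A \<Longrightarrow> Av A (av i f) = Av A f"
  by (metis Av_insert2 insert_absorb)

lemma av_absorb: "finite A \<Longrightarrow> i \<in> A \<Longrightarrow> av i (Av A f) = Av A f"
  by (metis Av_insert insert_absorb)

lemma Av_sum_form:
  assumes "finite A"
  shows "Av A f y = (\<Sum>z\<in>PiE A (\<lambda>_. Om). f (\<lambda>i. if i \<in> A then z i else y i)) / real (card Om) ^ card A"
  using assms
proof (induction A arbitrary: y rule: finite_induct)
  case (insert a A)
  let ?c = "real (card Om)"
  have "(\<Sum>z\<in>PiE (insert a A) (\<lambda>_. Om). f (\<lambda>i. if i \<in> insert a A then z i else y i))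
     = (\<Sum>p\<in>Om \<times> PiE A (\<lambda>_. Om). f (\<lambda>i. if i \<in> A then snd p i else (y(a := fst p)) i))"
  proof -
    have "f (\<lambda>i. if i \<in> insert a A then (g(a := w)) i else y i)
        = f (\<lambda>i. if i \<in> A then g i else (y(a := w)) i)" for g w
      using insert.hyps by (intro arg_cong[where f = f]) auto
    then show ?thesis
      unfolding PiE_insert_eq using insert.hyps
      by (subst sum.reindex[OF inj_combinator[OF insert.hyps(2)]])
         (auto intro!: sum.cong simp: case_prod_beta simp del: fun_upd_apply cong: if_cong)
  qed
  also have "\<dots> = (\<Sum>w\<in>Om. \<Sum>z\<in>PiE A (\<lambda>_. Om). f (\<lambda>i. if i \<in> A then z i else (y(a := w)) i))"
    by (subst sum.cartesian_product) (simp add: case_prod_beta)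
  also have "\<dots> = (\<Sum>w\<in>Om. Av A f (y(a := w)) * ?c ^ card A)"
    using card_Om by (simp add: insert.IH del: fun_upd_apply)
  also have "\<dots> = Av (insert a A) f y * ?c ^ card (insert a A)"
    using card_Om insert.hyps
    by (simp add: Av_insert av_def sum_distrib_right[symmetric])
  finally show ?case
    using card_Om by simp
qed simp

lemma Av_mono:
  assumes "finite A"
    and "\<And>z. (\<And>i. i \<notin> A \<Longrightarrow> z i = y i) \<Longrightarrow> (\<And>i. i \<in> A \<Longrightarrow> z i \<in> Om) \<Longrightarrow> f z \<le> g z"
  shows "Av A f y \<le> Av A g y"
  unfolding Av_sum_form[OF assms(1)]
  by (intro divide_right_mono sum_mono assms(2)) (auto simp: PiE_iff)

lemma Av_cong:
  assumes "finite A"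
    and "\<And>z. (\<And>i. i \<notin> A \<Longrightarrow> z i = y i) \<Longrightarrow> (\<And>i. i \<in> A \<Longrightarrow> z i \<in> Om) \<Longrightarrow> f z = g z"
  shows "Av A f y = Av A g y"
  by (rule antisym; rule Av_mono; use assms in force)

lemma Av_mono_valid:
  assumes "finite A" "y \<in> valid" and "\<And>z. z \<in> valid \<Longrightarrow> f z \<le> g z"
  shows "Av A f y \<le> Av A g y"
proof (rule Av_mono[OF assms(1)])
  fix z assume z: "\<And>i. i \<notin> A \<Longrightarrow> z i = y i" "\<And>i. i \<in> A \<Longrightarrow> z i \<in> Om"
  have "z i \<in> Om" for i
    using z assms(2) by (cases "i \<in> A") (auto simp: valid_def)
  then show "f z \<le> g z" by (intro assms(3)) (simp add: valid_def)
qed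

lemma Av_cong_valid:
  assumes "finite A" "y \<in> valid" and "\<And>z. z \<in> valid \<Longrightarrow> f z = g z"
  shows "Av A f y = Av A g y"
  by (rule antisym; rule Av_mono_valid) (use assms in auto)

lemma av_eq_Av: "av i f = Av {i} f"
  by (simp add: Av_insert)

lemma av_mono_valid:
  assumes "y \<in> valid" and "\<And>z. z \<in> valid \<Longrightarrow> f z \<le> g z"
  shows "av i f y \<le> av i g y"
  unfolding av_eq_Av using assms by (intro Av_mono_valid) auto

lemma Av_const [simp]: "finite A \<Longrightarrow> Av A (\<lambda>_. c) y = c"
  using card_Om by (simp add: Av_sum_form card_PiE)

lemma Av_add: "finite A \<Longrightarrow> Av A (\<lambda>z. f z + g z) y = Av A f y + Av A g y"
  by (simp add: Av_sum_form sum.distrib add_divide_distrib)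

lemma Av_diff: "finite A \<Longrightarrow> Av A (\<lambda>z. f z - g z) y = Av A f y - Av A g y"
  by (simp add: Av_sum_form sum_subtractf diff_divide_distrib)

lemma Av_cmult: "finite A \<Longrightarrow> Av A (\<lambda>z. c * f z) y = c * Av A f y"
  by (simp add: Av_sum_form sum_distrib_left)

lemma Av_sum: "finite A \<Longrightarrow> finite X \<Longrightarrow> Av A (\<lambda>z. \<Sum>x\<in>X. f x z) y = (\<Sum>x\<in>X. Av A (f x) y)"
  by (simp add: Av_sum_form sum.swap[of _ _ X] sum_divide_distrib)

lemma Av_nonneg_valid:
  assumes "finite A" "y \<in> valid" "\<And>z. z \<in> valid \<Longrightarrow> 0 \<le> f z"
  shows "0 \<le> Av A f y"
  using Av_mono_valid[OF assms(1,2), of "\<lambda>_. 0" f] assms by simp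

lemma Av_indep:
  assumes "finite A" "\<And>i. i \<notin> A \<Longrightarrow> y i = z i"
  shows "Av A f y = Av A f z"
proof -
  have "(\<lambda>i. if i \<in> A then x i else y i) = (\<lambda>i. if i \<in> A then x i else z i)" for x
    using assms(2) by auto
  then show ?thesis using assms(1) by (simp add: Av_sum_form)
qed

lemma Av_mult_indep:
  assumes "finite A" and "\<And>z. (\<And>i. i \<notin> A \<Longrightarrow> z i = y i) \<Longrightarrow> f z = f y"
  shows "Av A (\<lambda>z. f z * g z) y = f y * Av A g y"
proof -
  have "f (\<lambda>i. if i \<in> A then z i else y i) = f y" for z
    by (rule assms(2)) auto
  then show ?thesis using assms(1) by (simp add: Av_sum_form sum_distrib_left)
qed

lemmas av_add = Av_add[of "{i}" for i, folded av_eq_Av, simplified]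
lemmas av_diff = Av_diff[of "{i}" for i, folded av_eq_Av, simplified]
lemmas av_cmult = Av_cmult[of "{i}" for i, folded av_eq_Av, simplified]
lemmas av_const = Av_const[of "{i}" for i, folded av_eq_Av, simplified]

lemma av_upd: "av i f (y(i := w)) = av i f y"
  by (simp add: av_def)

lemma av_mult_indep:
  assumes "\<And>w. f (y(i := w)) = f y"
  shows "av i (\<lambda>z. f z * g z) y = f y * av i g y"
  using assms by (simp add: av_def sum_distrib_left)

text \<open>A factor independent of the coordinates in \<open>B\<close> pulls out of the average
  over \<open>B\<close>, so both sides equal the average over \<open>A\<close> of
  \<open>Av B f * Av B g\<close>.\<close>

lemma Av_self_adjoint:
  assumes "finite A" "B \<subseteq> A"
  shows "Av A (\<lambda>z. f z * Av B g z) y = Av A (\<lambda>z. Av B f z * g z) y"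
proof -
  have B: "finite B" using assms finite_subset by auto
  have AB: "A \<union> B = A" using assms by auto
  have *: "Av B (\<lambda>z. f z * Av B g z) = (\<lambda>z. Av B f z * Av B g z)" for f g
  proof
    fix z
    have "Av B (\<lambda>z. Av B g z * f z) z = Av B g z * Av B f z"
      by (rule Av_mult_indep[OF B]) (auto intro!: Av_indep[OF B])
    then show "Av B (\<lambda>z. f z * Av B g z) z = Av B f z * Av B g z"
      by (simp add: mult.commute)
  qed
  have "Av A (\<lambda>z. f z * Av B g z) = Av A (Av B (\<lambda>z. f z * Av B g z))"
    by (metis AB Av_Un B assms(1))
  also have "\<dots> = Av A (Av B (\<lambda>z. g z * Av B f z))"
    unfolding * by (simp add: mult.commute)
  also have "\<dots> = Av A (\<lambda>z. g z * Av B f z)"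
    by (metis AB Av_Un B assms(1))
  finally show ?thesis by (simp add: mult.commute)
qed

lemma Av_Cauchy_Schwarz:
  assumes A: "finite A"
  shows "(Av A (\<lambda>z. f z * g z) y)\<^sup>2 \<le> Av A (\<lambda>z. (f z)\<^sup>2) y * Av A (\<lambda>z. (g z)\<^sup>2) y"
proof -
  let ?Z = "PiE A (\<lambda>_. Om)"
  define F where "F z = f (\<lambda>i. if i \<in> A then z i else y i)" for z
  define G where "G z = g (\<lambda>i. if i \<in> A then z i else y i)" for z
  have "(\<Sum>z\<in>?Z. F z * G z)\<^sup>2 \<le> (\<Sum>z\<in>?Z. (F z)\<^sup>2) * (\<Sum>z\<in>?Z. (G z)\<^sup>2)"
    by (rule Cauchy_Schwarz_ineq_sum)
  then show ?thesis
    using card_Om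
    by (simp add: Av_sum_form[OF A] F_def[symmetric] G_def[symmetric] power_divide
        divide_right_mono power2_eq_square[of "_ ^ card A"])
qed

text \<open>\<open>k\<close> is a probability density: the constant 1 for one step of the noise, and
  the kernel of the adjoint of \<open>C\<close> for the operator on permutations.\<close>

lemma Av_Jensen_powr:
  assumes A: "finite A" and y: "y \<in> valid" and q: "q \<ge> 1" and k: "\<And>z. z \<in> valid \<Longrightarrow> 0 \<le> k z" and k1: "Av A k y = 1"
  shows "\<bar>Av A (\<lambda>z. k z * f z) y\<bar> powr q \<le> Av A (\<lambda>z. k z * \<bar>f z\<bar> powr q) y"
proof -
  let ?Z = "PiE A (\<lambda>_. Om)"
  let ?m = "\<lambda>z. (\<lambda>i. if i \<in> A then z i else y i)"
  let ?c = "real (card Om) ^ card A"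
  define w where "w z = k (?m z) / ?c" for z
  have c: "?c > 0" using card_Om by simp
  have fin: "finite ?Z" using A fin_Om by (simp add: finite_PiE)
  have ne: "?Z \<noteq> {}" using ne_Om by (simp add: PiE_eq_empty_iff)
  have w0: "0 \<le> w z" if "z \<in> ?Z" for z
    unfolding w_def using that y by (intro divide_nonneg_nonneg k) (auto simp: valid_def PiE_iff)
  have w1: "(\<Sum>z\<in>?Z. w z) = 1"
    using k1 by (simp add: Av_sum_form[OF A] w_def sum_divide_distrib)
  have form: "Av A (\<lambda>z. k z * h z) y = (\<Sum>z\<in>?Z. w z * h (?m z))" for h
    by (simp add: Av_sum_form[OF A] w_def sum_divide_distrib)
  have cv: "convex_on {0..} (\<lambda>x::real. x powr q)"
    using q by (rule convex_on_powr_nonneg)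
  have "\<bar>\<Sum>z\<in>?Z. w z * f (?m z)\<bar> \<le> (\<Sum>z\<in>?Z. w z * \<bar>f (?m z)\<bar>)"
    by (rule order_trans[OF sum_abs]) (auto intro!: sum_mono simp: abs_mult w0)
  then have "\<bar>\<Sum>z\<in>?Z. w z * f (?m z)\<bar> powr q \<le> (\<Sum>z\<in>?Z. w z * \<bar>f (?m z)\<bar>) powr q"
    using q by (intro powr_mono2) auto
  also have "\<dots> \<le> (\<Sum>z\<in>?Z. w z * \<bar>f (?m z)\<bar> powr q)"
    using convex_on_sum[OF fin ne cv w1, of "\<lambda>z. \<bar>f (?m z)\<bar>"] w0 by simp
  finally show ?thesis unfolding form .
qed

end

section \<open>Hypercontractivity of the noise operator on a product space\<close>

lemma ln_powr_bound:
  assumes "q \<ge> (2::real)"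
  shows "(ln q)\<^sup>2 * q powr (1/4) \<le> 16 * q"
proof -
  have q: "q > 0" "q \<ge> 1" using assms by auto
  \<comment> \<open>The logarithm of a fourth root trades \<open>ln q\<close> for
    \<open>4 * q powr (1/4)\<close>; the product then has exponent 3/4, which is below 1.\<close>
  have "ln q = 4 * ln (q powr (1/4))" using q by (simp add: ln_powr)
  also have "\<dots> \<le> 4 * q powr (1/4)" using q ln_bound[of "q powr (1/4)"] by simp
  finally have "(ln q)\<^sup>2 \<le> (4 * q powr (1/4))\<^sup>2"
    using q by (intro power_mono) auto
  also have "\<dots> = 16 * q powr (1/2)"
    using q by (simp add: power_mult_distrib powr_power)
  finally have "(ln q)\<^sup>2 * q powr (1/4) \<le> 16 * q powr (1/2) * q powr (1/4)"
    by (intro mult_right_mono) auto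
  also have "\<dots> = 16 * q powr (3/4)" by (simp add: powr_add[symmetric])
  also have "\<dots> \<le> 16 * q powr 1" using q by (intro mult_left_mono powr_mono) auto
  finally show ?thesis using q by simp
qed

text \<open>Taylor's formula with a crude bound on the second derivative. On either side of 0 the
  difference of the two sides starts at 0 and does not decrease as |v| grows.\<close>

lemma exp_le_second_order: "exp v \<le> 1 + v + v\<^sup>2 / 2 * exp \<bar>v\<bar>" for v :: real
proof (cases "0 \<le> v")
  case True
  define h where "h x = 1 + x + x\<^sup>2 / 2 * exp x - exp x" for x :: real
  have "h 0 \<le> h v"
  proof (rule DERIV_nonneg_imp_nondecreasing[OF True])
    fix x :: real assume x: "0 \<le> x" "x \<le> v"
    have "(h has_real_derivative (1 + (x + x\<^sup>2 / 2) * exp x - exp x)) (at x)"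
      unfolding h_def by (auto intro!: derivative_eq_intros simp: algebra_simps)
    moreover have "exp x * (1 - x) \<le> 1"
      using exp_ge_add_one_self[of "-x"] by (simp add: exp_minus field_simps)
    then have "0 \<le> 1 + (x + x\<^sup>2 / 2) * exp x - exp x"
      by (smt (verit) exp_gt_zero mult_nonneg_nonneg zero_le_power2 distrib_right right_diff_distrib mult.commute mult_cancel_left1 divide_nonneg_nonneg)
    ultimately show "\<exists>y. (h has_real_derivative y) (at x) \<and> 0 \<le> y" by blast
  qed
  then show ?thesis using True by (simp add: h_def)
next
  case False
  define h where "h x = 1 - x + x\<^sup>2 / 2 * exp x - exp (- x)" for x :: real
  have nv: "0 \<le> - v" using False by simp
  have "h 0 \<le> h (- v)"
  proof (rule DERIV_nonneg_imp_nondecreasing[OF nv])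
    fix x :: real assume x: "0 \<le> x" "x \<le> - v"
    have "(h has_real_derivative (- 1 + (x + x\<^sup>2 / 2) * exp x + exp (- x))) (at x)"
      unfolding h_def by (auto intro!: derivative_eq_intros simp: algebra_simps)
    moreover have "x * 1 \<le> (x + x\<^sup>2 / 2) * exp x" using x by (intro mult_mono) auto
    then have "0 \<le> - 1 + (x + x\<^sup>2 / 2) * exp x + exp (- x)"
      using exp_ge_add_one_self[of "- x"] by simp
    ultimately show "\<exists>y. (h has_real_derivative y) (at x) \<and> 0 \<le> y" by blast
  qed
  then show ?thesis using False by (simp add: h_def)
qed

lemma bernoulli_powr:
  assumes "(0::real) \<le> t" "1 \<le> p"
  shows "1 + p * t \<le> (1 + t) powr p"
proof -
  define h where "h t = (1 + t) powr p - (1 + p * t)" for t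
  have "h 0 \<le> h t"
  proof (rule DERIV_nonneg_imp_nondecreasing[OF assms(1)])
    fix x assume x: "0 \<le> x" "x \<le> t"
    have "(h has_real_derivative (p * (1 + x) powr (p - 1) - p)) (at x)"
      unfolding h_def using x by (auto intro!: derivative_eq_intros)
    moreover have "0 \<le> p * (1 + x) powr (p - 1) - p"
      using assms x ge_one_powr_ge_zero[of "1 + x" "p - 1"] mult_left_mono[of 1 "(1 + x) powr (p - 1)" p] by simp
    ultimately show "\<exists>y. (h has_real_derivative y) (at x) \<and> 0 \<le> y" by blast
  qed
  then show ?thesis by (simp add: h_def)
qed
text \<open>This is the case A = 1 of \<open>two_point_bound\<close>, with \<open>x\<close> the size
  of the derivative part and \<open>w\<close> a bound for it after noise. Put
  \<open>z = x / s\<close>. If \<open>z\<close> is large, the last summand alone bounds the left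
  side. Otherwise \<open>z\<close> is bounded, and a second-order expansion leaves an error that
  \<open>q / 4 * x\<^sup>2\<close> absorbs.\<close>

lemma two_point_bound_normalized:
  fixes q s w x b :: real
  assumes q: "q \<ge> 2" and s: "s \<ge> 2" and x: "x \<ge> 0" and w: "w \<le> x / s * (ln q / (16 * q))" and b: "\<bar>b\<bar> \<le> w"
  shows "(1 + 2 * b + w\<^sup>2) powr (q / 2) \<le> 1 + q * b + q / 4 * x\<^sup>2 + (x / s) powr q"
proof -
  define z where "z = x / s"
  define t where "t = ln q / (16 * q)"
  have w0: "0 \<le> w" using b by simp
  have z: "z \<ge> 0" using x s by (simp add: z_def)
  have lnq: "0 < ln q" "ln q \<le> q" using q ln_bound[of q] by auto
  have t: "0 < t" "t \<le> 1/16" using lnq q by (auto simp: t_def field_simps)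
  have wz: "w \<le> z * t" using w by (simp add: z_def t_def)
  have qw: "q * w \<le> ln q / 16 * z"
    using mult_left_mono[OF wz, of q] q by (simp add: t_def field_simps)
  have zx: "4 * z\<^sup>2 \<le> x\<^sup>2"
  proof -
    have "2 * z \<le> x" using s x mult_right_mono[of 2 s x] by (simp add: z_def field_simps)
    then have "(2 * z)\<^sup>2 \<le> x\<^sup>2" using z by (intro power_mono) auto
    then show ?thesis by (simp add: power_mult_distrib)
  qed
  have qzx: "q * z\<^sup>2 \<le> q / 4 * x\<^sup>2" using mult_left_mono[OF zx, of "q / 4"] q by simp
  have pos: "0 \<le> 1 + 2 * b + w\<^sup>2"
    using b zero_le_power2[of "1 - w"] by (simp add: power2_eq_square algebra_simps)
  show ?thesis
  proof (cases "1 + z * t \<le> z")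
    case True
    have z1: "1 \<le> z" using True z t mult_nonneg_nonneg[of z t] by linarith
    have "1 + 2 * b + w\<^sup>2 \<le> (1 + w)\<^sup>2" using b by (simp add: power2_eq_square algebra_simps)
    also have "\<dots> \<le> z\<^sup>2" using wz True w0 by (intro power_mono) auto
    finally have "(1 + 2 * b + w\<^sup>2) powr (q / 2) \<le> (z\<^sup>2) powr (q / 2)"
      using pos q by (intro powr_mono2) auto
    also have "\<dots> = z powr q" using z1 by (simp add: powr_powr flip: powr_numeral)
    finally have 1: "(1 + 2 * b + w\<^sup>2) powr (q / 2) \<le> z powr q" .
    have "ln q / 16 * z \<le> q * z\<^sup>2"
      using lnq z1 q mult_left_mono[OF z1, of z]
      by (intro mult_mono) (auto simp: power2_eq_square)
    moreover have "- (q * w) \<le> q * b" using mult_left_mono[of "-w" b q] b q by simp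
    ultimately have "0 \<le> q * b + q / 4 * x\<^sup>2" using qw qzx by linarith
    then show ?thesis using 1 by (simp add: z_def)
  next
    case False
    have "z * (1 - t) < 1" using False by (simp add: algebra_simps)
    moreover have "z * (15/16) \<le> z * (1 - t)" using t z by (intro mult_left_mono) auto
    ultimately have z2: "z \<le> 2" by simp
    \<comment> \<open>\<open>m\<close> is the exponent obtained from 1 + v \<le> exp v. Having |m|
      \<le> ln q / 4 keeps \<open>exp \<bar>m\<bar>\<close> below \<open>q powr (1/4)\<close>, the
      power that \<open>ln_powr_bound\<close> can absorb.\<close>
    define m where "m = q / 2 * (2 * b + w\<^sup>2)"
    have w8: "w \<le> 1/8" using wz mult_mono[OF z2 t(2)] t by simp
    have w2: "w\<^sup>2 \<le> w / 8" using mult_left_mono[OF w8 w0] by (simp add: power2_eq_square)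
    have "\<bar>2 * b + w\<^sup>2\<bar> \<le> 17/8 * w" using b w2 zero_le_power2[of w] by linarith
    then have "\<bar>m\<bar> \<le> q / 2 * (17/8 * w)"
      using q by (simp add: m_def abs_mult)
    also have "\<dots> = 17/16 * (q * w)" by simp
    also have "\<dots> \<le> 17/16 * (ln q / 16 * z)" using qw by (intro mult_left_mono) auto
    also have "\<dots> \<le> ln q / 15 * z" using lnq z by (simp add: mult_right_mono)
    finally have m: "\<bar>m\<bar> \<le> ln q / 15 * z" .
    also have "\<dots> \<le> ln q / 15 * 2" using z2 lnq q by (intro mult_left_mono) auto
    also have "\<dots> \<le> ln q / 4" using lnq by linarith
    finally have "exp \<bar>m\<bar> \<le> exp (ln q / 4)" by simp
    then have e: "exp \<bar>m\<bar> \<le> q powr (1/4)" using q by (simp add: powr_def)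
    have sq: "m\<^sup>2 \<le> (ln q / 15 * z)\<^sup>2" using m by (metis abs_ge_zero power2_abs power_mono)
    have q1: "1 \<le> q powr (1/4)" using q by (simp add: ge_one_powr_ge_zero)
    have "q / 2 * w\<^sup>2 \<le> q / 2 * (z * t)\<^sup>2" using wz w0 q by (intro mult_left_mono power_mono) auto
    also have "\<dots> = (ln q)\<^sup>2 * z\<^sup>2 / 512 * (1 / q)" using q by (simp add: t_def power2_eq_square)
    also have "\<dots> \<le> (ln q)\<^sup>2 * z\<^sup>2 / 512 * q powr (1/4)"
      using q q1 by (intro mult_left_mono order_trans[OF _ q1]) auto
    finally have r2: "q / 2 * w\<^sup>2 \<le> (ln q)\<^sup>2 * z\<^sup>2 / 512 * q powr (1/4)" .
    have r3: "m\<^sup>2 / 2 * exp \<bar>m\<bar> \<le> (ln q / 15 * z)\<^sup>2 / 2 * q powr (1/4)"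
      using sq e by (intro mult_mono) auto
    have "(1 + 2 * b + w\<^sup>2) powr (q / 2) \<le> exp (2 * b + w\<^sup>2) powr (q / 2)"
      using q pos exp_ge_add_one_self[of "2 * b + w\<^sup>2"] by (intro powr_mono2) (auto simp: add.assoc)
    also have "\<dots> = exp m" by (simp add: exp_powr_real m_def mult.commute)
    also have "\<dots> \<le> 1 + m + m\<^sup>2 / 2 * exp \<bar>m\<bar>" by (rule exp_le_second_order)
    also have "m = q * b + q / 2 * w\<^sup>2" by (simp add: m_def algebra_simps)
    finally have "(1 + 2 * b + w\<^sup>2) powr (q / 2)
        \<le> 1 + q * b + (ln q)\<^sup>2 * z\<^sup>2 / 512 * q powr (1/4) + (ln q / 15 * z)\<^sup>2 / 2 * q powr (1/4)"
      using r2 r3 by (simp add: m_def algebra_simps)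
    \<comment> \<open>1/512 comes from \<open>q / 2 * w\<^sup>2\<close> and 1/450 from the quadratic
      Taylor term; their sum is below 1/16, which cancels the 16 of
      \<open>ln_powr_bound\<close>.\<close>
    also have "\<dots> = 1 + q * b + ((ln q)\<^sup>2 * q powr (1/4)) * z\<^sup>2 * (1/512 + 1/450)"
      by (simp add: power_mult_distrib power_divide algebra_simps)
    also have "\<dots> \<le> 1 + q * b + (16 * q) * z\<^sup>2 * (1/16)"
      using ln_powr_bound[OF q] q
      by (intro add_left_mono mult_mono[of "_ * z\<^sup>2"] mult_right_mono[of _ _ "z\<^sup>2"]) auto
    finally have "(1 + 2 * b + w\<^sup>2) powr (q / 2) \<le> 1 + q * b + q * z\<^sup>2" by simp
    moreover have "0 \<le> (x / s) powr q" by simp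
    ultimately show ?thesis using qzx by linarith
  qed
qed

text \<open>The linear term \<open>u\<close> averages out in the application, so only the two last summands are losses.\<close>

lemma two_point_bound:
  fixes p s \<rho> A X u :: real
  assumes p: "p \<ge> 1" and s: "s \<ge> 2" and \<rho>: "\<rho> \<ge> 0" "\<rho> * s \<le> ln (2 * p) / (32 * p)"
    and A: "A \<ge> 0" and X: "X \<ge> 0" and u: "u\<^sup>2 \<le> A * X"
  shows "(A + 2 * \<rho> * u + \<rho>\<^sup>2 * X) powr p
    \<le> A powr p + 2 * p * \<rho> * u * A powr (p - 1) + p / 2 * X * A powr (p - 1) + X powr p / s powr (2 * p)"
proof (cases "A = 0")
  case True
  have "ln (2 * p) \<le> 2 * p" using ln_bound[of "2 * p"] p by simp
  then have "ln (2 * p) / (32 * p) \<le> 1" using p by (simp add: field_simps)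
  then have "\<rho> * s \<le> 1" using \<rho> by simp
  then have rs: "\<rho> \<le> 1 / s" using s by (simp add: field_simps)
  have "(\<rho>\<^sup>2 * X) powr p \<le> ((1/s)\<^sup>2 * X) powr p"
    using rs \<rho> X p by (intro powr_mono2 mult_right_mono power_mono) auto
  also have "\<dots> = X powr p / s powr (2 * p)"
    using s X by (simp add: powr_mult powr_powr power_divide powr_divide mult.commute flip: powr_numeral)
  finally show ?thesis using True u by simp
next
  case False
  then have A0: "A > 0" using A by simp
  \<comment> \<open>By homogeneity, division by \<open>A\<close> leaves one ratio
    \<open>x\<^sup>2 = X / A\<close> and a linear term \<open>b\<close>, which the assumption on
    \<open>u\<close> bounds by \<open>\<rho> * x\<close>.\<close>
  define x where "x = sqrt (X / A)"
  define b where "b = \<rho> * u / A"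
  have x: "x \<ge> 0" "x\<^sup>2 = X / A" using X A by (auto simp: x_def)
  have "(u / A)\<^sup>2 \<le> x\<^sup>2" using divide_right_mono[OF u, of "A\<^sup>2"] A0 unfolding x by (simp add: power_divide power2_eq_square)
  then have "\<bar>u / A\<bar> \<le> x" using x(1) by (metis abs_le_square_iff abs_of_nonneg)
  then have b: "\<bar>b\<bar> \<le> \<rho> * x"
    using \<rho> mult_left_mono[of "\<bar>u / A\<bar>" x \<rho>] by (simp add: b_def abs_mult)
  have "x * (\<rho> * s) \<le> x * (ln (2 * p) / (32 * p))" using \<rho> x by (intro mult_left_mono) auto
  then have "\<rho> * x \<le> x * (ln (2 * p) / (32 * p)) / s"
    using s by (simp only: pos_le_divide_eq) (simp add: mult_ac)
  then have w: "\<rho> * x \<le> x / s * (ln (2 * p) / (16 * (2 * p)))" by (simp add: mult_ac)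
  have "(1 + 2 * b + (\<rho> * x)\<^sup>2) powr (2 * p / 2) \<le> 1 + 2 * p * b + 2 * p / 4 * x\<^sup>2 + (x / s) powr (2 * p)"
    using p s x w b by (intro two_point_bound_normalized) auto
  then have main: "A powr p * (1 + 2 * b + (\<rho> * x)\<^sup>2) powr p
      \<le> A powr p * (1 + 2 * p * b + p / 2 * x\<^sup>2 + (x / s) powr (2 * p))"
    by (intro mult_left_mono) auto
  have pos: "0 \<le> 1 + 2 * b + (\<rho> * x)\<^sup>2"
    using b zero_le_power2[of "1 - \<rho> * x"] by (simp add: power2_eq_square algebra_simps)
  have "A * (1 + 2 * b + (\<rho> * x)\<^sup>2) = A + 2 * \<rho> * u + \<rho>\<^sup>2 * X"
    using A0 by (simp add: b_def x power_mult_distrib field_simps)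
  then have 1: "A powr p * (1 + 2 * b + (\<rho> * x)\<^sup>2) powr p = (A + 2 * \<rho> * u + \<rho>\<^sup>2 * X) powr p"
    using A0 pos by (simp add: powr_mult[symmetric])
  have 2: "A powr p = A * A powr (p - 1)" using A0 by (simp add: powr_mult_base)
  have "x powr (2 * p) = (x\<^sup>2) powr p"
    using x(1) by (simp add: powr_powr flip: powr_numeral)
  then have "(x / s) powr (2 * p) = (x\<^sup>2) powr p / s powr (2 * p)"
    using x(1) s by (simp add: powr_divide)
  also have "\<dots> = X powr p / A powr p / s powr (2 * p)"
    using X A by (simp add: x powr_divide)
  finally have 3: "A powr p * (x / s) powr (2 * p) = X powr p / s powr (2 * p)"
    using A0 by simp
  have "A powr p * (1 + 2 * p * b + p / 2 * x\<^sup>2 + (x / s) powr (2 * p))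
     = A powr p + 2 * p * (A powr p * b) + p / 2 * (A powr p * x\<^sup>2) + A powr p * (x / s) powr (2 * p)"
    by (simp add: algebra_simps)
  also have "A powr p * b = \<rho> * u * A powr (p - 1)" using A0 by (simp add: 2 b_def)
  also have "A powr p * x\<^sup>2 = X * A powr (p - 1)" using A0 by (simp add: 2 x)
  finally show ?thesis using main 1 3 by (simp add: mult.assoc)
qed

section \<open>The noise operator and its one-coordinate estimates\<close>

context finite_alphabet
begin

definition nz :: "real \<Rightarrow> nat \<Rightarrow> ((nat \<Rightarrow> 'w) \<Rightarrow> real) \<Rightarrow> (nat \<Rightarrow> 'w) \<Rightarrow> real" where
  "nz \<rho> i f = (\<lambda>y. \<rho> * f y + (1 - \<rho>) * av i f y)"

definition noise :: "real \<Rightarrow> nat list \<Rightarrow> ((nat \<Rightarrow> 'w) \<Rightarrow> real) \<Rightarrow> (nat \<Rightarrow> 'w) \<Rightarrow> real" where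
  "noise \<rho> is = foldr (nz \<rho>) is"

lemma noise_Nil [simp]: "noise \<rho> [] f = f"
  and noise_Cons [simp]: "noise \<rho> (i # is) f = nz \<rho> i (noise \<rho> is f)"
  by (simp_all add: noise_def)

lemma av_nz: "av j (nz \<rho> i f) = nz \<rho> i (av j f)"
  by (rule ext) (simp add: nz_def av_add av_cmult av_commute)

lemma av_noise: "av j (noise \<rho> is f) = noise \<rho> is (av j f)"
  by (induction "is") (simp_all add: av_nz)

lemma nz_nz: "nz a i (nz b j f) = nz b j (nz a i f)"
  by (rule ext, simp add: nz_def av_add av_cmult av_commute[of i j]) (simp add: algebra_simps)

lemma nz_noise: "nz a i (noise b is f) = noise b is (nz a i f)"
  by (induction "is") (simp, metis noise_Cons nz_nz)

lemma nz_add: "nz \<rho> i (\<lambda>y. f y + g y) = (\<lambda>y. nz \<rho> i f y + nz \<rho> i g y)"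
  by (simp add: nz_def fun_eq_iff av_add algebra_simps)

lemma nz_cmult: "nz \<rho> i (\<lambda>y. c * f y) = (\<lambda>y. c * nz \<rho> i f y)"
  by (simp add: nz_def fun_eq_iff av_cmult algebra_simps)

lemma noise_add: "noise \<rho> is (\<lambda>y. f y + g y) = (\<lambda>y. noise \<rho> is f y + noise \<rho> is g y)"
  by (induction "is") (simp_all add: nz_add)

lemma noise_cmult: "noise \<rho> is (\<lambda>y. c * f y) = (\<lambda>y. c * noise \<rho> is f y)"
  by (induction "is") (simp_all add: nz_cmult)

lemma noise_diff: "noise \<rho> is (\<lambda>y. f y - g y) = (\<lambda>y. noise \<rho> is f y - noise \<rho> is g y)"
  using noise_add[of \<rho> "is" f "\<lambda>y. -1 * g y"] noise_cmult[of \<rho> "is" "-1" g] by simp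

lemma nz_mult: "nz a i (nz b i f) = nz (a * b) i f"
  by (rule ext, simp add: nz_def av_add av_cmult av_av_same) (simp add: algebra_simps)

text \<open>The semigroup law makes the noise a square: rate sqrt \<rho> applied twice is rate
  \<rho>, so its quadratic form becomes a squared norm.\<close>

lemma noise_mult: "noise a is (noise b is f) = noise (a * b) is f"
proof (induction "is" arbitrary: f)
  case (Cons i js)
  have "noise a (i # js) (noise b (i # js) f) = nz a i (noise a js (nz b i (noise b js f)))" by simp
  also have "\<dots> = nz a i (nz b i (noise a js (noise b js f)))" by (simp only: nz_noise)
  also have "\<dots> = noise (a * b) (i # js) f" by (simp add: Cons.IH nz_mult)
  finally show ?case .
qed simp

lemma nz_expand: "nz \<theta> i g y = av i g y + \<theta> * (g y - av i g y)"
  by (simp add: nz_def algebra_simps)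

text \<open>Write \<open>g = av i g + (g - av i g)\<close>. The second part has mean 0 in coordinate
  \<open>i\<close> and is the only one scaled by \<open>nz \<theta> i\<close>, so all claims come
  from expanding a square. As \<open>A\<close> omits \<open>i\<close>, the cross term
  \<open>u\<close> disappears only after a further average over \<open>i\<close>; hence a pointwise
  and an averaged form.\<close>

lemma Av_nz_square:
  fixes g :: "(nat \<Rightarrow> 'w) \<Rightarrow> real"
  assumes A: "finite A" and i: "i \<notin> A"
  defines "a \<equiv> Av A (\<lambda>z. (av i g z)\<^sup>2)"
    and "u \<equiv> Av A (\<lambda>z. av i g z * (g z - av i g z))"
    and "x \<equiv> Av A (\<lambda>z. (g z - av i g z)\<^sup>2)"
  shows "Av A (\<lambda>z. (nz \<theta> i g z)\<^sup>2) y = a y + 2 * \<theta> * u y + \<theta>\<^sup>2 * x y"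
    and "av i (u) y = 0"
    and "a (y(i := w)) = a y"
    and "av i (Av A (\<lambda>z. (nz \<theta> i g z)\<^sup>2)) y = a y + \<theta>\<^sup>2 * av i (x) y"
proof -
  show 1: "Av A (\<lambda>z. (nz \<theta> i g z)\<^sup>2) y = a y + 2 * \<theta> * u y + \<theta>\<^sup>2 * x y" for y
  proof -
    have "(\<lambda>z. (nz \<theta> i g z)\<^sup>2) = (\<lambda>z. (av i g z)\<^sup>2 +
        (2 * \<theta> * (av i g z * (g z - av i g z)) + \<theta>\<^sup>2 * (g z - av i g z)\<^sup>2))"
      by (simp add: nz_expand fun_eq_iff) (simp add: power2_eq_square algebra_simps)
    then show ?thesis
      by (simp add: Av_add[OF A] Av_cmult[OF A] a_def u_def x_def)
  qed
  have "av i (\<lambda>z. av i g z * (g z - av i g z)) = (\<lambda>_. 0)"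
  proof
    fix y
    show "av i (\<lambda>z. av i g z * (g z - av i g z)) y = 0"
      by (subst av_mult_indep) (simp_all add: av_upd av_diff av_av_same)
  qed
  then show 2: "av i (u) y = 0" for y
    using A by (simp add: u_def flip: Av_av_commute)
  show 3: "a (y(i := w)) = a y" for y w
  proof -
    have "av i (\<lambda>z. (av i g z)\<^sup>2) = (\<lambda>z. (av i g z)\<^sup>2)"
      by (rule ext) (use av_mult_indep[of "av i g" _ i "av i g"] in \<open>simp add: av_upd av_av_same power2_eq_square\<close>)
    then have "a = av i (a)" by (metis A Av_av_commute a_def)
    then show ?thesis by (metis av_upd)
  qed
  have "av i (Av A (\<lambda>z. (nz \<theta> i g z)\<^sup>2)) y = av i (\<lambda>y. a y + (2 * \<theta> * u y + \<theta>\<^sup>2 * x y)) y"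
    by (rule arg_cong[where f = "\<lambda>h. av i h y"]) (simp add: 1 fun_eq_iff add.assoc)
  also have "\<dots> = av i (a) y + (2 * \<theta> * av i (u) y + \<theta>\<^sup>2 * av i (x) y)"
    by (simp add: av_add av_cmult)
  also have "av i (a) y = a y"
    using card_Om by (simp add: av_def 3)
  finally show "av i (Av A (\<lambda>z. (nz \<theta> i g z)\<^sup>2)) y = a y + \<theta>\<^sup>2 * av i (x) y"
    by (simp add: 2)
qed

text \<open>The two-point inequality is applied at each value of coordinate \<open>i\<close>, and
  its linear term averages to 0. Bernoulli's inequality then moves the term with
  \<open>p / 2\<close> inside the power, where it adds half of the variance; this is what noise of
  rate \<open>sqrt (1/2)\<close> produces. The other half remains available to pay for the
  derivative term.\<close>

lemma one_coordinate_bound: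
  fixes p s \<rho> :: real
  assumes p: "p \<ge> 1" and s: "s \<ge> 2" and \<rho>: "\<rho> \<ge> 0" "\<rho> * s \<le> ln (2 * p) / (32 * p)"
    and A: "finite A" and i: "i \<notin> A" and y: "y \<in> valid"
  shows "av i (\<lambda>y. Av A (\<lambda>z. (nz \<rho> i g z)\<^sup>2) y powr p) y
    \<le> Av (insert i A) (\<lambda>z. (nz (sqrt (1/2)) i g z)\<^sup>2) y powr p
      + av i (\<lambda>y. Av A (\<lambda>z. (g z - av i g z)\<^sup>2) y powr p) y / s powr (2 * p)"
proof -
  define a where "a = Av A (\<lambda>z. (av i g z)\<^sup>2) y"
  define u where "u = Av A (\<lambda>z. av i g z * (g z - av i g z))"
  define x where "x = Av A (\<lambda>z. (g z - av i g z)\<^sup>2)"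
  note sq = Av_nz_square[OF A i, where g = g, folded u_def x_def]
  have a0: "0 \<le> a" unfolding a_def by (rule Av_nonneg_valid[OF A y]) simp
  have x0: "0 \<le> x z" if "z \<in> valid" for z unfolding x_def by (rule Av_nonneg_valid[OF A that]) simp
  have "av i (\<lambda>y. Av A (\<lambda>z. (nz \<rho> i g z)\<^sup>2) y powr p) y
     \<le> av i (\<lambda>z. a powr p + (2 * p * \<rho> * a powr (p - 1) * u z + (p / 2 * a powr (p - 1) * x z
          + 1 / s powr (2 * p) * x z powr p))) y"
    unfolding av_def
  proof (intro divide_right_mono sum_mono)
    fix w assume w: "w \<in> Om"
    let ?z = "y(i := w)"
    have eq: "Av A (\<lambda>z. (av i g z)\<^sup>2) ?z = a" by (simp only: a_def sq(3))
    have "(u ?z)\<^sup>2 \<le> a * x ?z"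
      unfolding u_def x_def eq[symmetric] by (rule Av_Cauchy_Schwarz[OF A])
    from two_point_bound[OF p s \<rho> a0 x0 this] valid_upd[OF y w]
    show "Av A (\<lambda>z. (nz \<rho> i g z)\<^sup>2) ?z powr p \<le> a powr p + (2 * p * \<rho> * a powr (p - 1) * u ?z
        + (p / 2 * a powr (p - 1) * x ?z + 1 / s powr (2 * p) * x ?z powr p))"
      unfolding sq(1) eq by (simp add: mult_ac)
  qed simp
  also have "\<dots> = a powr p + p / 2 * a powr (p - 1) * av i x y + av i (\<lambda>z. x z powr p) y / s powr (2 * p)"
    unfolding av_add av_cmult av_const sq(2) by simp
  also have "a powr p + p / 2 * a powr (p - 1) * av i x y \<le> (a + (sqrt (1/2))\<^sup>2 * av i x y) powr p"
  proof (cases "a = 0")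
    case False
    then have a: "a > 0" using a0 by simp
    have X: "0 \<le> av i x y" unfolding av_eq_Av using y x0 by (intro Av_nonneg_valid) auto
    define t where "t = av i x y / (2 * a)"
    have t: "t \<ge> 0" using X a by (simp add: t_def)
    have "1 + p * t \<le> (1 + t) powr p"
      using bernoulli_powr t p by simp
    then have "a powr p * (1 + p * t) \<le> a powr p * (1 + t) powr p" by (intro mult_left_mono) auto
    also have "\<dots> = (a * (1 + t)) powr p" using a t by (simp add: powr_mult)
    also have "a * (1 + t) = a + (sqrt (1/2))\<^sup>2 * av i x y" using a by (simp add: t_def field_simps)
    finally have "a powr p * (1 + p * t) \<le> (a + (sqrt (1/2))\<^sup>2 * av i x y) powr p" .
    moreover have "a powr p * (1 + p * t) = a powr p + p / 2 * (a powr p / a) * av i x y"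
      using a by (simp add: t_def field_simps)
    moreover have "a powr p / a = a powr (p - 1)" using a by (simp add: powr_diff)
    ultimately show ?thesis by simp
  qed (use p in auto)
  also have "a + (sqrt (1/2))\<^sup>2 * av i x y = Av (insert i A) (\<lambda>z. (nz (sqrt (1/2)) i g z)\<^sup>2) y"
    using A by (simp only: Av_insert sq(4) a_def)
  finally show ?thesis by (simp add: x_def)
qed

lemma Av_nz_square_le:
  assumes A: "finite A" and i: "i \<in> A" and \<theta>: "0 \<le> \<theta>" "\<theta> \<le> 1" and y: "y \<in> valid"
  shows "Av A (\<lambda>z. (nz \<theta> i g z)\<^sup>2) y \<le> Av A (\<lambda>z. (g z)\<^sup>2) y"
proof -
  define B where "B = A - {i}"
  have B: "finite B" "i \<notin> B" "A = insert i B" using A i by (auto simp: B_def)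
  have "0 \<le> av i (Av B (\<lambda>z. (g z - av i g z)\<^sup>2)) y"
    using B y by (simp flip: Av_insert) (intro Av_nonneg_valid; simp)
  moreover have "\<theta>\<^sup>2 \<le> 1\<^sup>2" using \<theta> by (intro power_mono)
  ultimately have "\<theta>\<^sup>2 * av i (Av B (\<lambda>z. (g z - av i g z)\<^sup>2)) y \<le> 1\<^sup>2 * av i (Av B (\<lambda>z. (g z - av i g z)\<^sup>2)) y"
    by (intro mult_right_mono)
  then have "av i (Av B (\<lambda>z. (nz \<theta> i g z)\<^sup>2)) y \<le> av i (Av B (\<lambda>z. (nz 1 i g z)\<^sup>2)) y"
    unfolding Av_nz_square(4)[OF B(1,2)] by simp
  then show ?thesis by (simp add: B(3) Av_insert[OF B(1)]) (simp add: nz_def)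
qed

lemma Av_square_av_le:
  assumes A: "finite A" and i: "i \<notin> A" and y: "y \<in> valid"
  shows "Av A (\<lambda>z. (av i g z)\<^sup>2) y \<le> Av (insert i A) (\<lambda>z. (g z)\<^sup>2) y"
proof -
  have "Av (insert i A) (\<lambda>z. (nz 0 i g z)\<^sup>2) y \<le> Av (insert i A) (\<lambda>z. (g z)\<^sup>2) y"
    using A y by (intro Av_nz_square_le) auto
  then show ?thesis
    by (simp add: Av_insert[OF A] Av_nz_square(4)[OF A i])
qed

text \<open>The triangle inequality in squared form, by weighted arithmetic-geometric means with the
  weights fitted to the two bounds.\<close>

lemma Av_square_diff_le:
  assumes A: "finite A" and y: "y \<in> valid" and ab: "a > 0" "b > 0"
    and f: "Av A (\<lambda>z. (f z)\<^sup>2) y \<le> a\<^sup>2" and g: "Av A (\<lambda>z. (g z)\<^sup>2) y \<le> b\<^sup>2"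
  shows "Av A (\<lambda>z. (f z - g z)\<^sup>2) y \<le> (a + b)\<^sup>2"
proof -
  have "(f z - g z)\<^sup>2 \<le> (1 + b / a) * (f z)\<^sup>2 + (1 + a / b) * (g z)\<^sup>2" for z
  proof -
    have "0 \<le> a * b * (f z / a + g z / b)\<^sup>2" using ab by simp
    also have "\<dots> = b / a * (f z)\<^sup>2 + a / b * (g z)\<^sup>2 + 2 * f z * g z"
      using ab by (simp add: power2_eq_square field_simps)
    finally show ?thesis by (simp add: power2_eq_square algebra_simps)
  qed
  then have "Av A (\<lambda>z. (f z - g z)\<^sup>2) y \<le> Av A (\<lambda>z. (1 + b / a) * (f z)\<^sup>2 + (1 + a / b) * (g z)\<^sup>2) y"
    by (intro Av_mono A)
  also have "\<dots> = (1 + b / a) * Av A (\<lambda>z. (f z)\<^sup>2) y + (1 + a / b) * Av A (\<lambda>z. (g z)\<^sup>2) y"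
    by (simp add: Av_add[OF A] Av_cmult[OF A])
  also have "\<dots> \<le> (1 + b / a) * a\<^sup>2 + (1 + a / b) * b\<^sup>2"
    using ab f g by (intro add_mono mult_left_mono) auto
  also have "\<dots> = (a + b)\<^sup>2" using ab by (simp add: power2_eq_square field_simps)
  finally show ?thesis .
qed

text \<open>Induction on \<open>is\<close>: the coordinates in \<open>A\<close> have already been moved inside the \<open>L\<^sup>2\<close> norm, and those
  outside \<open>A\<close> and \<open>is\<close> are parameters introduced by taking derivatives.\<close>

lemma noise_hypercontractive_aux:
  fixes p r \<rho> :: real
  assumes p: "p \<ge> 1" and r: "r \<ge> 1" and \<rho>: "\<rho> \<ge> 0" "\<rho> * (1 + r) \<le> ln (2 * p) / (32 * p)"
  shows "\<lbrakk>finite A; distinct is; set is \<inter> A = {}; \<gamma> > 0; y \<in> valid;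
     \<And>S y. S \<subseteq> set is \<Longrightarrow> y \<in> valid \<Longrightarrow> Av (A \<union> (set is - S)) (\<lambda>z. (f z)\<^sup>2) y \<le> (r ^ card S * \<gamma>)\<^sup>2\<rbrakk>
   \<Longrightarrow> Av (set is) (\<lambda>z. Av A (\<lambda>z. (noise \<rho> is f z)\<^sup>2) z powr p) y
     \<le> \<gamma> powr (2 * p - 2) * Av (A \<union> set is) (\<lambda>z. (f z)\<^sup>2) y"
proof (induction "is" arbitrary: A f \<gamma> y)
  case Nil
  define X where "X = Av A (\<lambda>z. (f z)\<^sup>2) y"
  have X: "0 \<le> X" unfolding X_def using Nil.prems by (intro Av_nonneg_valid) auto
  have X2: "X \<le> \<gamma>\<^sup>2" using Nil.prems(6)[of "{}" y] Nil.prems(5) by (simp add: X_def)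
  have "X powr p \<le> \<gamma> powr (2 * p - 2) * X"
  proof (cases "X = 0")
    case False
    then have "X powr p = X powr (p - 1) * X" using X by (simp add: powr_diff)
    also have "\<dots> \<le> (\<gamma>\<^sup>2) powr (p - 1) * X" using X X2 p by (intro mult_right_mono powr_mono2) auto
    also have "(\<gamma>\<^sup>2) powr (p - 1) = \<gamma> powr (2 * p - 2)"
      using Nil.prems(4) by (simp add: powr_powr algebra_simps flip: powr_numeral)
    finally show ?thesis .
  qed simp
  then show ?case by (simp add: X_def)
next
  case (Cons i js)
  note A = Cons.prems(1) and \<gamma> = Cons.prems(4) and y = Cons.prems(5) and glob = Cons.prems(6)
  have i: "i \<notin> A" "i \<notin> set js" and js: "distinct js" "set js \<inter> A = {}" using Cons.prems by auto
  define g where "g = noise \<rho> js f"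
  define \<theta> where "\<theta> = sqrt (1/2)"
  define h where "h z = f z - av i f z" for z
  \<comment> \<open>The derivative \<open>h = f - av i f\<close> is a value with coordinate
    \<open>i\<close> fixed minus one with it averaged, so its bound at \<open>S\<close> is the one
    for \<open>insert i S\<close> plus the one for \<open>S\<close>: a factor r + 1.\<close>
  define s where "s = 1 + r"
  have s: "s \<ge> 2" using r by (simp add: s_def)
  have \<theta>: "0 \<le> \<theta>" "\<theta> \<le> 1" "\<theta>\<^sup>2 = 1/2" by (auto simp: \<theta>_def real_le_lsqrt)
  define A' where "A' = A \<union> set js"
  have A': "finite A'" "i \<notin> A'" using A i by (auto simp: A'_def)
  have g\<theta>: "nz \<theta> i g = noise \<rho> js (nz \<theta> i f)" by (simp add: g_def nz_noise)
  have gh: "(\<lambda>z. g z - av i g z) = noise \<rho> js h"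
    by (simp add: g_def h_def[abs_def] noise_diff av_noise)
  have "Av (set (i # js)) (\<lambda>z. Av A (\<lambda>z. (noise \<rho> (i # js) f z)\<^sup>2) z powr p) y
      = Av (set js) (av i (\<lambda>z. Av A (\<lambda>z. (nz \<rho> i g z)\<^sup>2) z powr p)) y"
    by (simp add: Av_insert2 g_def)
  also have "\<dots> \<le> Av (set js) (\<lambda>y. Av (insert i A) (\<lambda>z. (nz \<theta> i g z)\<^sup>2) y powr p
      + 1 / s powr (2 * p) * av i (\<lambda>y. Av A (\<lambda>z. (g z - av i g z)\<^sup>2) y powr p) y) y"
    using one_coordinate_bound[OF p s \<rho>(1) _ A i(1), of _ g] \<rho>(2) y
    by (intro Av_mono_valid) (auto simp: \<theta>_def s_def)
  also have "\<dots> = Av (set js) (\<lambda>z. Av (insert i A) (\<lambda>z. (noise \<rho> js (nz \<theta> i f) z)\<^sup>2) z powr p) y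
      + 1 / s powr (2 * p) * av i (Av (set js) (\<lambda>z. Av A (\<lambda>z. (noise \<rho> js h z)\<^sup>2) z powr p)) y"
    by (simp only: Av_add Av_cmult List.finite_set g\<theta> gh[symmetric] Av_av_commute[symmetric])
  also have "Av (set js) (\<lambda>z. Av (insert i A) (\<lambda>z. (noise \<rho> js (nz \<theta> i f) z)\<^sup>2) z powr p) y
      \<le> \<gamma> powr (2 * p - 2) * Av (insert i A \<union> set js) (\<lambda>z. (nz \<theta> i f z)\<^sup>2) y"
  proof (rule Cons.IH)
    fix S y assume S: "S \<subseteq> set js" and y: "y \<in> valid"
    have "Av (insert i A \<union> (set js - S)) (\<lambda>z. (nz \<theta> i f z)\<^sup>2) y
        \<le> Av (insert i A \<union> (set js - S)) (\<lambda>z. (f z)\<^sup>2) y"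
      using A \<theta> y by (intro Av_nz_square_le) auto
    also have "Av (insert i A \<union> (set js - S)) (\<lambda>z. (f z)\<^sup>2) y \<le> (r ^ card S * \<gamma>)\<^sup>2"
    proof -
      have "insert i A \<union> (set js - S) = A \<union> (set (i # js) - S)" using S i by auto
      then show ?thesis using glob[of S y] S y by auto
    qed
    finally show "Av (insert i A \<union> (set js - S)) (\<lambda>z. (nz \<theta> i f z)\<^sup>2) y \<le> (r ^ card S * \<gamma>)\<^sup>2" .
  qed (use A i js \<gamma> y in auto)
  also have "av i (Av (set js) (\<lambda>z. Av A (\<lambda>z. (noise \<rho> js h z)\<^sup>2) z powr p)) y
      \<le> av i (\<lambda>y. (s * \<gamma>) powr (2 * p - 2) * Av A' (\<lambda>z. (h z)\<^sup>2) y) y"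
    unfolding A'_def
  proof (rule av_mono_valid[OF y], rule Cons.IH)
    fix S y assume S: "S \<subseteq> set js" and y: "y \<in> valid"
    have fS: "finite S" using S finite_subset by auto
    define B where "B = A \<union> (set js - S)"
    have B: "finite B" "i \<notin> B" using A i by (auto simp: B_def)
    have "B = A \<union> (set (i # js) - insert i S)" using S i by (auto simp: B_def)
    then have 1: "Av B (\<lambda>z. (f z)\<^sup>2) y \<le> (r ^ card (insert i S) * \<gamma>)\<^sup>2"
      using S y glob[of "insert i S" y] by auto
    have "insert i B = A \<union> (set (i # js) - S)" using S i by (auto simp: B_def)
    then have 2: "Av B (\<lambda>z. (av i f z)\<^sup>2) y \<le> (r ^ card S * \<gamma>)\<^sup>2"
      using order_trans[OF Av_square_av_le[OF B y, of f], of "(r ^ card S * \<gamma>)\<^sup>2"] S y glob[of S y]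
      by (metis set_subset_Cons subset_trans)
    have "Av B (\<lambda>z. (h z)\<^sup>2) y \<le> (r ^ card (insert i S) * \<gamma> + r ^ card S * \<gamma>)\<^sup>2"
      unfolding h_def using r \<gamma> by (intro Av_square_diff_le B y 1 2) auto
    also have "r ^ card (insert i S) * \<gamma> + r ^ card S * \<gamma> = r ^ card S * (s * \<gamma>)"
      using S i fS by (subst card_insert_disjoint) (auto simp: s_def algebra_simps)
    finally show "Av (A \<union> (set js - S)) (\<lambda>z. (h z)\<^sup>2) y \<le> (r ^ card S * (s * \<gamma>))\<^sup>2"
      by (simp add: B_def)
  qed (use A js \<gamma> s in auto)
  also have "av i (\<lambda>y. (s * \<gamma>) powr (2 * p - 2) * Av A' (\<lambda>z. (h z)\<^sup>2) y) y
      = (s * \<gamma>) powr (2 * p - 2) * av i (Av A' (\<lambda>z. (h z)\<^sup>2)) y"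
    by (rule av_cmult)
  finally have 1: "Av (set (i # js)) (\<lambda>z. Av A (\<lambda>z. (noise \<rho> (i # js) f z)\<^sup>2) z powr p) y
    \<le> \<gamma> powr (2 * p - 2) * Av (insert i A') (\<lambda>z. (nz \<theta> i f z)\<^sup>2) y
      + 1 / s powr (2 * p) * ((s * \<gamma>) powr (2 * p - 2) * av i (Av A' (\<lambda>z. (h z)\<^sup>2)) y)"
    by (simp add: A'_def divide_right_mono)
  define a D where "a = Av A' (\<lambda>z. (av i f z)\<^sup>2) y" and "D = av i (Av A' (\<lambda>z. (h z)\<^sup>2)) y"
  have D: "0 \<le> D" unfolding D_def using A' y by (simp flip: Av_insert) (intro Av_nonneg_valid; simp)
  have 2: "Av (insert i A') (\<lambda>z. (nz t i f z)\<^sup>2) y = a + t\<^sup>2 * D" for t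
    using A' by (simp add: Av_insert Av_nz_square(4) a_def D_def h_def)
  have 3: "Av (insert i A') (\<lambda>z. (f z)\<^sup>2) y = a + D"
    using 2[of 1] by (simp add: nz_def)
  \<comment> \<open>The gain \<open>s powr (2 * p)\<close> of the scalar inequality exceeds the loss
    \<open>s powr (2 * p - 2)\<close> in globalness by \<open>s\<^sup>2\<close>. As s \<ge> 2, the
    derivative costs at most a quarter of \<open>D\<close>, within the half left over by the other
    term.\<close>
  have 4: "1 / s powr (2 * p) * ((s * \<gamma>) powr (2 * p - 2) * D) = \<gamma> powr (2 * p - 2) * (D / s\<^sup>2)"
    using s \<gamma> by (simp add: powr_mult powr_diff)
  have "2\<^sup>2 \<le> s\<^sup>2" using s by (intro power_mono) auto
  then have "D / s\<^sup>2 \<le> D / 2" using D by (intro divide_left_mono) auto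
  then have "\<gamma> powr (2 * p - 2) * (a + 1 / 2 * D + D / s\<^sup>2) \<le> \<gamma> powr (2 * p - 2) * (a + D)"
    by (intro mult_left_mono, linarith, simp)
  then have "\<gamma> powr (2 * p - 2) * (a + 1 / 2 * D) + \<gamma> powr (2 * p - 2) * (D / s\<^sup>2) \<le> \<gamma> powr (2 * p - 2) * (a + D)"
    by (simp only: distrib_left)
  moreover have "A \<union> set (i # js) = insert i A'" by (simp add: A'_def)
  ultimately show ?case
    using 1 unfolding 2 3 D_def[symmetric] 4 \<theta>(3) \<open>A \<union> set (i # js) = insert i A'\<close> by linarith
qed

corollary noise_hypercontractive:
  fixes q r \<rho> :: real
  assumes q: "q \<ge> 2" and r: "r \<ge> 1" and \<rho>: "\<rho> \<ge> 0" "\<rho> * (1 + r) \<le> ln q / (16 * q)"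
    and "distinct is" "\<gamma> > 0" "y \<in> valid"
    and "\<And>S y. S \<subseteq> set is \<Longrightarrow> y \<in> valid \<Longrightarrow> Av (set is - S) (\<lambda>z. (f z)\<^sup>2) y \<le> (r ^ card S * \<gamma>)\<^sup>2"
  shows "Av (set is) (\<lambda>z. \<bar>noise \<rho> is f z\<bar> powr q) y
     \<le> \<gamma> powr (q - 2) * Av (set is) (\<lambda>z. (f z)\<^sup>2) y"
proof -
  have "((x::real)\<^sup>2) powr (q / 2) = \<bar>x\<bar> powr q" for x
    using powr_powr[of "\<bar>x\<bar>" 2 "q / 2"] by simp
  then show ?thesis
    using noise_hypercontractive_aux[of "q / 2" r \<rho> "{}" "is" \<gamma> y f] assms by simp
qed

lemma noise_self_adjoint:
  assumes A: "finite A" and "set is \<subseteq> A"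
  shows "Av A (\<lambda>z. noise \<tau> is f z * g z) y = Av A (\<lambda>z. f z * noise \<tau> is g z) y"
  using assms(2)
proof (induction "is" arbitrary: f g)
  case (Cons i js)
  have nz: "Av A (\<lambda>z. nz \<tau> i f z * g z) y = Av A (\<lambda>z. f z * nz \<tau> i g z) y" for f g
  proof -
    have "Av A (\<lambda>z. nz \<tau> i f z * g z) y
        = \<tau> * Av A (\<lambda>z. f z * g z) y + (1 - \<tau>) * Av A (\<lambda>z. av i f z * g z) y"
      by (simp add: nz_def distrib_right mult.assoc Av_add[OF A] Av_cmult[OF A])
    also have "Av A (\<lambda>z. av i f z * g z) y = Av A (\<lambda>z. f z * av i g z) y"
      using Av_self_adjoint[OF A, of "{i}" f g y] Cons.prems by (simp add: av_eq_Av)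
    also have "\<tau> * Av A (\<lambda>z. f z * g z) y + (1 - \<tau>) * Av A (\<lambda>z. f z * av i g z) y
       = Av A (\<lambda>z. \<tau> * (f z * g z) + (1 - \<tau>) * (f z * av i g z)) y"
      by (simp add: Av_add[OF A] Av_cmult[OF A])
    finally show ?thesis by (simp add: nz_def algebra_simps)
  qed
  have "Av A (\<lambda>z. noise \<tau> (i # js) f z * g z) y = Av A (\<lambda>z. f z * noise \<tau> js (nz \<tau> i g) z) y"
    using Cons by (simp add: nz)
  then show ?case by (simp add: nz_noise)
qed simp

text \<open>By \<open>zero\<close>, the function \<open>Av (A - S) G\<close> has mean 0 in each
  coordinate of \<open>S\<close>, and it does not depend on the rest of \<open>A\<close>. So each
  \<open>nz \<tau> i\<close> multiplies it by \<tau> or by 1: it sits on level \<open>S\<close> of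
  the Efron-Stein decomposition.\<close>

lemma noise_level:
  assumes A: "finite A" and S: "S \<subseteq> A"
    and zero: "\<And>S' y. S' \<subset> S \<Longrightarrow> y \<in> valid \<Longrightarrow> Av (A - S') G y = 0"
    and "distinct is" "set is \<subseteq> A" "y \<in> valid"
  shows "noise \<tau> is (Av (A - S) G) y = \<tau> ^ card (S \<inter> set is) * Av (A - S) G y"
  using assms(4-)
proof (induction "is" arbitrary: y)
  case (Cons i js)
  let ?g = "Av (A - S) G"
  let ?k = "card (S \<inter> set js)"
  have fS: "finite S" using A S finite_subset by auto
  have IH: "noise \<tau> js ?g z = \<tau> ^ ?k * ?g z" if "z \<in> valid" for z
    using Cons that by auto
  have "av i (noise \<tau> js ?g) y = av i (\<lambda>z. \<tau> ^ ?k * ?g z) y"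
    unfolding av_eq_Av using Cons.prems IH by (intro Av_cong_valid) auto
  then have eq: "noise \<tau> (i # js) ?g y = \<tau> * (\<tau> ^ ?k * ?g y) + (1 - \<tau>) * (\<tau> ^ ?k * av i ?g y)"
    using Cons.prems by (simp add: nz_def IH av_cmult)
  show ?case
  proof (cases "i \<in> S")
    case True
    have "insert i (A - S) = A - (S - {i})" using True S by auto
    then have "av i ?g y = 0"
      using A zero[of "S - {i}" y] True Cons.prems by (simp add: psubset_eq flip: Av_insert) blast
    moreover have "card (S \<inter> set (i # js)) = Suc ?k"
      using True Cons.prems fS by (simp add: Int_insert_right)
    ultimately show ?thesis unfolding eq by simp
  next
    case False
    then have "av i ?g = ?g" using A Cons.prems by (intro av_absorb) auto
    then show ?thesis unfolding eq using False by (simp add: Int_insert_right algebra_simps)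
  qed
qed simp

text \<open>Since lower averages vanish, the parts of \<open>G\<close> on the levels of size
  \<open>d\<close> are orthogonal eigenfunctions of the noise. Their sum \<open>h\<close> has inner
  product \<open>Q\<close> with itself and with \<open>G\<close>, and testing
  \<open>noise \<tau> is G\<close> against \<open>h\<close> gives the bound by Cauchy-Schwarz.
  Higher levels need no description.\<close>

theorem noise_lower_bound:
  assumes d: "distinct is" and y: "y \<in> valid" and \<tau>: "\<tau> \<ge> 0"
    and zero: "\<And>S y. S \<subseteq> set is \<Longrightarrow> card S < d \<Longrightarrow> y \<in> valid \<Longrightarrow> Av (set is - S) G y = 0"
  shows "\<tau> ^ (2 * d) * (\<Sum>S | S \<subseteq> set is \<and> card S = d. Av (set is) (\<lambda>z. (Av (set is - S) G z)\<^sup>2) y)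
    \<le> Av (set is) (\<lambda>z. (noise \<tau> is G z)\<^sup>2) y"
proof -
  let ?A = "set is"
  let ?D = "{S. S \<subseteq> ?A \<and> card S = d}"
  have fin: "finite ?A" "finite ?D" by auto
  define g where "g S = Av (?A - S) G" for S
  define h where "h z = (\<Sum>S\<in>?D. g S z)" for z
  define Q where "Q = (\<Sum>S\<in>?D. Av ?A (\<lambda>z. (g S z)\<^sup>2) y)"
  have noise_g: "noise \<tau> is (g S) z = \<tau> ^ d * g S z" if S: "S \<in> ?D" and z: "z \<in> valid" for S z
  proof -
    have "card S' < d" "S' \<subseteq> ?A" if "S' \<subset> S" for S'
      using S that psubset_card_mono[of S S'] by (auto intro: finite_subset[of S ?A])
    moreover have "S \<inter> ?A = S" using S by auto
    ultimately show ?thesis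
      using noise_level[OF fin(1), of S G "is" z \<tau>] S d z zero by (auto simp: g_def)
  qed
  \<comment> \<open>Averaging \<open>g S\<close> over the complement of \<open>S'\<close> averages
    \<open>G\<close> over the complement of \<open>S \<inter> S'\<close>, and this intersection has
    fewer than \<open>d\<close> elements when the sets differ.\<close>
  have cross: "Av ?A (\<lambda>z. g S z * g S' z) y = (if S = S' then Av ?A (\<lambda>z. (g S z)\<^sup>2) y else 0)"
    if S: "S \<in> ?D" "S' \<in> ?D" for S S'
  proof (cases "S = S'")
    case False
    have "S \<inter> S' \<subset> S"
    proof (rule psubsetI)
      show "S \<inter> S' \<noteq> S"
        using S False card_subset_eq[of S' S] finite_subset[of S' ?A] by auto
    qed auto
    then have "card (S \<inter> S') < d" using S psubset_card_mono[of S "S \<inter> S'"] finite_subset[of S ?A] by auto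
    moreover have "(?A - S') \<union> (?A - S) = ?A - (S \<inter> S')" by auto
    ultimately have "Av (?A - S') (g S) z = 0" if "z \<in> valid" for z
      using S that zero[of "S \<inter> S'" z] by (auto simp: g_def simp flip: Av_Un)
    then have "Av ?A (\<lambda>z. Av (?A - S') (g S) z * G z) y = Av ?A (\<lambda>z. 0) y"
      using y by (intro Av_cong_valid) auto
    then show ?thesis
      using False Av_self_adjoint[OF fin(1), of "?A - S'" "g S" G y] by (simp add: g_def)
  qed (simp add: power2_eq_square)
  have hh: "Av ?A (\<lambda>z. (h z)\<^sup>2) y = Q"
  proof -
    have "(\<lambda>z. (h z)\<^sup>2) = (\<lambda>z. \<Sum>S\<in>?D. \<Sum>S'\<in>?D. g S z * g S' z)"
      by (simp add: h_def power2_eq_square sum_product)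
    then have "Av ?A (\<lambda>z. (h z)\<^sup>2) y = (\<Sum>S\<in>?D. \<Sum>S'\<in>?D. Av ?A (\<lambda>z. g S z * g S' z) y)"
      by (simp add: Av_sum fin)
    also have "\<dots> = Q" unfolding Q_def
    proof (rule sum.cong[OF refl])
      fix S assume S: "S \<in> ?D"
      have "(\<Sum>S'\<in>?D. Av ?A (\<lambda>z. g S z * g S' z) y)
          = (\<Sum>S'\<in>?D. if S = S' then Av ?A (\<lambda>z. (g S z)\<^sup>2) y else 0)"
        by (rule sum.cong[OF refl]) (rule cross[OF S])
      also have "\<dots> = Av ?A (\<lambda>z. (g S z)\<^sup>2) y" using S fin(2) by (subst sum.delta') auto
      finally show "(\<Sum>S'\<in>?D. Av ?A (\<lambda>z. g S z * g S' z) y) = Av ?A (\<lambda>z. (g S z)\<^sup>2) y" .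
    qed
    finally show ?thesis .
  qed
  have Gh: "Av ?A (\<lambda>z. G z * h z) y = Q"
  proof -
    have "Av ?A (\<lambda>z. G z * h z) y = (\<Sum>S\<in>?D. Av ?A (\<lambda>z. G z * g S z) y)"
      by (simp add: h_def sum_distrib_left Av_sum fin)
    also have "\<dots> = Q" unfolding Q_def
    proof (rule sum.cong[OF refl])
      fix S assume "S \<in> ?D"
      have "Av ?A (\<lambda>z. g S z * Av (?A - S) G z) y = Av ?A (\<lambda>z. Av (?A - S) (g S) z * G z) y"
        by (rule Av_self_adjoint) auto
      moreover have "Av (?A - S) (g S) = g S" by (simp add: g_def flip: Av_Un)
      ultimately show "Av ?A (\<lambda>z. G z * g S z) y = Av ?A (\<lambda>z. (g S z)\<^sup>2) y"
        by (simp add: g_def power2_eq_square mult.commute)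
    qed
    finally show ?thesis .
  qed
  have "noise \<tau> is h z = \<tau> ^ d * h z" if "z \<in> valid" for z
  proof -
    have "noise \<tau> is (\<lambda>z. \<Sum>S\<in>X. g S z) = (\<lambda>z. \<Sum>S\<in>X. noise \<tau> is (g S) z)" if "finite X" for X
      using that
    proof (induction X)
      case empty
      show ?case using noise_cmult[of \<tau> "is" 0 "\<lambda>_. 0"] by simp
    qed (simp add: noise_add)
    from this[OF fin(2)] have "noise \<tau> is h z = (\<Sum>S\<in>?D. noise \<tau> is (g S) z)"
      by (simp add: h_def[abs_def])
    also have "\<dots> = (\<Sum>S\<in>?D. \<tau> ^ d * g S z)"
      by (rule sum.cong[OF refl]) (rule noise_g[OF _ that])
    finally show ?thesis by (simp add: h_def sum_distrib_left)
  qed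
  then have "Av ?A (\<lambda>z. noise \<tau> is G z * h z) y = Av ?A (\<lambda>z. \<tau> ^ d * (G z * h z)) y"
    unfolding noise_self_adjoint[OF fin(1) order_refl] using y by (intro Av_cong_valid) auto
  then have "(\<tau> ^ d * Q)\<^sup>2 \<le> Av ?A (\<lambda>z. (noise \<tau> is G z)\<^sup>2) y * Q"
    using Av_Cauchy_Schwarz[OF fin(1), of "noise \<tau> is G" h y] by (simp add: Av_cmult Gh hh)
  then have "\<tau> ^ (2 * d) * Q * Q \<le> Av ?A (\<lambda>z. (noise \<tau> is G z)\<^sup>2) y * Q"
    by (simp add: power_mult_distrib power_mult power2_eq_square power_mult[of \<tau> 2] mult_ac)
  moreover have "Q \<ge> 0" unfolding Q_def using y by (intro sum_nonneg Av_nonneg_valid) auto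
  moreover have "0 \<le> Av ?A (\<lambda>z. (noise \<tau> is G z)\<^sup>2) y" using y by (intro Av_nonneg_valid) auto
  ultimately have "\<tau> ^ (2 * d) * Q \<le> Av ?A (\<lambda>z. (noise \<tau> is G z)\<^sup>2) y"
    by (cases "Q = 0") auto
  then show ?thesis by (simp add: Q_def g_def)
qed

end

section \<open>Permutations containing a partial matching\<close>

lemma extend_bij_to_permutation:
  assumes X: "finite X" "A \<subseteq> X" "B \<subseteq> X" and h: "bij_betw h A B"
  obtains \<alpha> where "\<alpha> permutes X" "\<And>a. a \<in> A \<Longrightarrow> \<alpha> a = h a"
proof -
  have fin: "finite A" "finite B" using X(2,3) by (auto intro: finite_subset[OF _ X(1)])
  have "card (X - A) = card (X - B)"
    using bij_betw_same_card[OF h] by (simp add: card_Diff_subset fin X)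
  then obtain h' where h': "bij_betw h' (X - A) (X - B)"
    using finite_same_card_bij[of "X - A" "X - B"] X(1) by auto
  define \<alpha> where "\<alpha> x = (if x \<in> A then h x else if x \<in> X then h' x else x)" for x
  have "bij_betw \<alpha> A B" using h by (subst bij_betw_cong[of _ _ h]) (auto simp: \<alpha>_def)
  moreover have "bij_betw \<alpha> (X - A) (X - B)"
    using h' by (subst bij_betw_cong[of _ _ h']) (auto simp: \<alpha>_def)
  ultimately have "bij_betw \<alpha> (A \<union> (X - A)) (B \<union> (X - B))"
    by (rule bij_betw_combine) auto
  moreover have "A \<union> (X - A) = X" "B \<union> (X - B) = X" using X by auto
  ultimately have "\<alpha> permutes X" using X by (intro bij_imp_permutes) (auto simp: \<alpha>_def)
  then show ?thesis by (intro that[of \<alpha>]) (auto simp: \<alpha>_def)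
qed

definition matching :: "('a \<times> 'b) set \<Rightarrow> bool" where
  "matching M \<longleftrightarrow> inj_on fst M \<and> inj_on snd M"

definition relabel :: "('a \<Rightarrow> 'a) \<Rightarrow> ('b \<Rightarrow> 'b) \<Rightarrow> 'a \<times> 'b \<Rightarrow> 'a \<times> 'b" where
  "relabel \<alpha> \<beta> p = (\<alpha> (fst p), \<beta> (snd p))"

lemma relabel_simps [simp]: "fst (relabel \<alpha> \<beta> p) = \<alpha> (fst p)" "snd (relabel \<alpha> \<beta> p) = \<beta> (snd p)"
  by (auto simp: relabel_def)

lemma inj_relabel: "inj \<alpha> \<Longrightarrow> inj \<beta> \<Longrightarrow> inj (relabel \<alpha> \<beta>)"
  by (auto simp: inj_def relabel_def prod_eq_iff)

lemma sum_Pow_by_card: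
  fixes \<phi> :: "nat \<Rightarrow> real"
  assumes "finite X" and "\<And>j. j > l \<Longrightarrow> \<phi> j = 0"
  shows "(\<Sum>M\<in>Pow X. \<phi> (card M)) = (\<Sum>j\<le>l. real (card X choose j) * \<phi> j)"
proof -
  have "(\<Sum>M\<in>Pow X. \<phi> (card M)) = (\<Sum>M\<in>{M \<in> Pow X. card M \<le> l}. \<phi> (card M))"
    using assms by (intro sum.mono_neutral_right) (auto simp: not_le)
  also have "\<dots> = (\<Sum>j\<le>l. \<Sum>M\<in>{M \<in> {M \<in> Pow X. card M \<le> l}. card M = j}. \<phi> (card M))"
    using assms by (intro sum.group[symmetric]) auto
  also have "\<dots> = (\<Sum>j\<le>l. real (card X choose j) * \<phi> j)"
  proof (rule sum.cong[OF refl])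
    fix j assume "j \<in> {..l}"
    then have "{M \<in> {M \<in> Pow X. card M \<le> l}. card M = j} = {M. M \<subseteq> X \<and> card M = j}" by auto
    then show "(\<Sum>M\<in>{M \<in> {M \<in> Pow X. card M \<le> l}. card M = j}. \<phi> (card M)) = real (card X choose j) * \<phi> j"
      using assms by (simp add: n_subsets)
  qed
  finally show ?thesis .
qed

definition grid :: "nat \<Rightarrow> (nat \<times> nat) set" where
  "grid n = {1..n} \<times> {1..n}"

locale symmetric_group =
  fixes n :: nat
  assumes n1: "n \<ge> 1"
begin

sublocale finite_alphabet "grid n"
  by standard (use n1 in \<open>auto simp: grid_def\<close>)

abbreviation "G \<equiv> sym_grp n"
abbreviation "PP \<equiv> grid n"

definition U :: "(nat \<times> nat) set \<Rightarrow> (nat \<Rightarrow> nat) set" where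
  "U M = {\<sigma> \<in> G. \<forall>p\<in>M. \<sigma> (fst p) = snd p}"

text \<open>Without normalisation, \<open>s f M\<close> vanishes by itself when \<open>M\<close> is
  no matching, as \<open>U M\<close> is then empty. Sums may therefore run over all sets of
  edges.\<close>

definition s :: "((nat \<Rightarrow> nat) \<Rightarrow> real) \<Rightarrow> (nat \<times> nat) set \<Rightarrow> real" where
  "s f M = (\<Sum>\<sigma>\<in>U M. f \<sigma>)"

lemma finite_G [simp]: "finite G"
  by (simp add: sym_grp_def finite_permutations)

lemma card_G: "card G = fact n"
  by (simp add: sym_grp_def card_permutations)

lemma finite_U [simp]: "finite (U M)"
  by (rule finite_subset[OF _ finite_G]) (auto simp: U_def)

lemma G_inj: "\<sigma> \<in> G \<Longrightarrow> inj \<sigma>"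
  by (auto simp: sym_grp_def permutes_inj)

lemma G_comp: "\<sigma> \<in> G \<Longrightarrow> \<tau> \<in> G \<Longrightarrow> \<sigma> \<circ> \<tau> \<in> G"
  by (auto simp: sym_grp_def permutes_compose)

lemma G_inv: "\<sigma> \<in> G \<Longrightarrow> inv \<sigma> \<in> G"
  by (auto simp: sym_grp_def permutes_inv)

lemma G_id: "id \<in> G"
  by (auto simp: sym_grp_def permutes_id)

lemma G_inv_simps: "\<sigma> \<in> G \<Longrightarrow> inv \<sigma> (\<sigma> x) = x" "\<sigma> \<in> G \<Longrightarrow> \<sigma> (inv \<sigma> x) = x"
  by (auto simp: sym_grp_def permutes_inverses)

lemma G_mem: "\<sigma> \<in> G \<Longrightarrow> \<sigma> x \<in> {1..n} \<longleftrightarrow> x \<in> {1..n}"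
  by (auto simp: sym_grp_def dest: permutes_in_image)

lemma U_Un: "U (M \<union> M') = U M \<inter> U M'"
  by (auto simp: U_def)

lemma matching_if_U: "U M \<noteq> {} \<Longrightarrow> matching M"
proof -
  assume "U M \<noteq> {}"
  then obtain \<sigma> where \<sigma>: "\<sigma> \<in> G" "\<And>p. p \<in> M \<Longrightarrow> \<sigma> (fst p) = snd p" by (auto simp: U_def)
  show "matching M"
    unfolding matching_def
  proof (intro conjI inj_onI prod_eqI)
    fix p p' assume p: "p \<in> M" "p' \<in> M"
    show "snd p = snd p'" if "fst p = fst p'" using \<sigma>(2)[OF p(1)] \<sigma>(2)[OF p(2)] that by simp
    show "fst p = fst p'" if "snd p = snd p'"
      using \<sigma>(2)[OF p(1)] \<sigma>(2)[OF p(2)] that injD[OF G_inj[OF \<sigma>(1)], of "fst p" "fst p'"] by simp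
  qed
qed

lemma s_zero: "\<not> matching M \<Longrightarrow> s f M = 0"
  using matching_if_U[of M] by (cases "U M = {}") (auto simp: s_def)

lemma U_nonempty:
  assumes M: "matching M" "M \<subseteq> PP"
  shows "U M \<noteq> {}"
proof -
  have "bij_betw (the_inv_into M fst) (fst ` M) M" "bij_betw snd M (snd ` M)"
    using M by (auto simp: matching_def intro: bij_betw_the_inv_into inj_on_imp_bij_betw)
  then have bij: "bij_betw (snd \<circ> the_inv_into M fst) (fst ` M) (snd ` M)" by (rule bij_betw_trans)
  have sub: "fst ` M \<subseteq> {1..n}" "snd ` M \<subseteq> {1..n}" using M by (auto simp: grid_def)
  obtain \<sigma> where \<sigma>: "\<sigma> permutes {1..n}" "\<And>a. a \<in> fst ` M \<Longrightarrow> \<sigma> a = (snd \<circ> the_inv_into M fst) a"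
    by (rule extend_bij_to_permutation[OF finite_atLeastAtMost sub bij]) blast
  have "\<sigma> (fst p) = snd p" if "p \<in> M" for p
    using \<sigma>(2)[of "fst p"] that M by (simp add: matching_def the_inv_into_f_f)
  then have "\<sigma> \<in> U M" using \<sigma> by (auto simp: U_def sym_grp_def)
  then show ?thesis by blast
qed

lemma card_U:
  assumes M: "matching M" "M \<subseteq> PP"
  shows "card (U M) = fact (n - card M)"
proof -
  obtain \<sigma> where \<sigma>: "\<sigma> \<in> U M" using U_nonempty[OF M] by blast
  then have \<sigma>G: "\<sigma> \<in> G" by (auto simp: U_def)
  let ?X = "{1..n} - fst ` M"
  have "U M = (\<lambda>\<tau>. \<sigma> \<circ> \<tau>) ` {\<tau>. \<tau> permutes ?X}"
  proof (intro equalityI subsetI)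
    fix \<sigma>' assume \<sigma>': "\<sigma>' \<in> U M"
    have "inv \<sigma> \<circ> \<sigma>' \<in> G" using \<sigma>' \<sigma>G by (auto simp: U_def intro: G_comp G_inv)
    moreover have "(inv \<sigma> \<circ> \<sigma>') (fst p) = fst p" if "p \<in> M" for p
    proof -
      have "\<sigma>' (fst p) = \<sigma> (fst p)" using that \<sigma> \<sigma>' by (simp add: U_def)
      then show ?thesis using \<sigma>G by (simp add: G_inv_simps)
    qed
    then have "(inv \<sigma> \<circ> \<sigma>') x = x" if "x \<in> {1..n} - ?X" for x using that by blast
    ultimately have "inv \<sigma> \<circ> \<sigma>' permutes ?X"
      unfolding sym_grp_def mem_Collect_eq by (rule permutes_superset)
    moreover have "\<sigma>' = \<sigma> \<circ> (inv \<sigma> \<circ> \<sigma>')" using \<sigma>G by (auto simp: G_inv_simps)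
    ultimately show "\<sigma>' \<in> (\<lambda>\<tau>. \<sigma> \<circ> \<tau>) ` {\<tau>. \<tau> permutes ?X}" by blast
  next
    fix \<sigma>' assume "\<sigma>' \<in> (\<lambda>\<tau>. \<sigma> \<circ> \<tau>) ` {\<tau>. \<tau> permutes ?X}"
    then obtain \<tau> where \<tau>: "\<tau> permutes ?X" "\<sigma>' = \<sigma> \<circ> \<tau>" by auto
    have "\<tau> \<in> G" using \<tau> by (auto simp: sym_grp_def intro: permutes_subset)
    moreover have "\<tau> (fst p) = fst p" if "p \<in> M" for p
      using permutes_not_in[OF \<tau>(1)] that by auto
    ultimately show "\<sigma>' \<in> U M" using \<sigma> \<tau> \<sigma>G by (auto simp: U_def intro: G_comp)
  qed
  moreover have "inj_on (\<lambda>\<tau>. \<sigma> \<circ> \<tau>) {\<tau>. \<tau> permutes ?X}"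
    by (rule inj_on_subset[OF fun.inj_map[OF G_inj[OF \<sigma>G]] subset_UNIV])
  ultimately have "card (U M) = card {\<tau>. \<tau> permutes ?X}" by (simp only: card_image)
  also have "\<dots> = fact (card ?X)" by (rule card_permutations) auto
  also have "card ?X = n - card M"
  proof -
    have "fst ` M \<subseteq> {1..n}" using M by (auto simp: grid_def)
    then show ?thesis
      using M by (simp add: card_Diff_subset finite_subset[of "fst ` M" "{1..n}"] matching_def card_image)
  qed
  finally show ?thesis .
qed

lemma sum_G_reindex:
  assumes "\<alpha> \<in> G" "\<beta> \<in> G"
  shows "(\<Sum>\<sigma>\<in>G. f (\<beta> \<circ> \<sigma> \<circ> inv \<alpha>)) = (\<Sum>\<sigma>\<in>G. f \<sigma>)"
proof (rule sum.reindex_bij_witness[where i = "\<lambda>\<sigma>. inv \<beta> \<circ> \<sigma> \<circ> \<alpha>" and j = "\<lambda>\<sigma>. \<beta> \<circ> \<sigma> \<circ> inv \<alpha>"])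
  fix \<sigma> assume "\<sigma> \<in> G"
  then show "inv \<beta> \<circ> \<sigma> \<circ> \<alpha> \<in> G" "\<beta> \<circ> \<sigma> \<circ> inv \<alpha> \<in> G"
    using assms by (auto intro!: G_comp G_inv)
qed (use assms in \<open>auto simp: fun_eq_iff G_inv_simps\<close>)

lemma U_relabel:
  assumes "\<alpha> \<in> G" "\<beta> \<in> G" "\<sigma> \<in> G"
  shows "\<beta> \<circ> \<sigma> \<circ> inv \<alpha> \<in> U (relabel \<alpha> \<beta> ` M) \<longleftrightarrow> \<sigma> \<in> U M"
proof -
  have "\<beta> \<circ> \<sigma> \<circ> inv \<alpha> \<in> G" using assms by (intro G_comp G_inv)
  moreover have "\<beta> x = \<beta> y \<longleftrightarrow> x = y" for x y using G_inj[OF assms(2)] by (auto dest: injD)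
  ultimately show ?thesis using assms by (simp add: U_def G_inv_simps)
qed

lemma s_eq_sum_G: "s f M = (\<Sum>\<sigma>\<in>G. of_bool (\<sigma> \<in> U M) * f \<sigma>)"
  unfolding s_def by (rule sum.mono_neutral_cong_left) (auto simp: U_def)

lemma s_relabel:
  assumes "\<alpha> \<in> G" "\<beta> \<in> G"
  shows "s f (relabel \<alpha> \<beta> ` M) = s (\<lambda>\<sigma>. f (\<beta> \<circ> \<sigma> \<circ> inv \<alpha>)) M"
proof -
  have "s f (relabel \<alpha> \<beta> ` M) = (\<Sum>\<sigma>\<in>G. of_bool (\<beta> \<circ> \<sigma> \<circ> inv \<alpha> \<in> U (relabel \<alpha> \<beta> ` M)) * f (\<beta> \<circ> \<sigma> \<circ> inv \<alpha>))"
    unfolding s_eq_sum_G by (rule sum_G_reindex[OF assms, symmetric])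
  also have "\<dots> = s (\<lambda>\<sigma>. f (\<beta> \<circ> \<sigma> \<circ> inv \<alpha>)) M"
    unfolding s_eq_sum_G by (rule sum.cong[OF refl]) (simp add: U_relabel[OF assms])
  finally show ?thesis .
qed

section \<open>Matchings outside and inside a rectangle\<close>

definition graph :: "(nat \<Rightarrow> nat) \<Rightarrow> (nat \<times> nat) set" where
  "graph \<sigma> = (\<lambda>i. (i, \<sigma> i)) ` {1..n}"

lemma U_iff_graph:
  assumes "\<sigma> \<in> G" "R \<subseteq> PP"
  shows "\<sigma> \<in> U R \<longleftrightarrow> R \<subseteq> graph \<sigma>"
  using assms by (fastforce simp: U_def graph_def grid_def)

text \<open>The points counted lie in the rows outside \<open>I\<close> and outside the preimage
  \<open>J'\<close> of \<open>J\<close>; the rest is inclusion-exclusion, as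
  \<open>I \<inter> J'\<close> counts the points in \<open>I \<times> J\<close>. The bound
  \<open>IJ\<close> protects the truncated subtraction.\<close>

lemma card_graph_diff:
  assumes \<sigma>: "\<sigma> \<in> G" and I: "I \<subseteq> {1..n}" and J: "J \<subseteq> {1..n}" and IJ: "card I + card J \<le> n"
  shows "card (graph \<sigma> \<inter> (({1..n} - I) \<times> ({1..n} - J))) = n - card I - card J + card (graph \<sigma> \<inter> (I \<times> J))"
proof -
  let ?g = "\<lambda>i. (i, \<sigma> i)"
  have inj: "inj_on ?g A" for A by (auto simp: inj_on_def)
  define J' where "J' = inv \<sigma> ` J"
  have J': "J' \<subseteq> {1..n}" "card J' = card J"
  proof -
    show "J' \<subseteq> {1..n}" using J G_mem[OF G_inv[OF \<sigma>]] by (auto simp: J'_def)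
    show "card J' = card J" unfolding J'_def
      using G_inj[OF G_inv[OF \<sigma>]] by (intro card_image) (auto simp: inj_on_def inj_def)
  qed
  have mem: "\<sigma> i \<in> J \<longleftrightarrow> i \<in> J'" for i
  proof
    assume "\<sigma> i \<in> J"
    then show "i \<in> J'" unfolding J'_def by (rule rev_image_eqI) (simp add: G_inv_simps[OF \<sigma>])
  next
    assume "i \<in> J'"
    then show "\<sigma> i \<in> J" by (auto simp: J'_def G_inv_simps[OF \<sigma>])
  qed
  have fin: "finite I" "finite J'" using I J' by (auto intro: finite_subset)
  have "graph \<sigma> \<inter> (({1..n} - I) \<times> ({1..n} - J)) = ?g ` ({1..n} - (I \<union> J'))"
    using G_mem[OF \<sigma>] by (auto simp: graph_def mem simp del: atLeastAtMost_iff)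
  then have "card (graph \<sigma> \<inter> (({1..n} - I) \<times> ({1..n} - J))) = card ({1..n} - (I \<union> J'))"
    using inj by (simp add: card_image)
  also have "\<dots> = n - card (I \<union> J')"
    using I J' fin by (subst card_Diff_subset) auto
  finally have 1: "card (graph \<sigma> \<inter> (({1..n} - I) \<times> ({1..n} - J))) = n - card (I \<union> J')" .
  have "graph \<sigma> \<inter> (I \<times> J) = ?g ` (I \<inter> J')"
    using I by (auto simp: graph_def mem)
  then have 2: "card (graph \<sigma> \<inter> (I \<times> J)) = card (I \<inter> J')"
    using inj by (simp add: card_image)
  have "card I + card J = card (I \<union> J') + card (I \<inter> J')"
    using card_Un_Int[OF fin] J' by simp
  moreover have "card (I \<union> J') \<le> n" using card_mono[of "{1..n}" "I \<union> J'"] I J' by auto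
  ultimately show ?thesis using 1 2 IJ by linarith
qed

text \<open>The guard matters: for \<open>j > l\<close> the truncated difference
  \<open>l - j\<close> is 0, and the binomial coefficient would be 1.\<close>

definition vand :: "nat \<Rightarrow> nat \<Rightarrow> nat \<Rightarrow> real" where
  "vand m l j = (if j \<le> l then real (m choose (l - j)) else 0)"

lemma vand_nonneg: "0 \<le> vand m l j"
  by (simp add: vand_def)

text \<open>Vandermonde's identity, applied to the number of points of the graph of \<open>\<sigma>\<close> that avoid the
  rows \<open>I\<close> and the columns \<open>J\<close>, trades matchings outside \<open>I \<times> J\<close> for matchings inside.\<close>

lemma sum_outside_eq_sum_inside:
  assumes I: "I \<subseteq> {1..n}" and J: "J \<subseteq> {1..n}" and IJ: "card I + card J \<le> n"
  shows "(\<Sum>R | R \<subseteq> ({1..n} - I) \<times> ({1..n} - J) \<and> card R = l. s f (L \<union> R))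
    = (\<Sum>M\<in>Pow (I \<times> J). vand (n - card I - card J) l (card M) * s f (L \<union> M))"
proof -
  define O' where "O' = ({1..n} - I) \<times> ({1..n} - J)"
  define n0 where "n0 = n - card I - card J"
  have fin: "finite O'" "finite (I \<times> J)" using I J by (auto simp: O'_def intro: finite_subset)
  have sub: "O' \<subseteq> PP" "I \<times> J \<subseteq> PP" using I J by (auto simp: O'_def grid_def)
  have UL: "s f (L \<union> R) = (\<Sum>\<sigma>\<in>U L. of_bool (R \<subseteq> graph \<sigma>) * f \<sigma>)" if "R \<subseteq> PP" for R
    unfolding s_def U_Un using that
    by (intro sum.mono_neutral_cong_left) (auto simp: U_iff_graph[symmetric] U_def)
  have "(\<Sum>R | R \<subseteq> O' \<and> card R = l. s f (L \<union> R))
      = (\<Sum>R | R \<subseteq> O' \<and> card R = l. \<Sum>\<sigma>\<in>U L. of_bool (R \<subseteq> graph \<sigma>) * f \<sigma>)"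
    using sub by (intro sum.cong refl UL) auto
  also have "\<dots> = (\<Sum>\<sigma>\<in>U L. \<Sum>R | R \<subseteq> O' \<and> card R = l. of_bool (R \<subseteq> graph \<sigma>) * f \<sigma>)"
    by (rule sum.swap)
  also have "\<dots> = (\<Sum>\<sigma>\<in>U L. \<Sum>M\<in>Pow (I \<times> J). vand n0 l (card M) * (of_bool (M \<subseteq> graph \<sigma>) * f \<sigma>))"
  proof (rule sum.cong[OF refl])
    fix \<sigma> assume "\<sigma> \<in> U L"
    then have \<sigma>: "\<sigma> \<in> G" by (auto simp: U_def)
    define m where "m = card (graph \<sigma> \<inter> (I \<times> J))"
    have "(\<Sum>R | R \<subseteq> O' \<and> card R = l. of_bool (R \<subseteq> graph \<sigma>) * f \<sigma>)
        = (\<Sum>R | R \<subseteq> graph \<sigma> \<inter> O' \<and> card R = l. f \<sigma>)"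
      using fin by (intro sum.mono_neutral_cong_right) auto
    also have "\<dots> = real ((n0 + m) choose l) * f \<sigma>"
    proof -
      have "card {R. R \<subseteq> graph \<sigma> \<inter> O' \<and> card R = l} = card (graph \<sigma> \<inter> O') choose l"
        by (rule n_subsets) (use fin in simp)
      moreover have "card (graph \<sigma> \<inter> O') = n0 + m"
        unfolding O'_def n0_def m_def by (rule card_graph_diff[OF \<sigma> I J IJ])
      ultimately show ?thesis by (simp only: sum_constant)
    qed
    \<comment> \<open>Of the two numbers only \<open>m\<close> depends on \<sigma>, and a binomial
      coefficient of \<open>m\<close> counts the subsets of the graph inside
      \<open>I \<times> J\<close>; this is what turns the count into a sum over
      \<open>M\<close>.\<close>
    also have "real ((n0 + m) choose l) = (\<Sum>j\<le>l. real (m choose j) * vand n0 l j)"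
      by (simp add: vand_def add.commute[of n0] flip: vandermonde of_nat_mult of_nat_sum)
    also have "\<dots> = (\<Sum>M\<in>Pow (graph \<sigma> \<inter> (I \<times> J)). vand n0 l (card M))"
      unfolding m_def using fin by (intro sum_Pow_by_card[symmetric]) (auto simp: vand_def)
    also have "\<dots> * f \<sigma> = (\<Sum>M\<in>Pow (graph \<sigma> \<inter> (I \<times> J)). vand n0 l (card M) * f \<sigma>)"
      by (rule sum_distrib_right)
    also have "\<dots> = (\<Sum>M\<in>Pow (I \<times> J). vand n0 l (card M) * (of_bool (M \<subseteq> graph \<sigma>) * f \<sigma>))"
      using fin by (intro sum.mono_neutral_cong_left) auto
    finally show "(\<Sum>R | R \<subseteq> O' \<and> card R = l. of_bool (R \<subseteq> graph \<sigma>) * f \<sigma>)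
        = (\<Sum>M\<in>Pow (I \<times> J). vand n0 l (card M) * (of_bool (M \<subseteq> graph \<sigma>) * f \<sigma>))" .
  qed
  also have "\<dots> = (\<Sum>M\<in>Pow (I \<times> J). \<Sum>\<sigma>\<in>U L. vand n0 l (card M) * (of_bool (M \<subseteq> graph \<sigma>) * f \<sigma>))"
    by (rule sum.swap)
  also have "\<dots> = (\<Sum>M\<in>Pow (I \<times> J). vand n0 l (card M) * s f (L \<union> M))"
    using sub by (intro sum.cong refl) (subst UL, auto simp only: sum_distrib_left)
  finally show ?thesis by (simp add: O'_def n0_def)
qed

section \<open>Symmetries of the space of pairs\<close>

lemma Av_relabel:
  assumes \<alpha>: "\<alpha> \<in> G" and \<beta>: "\<beta> \<in> G" and A: "finite A"
  shows "Av A (\<lambda>z. F (relabel \<alpha> \<beta> \<circ> z)) y = Av A F (relabel \<alpha> \<beta> \<circ> y)"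
  using A
proof (induction A arbitrary: y rule: finite_induct)
  case (insert i A)
  have "bij_betw \<alpha> {1..n} {1..n}" "bij_betw \<beta> {1..n} {1..n}"
    using \<alpha> \<beta> by (auto simp: sym_grp_def permutes_imp_bij)
  then have "bij_betw (map_prod \<alpha> \<beta>) PP PP" unfolding grid_def by (rule bij_betw_map_prod)
  moreover have "map_prod \<alpha> \<beta> = relabel \<alpha> \<beta>" by (rule ext) (simp add: relabel_def map_prod_def case_prod_beta)
  ultimately have b: "bij_betw (relabel \<alpha> \<beta>) PP PP" by simp
  define H where "H w = Av A F ((relabel \<alpha> \<beta> \<circ> y)(i := w))" for w
  have "Av (insert i A) (\<lambda>z. F (relabel \<alpha> \<beta> \<circ> z)) y
      = (\<Sum>w\<in>PP. Av A F (relabel \<alpha> \<beta> \<circ> y(i := w))) / real (card PP)"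
    by (simp only: Av_insert[OF insert.hyps(1)] av_def insert.IH)
  also have "\<dots> = (\<Sum>w\<in>PP. H (relabel \<alpha> \<beta> w)) / real (card PP)"
    by (simp only: fun_upd_comp H_def)
  also have "(\<Sum>w\<in>PP. H (relabel \<alpha> \<beta> w)) = (\<Sum>w\<in>PP. H w)"
    by (rule sum.reindex_bij_betw[OF b])
  finally show ?case by (simp only: Av_insert[OF insert.hyps(1)] av_def H_def)
qed simp

text \<open>In contrast to \<open>relabel\<close>, the permutation acts on positions and not on
  column labels; different positions exchange their columns and keep their rows.\<close>

definition colperm :: "(nat \<Rightarrow> nat) \<Rightarrow> (nat \<Rightarrow> nat \<times> nat) \<Rightarrow> nat \<Rightarrow> nat \<times> nat" where
  "colperm \<pi> y = (\<lambda>k. (fst (y k), snd (y (\<pi> k))))"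

lemma colperm_colperm: "colperm \<pi> (colperm \<rho> y) = colperm (\<rho> \<circ> \<pi>) y"
  by (auto simp: colperm_def)

text \<open>\<open>PP\<close> is a full product of rows and columns, so the columns of the pairs are
  exchangeable independently of the rows.\<close>

lemma Av_colperm:
  assumes A: "finite A" and \<pi>: "\<pi> permutes A"
  shows "Av A (\<lambda>z. F (colperm \<pi> z)) y = Av A F y"
proof -
  let ?m = "\<lambda>z i. if i \<in> A then z i else y i"
  have m: "colperm \<pi> (?m z) = ?m (colperm \<pi> z)" for z
  proof
    fix k
    show "colperm \<pi> (?m z) k = ?m (colperm \<pi> z) k"
      using permutes_in_image[OF \<pi>, of k] permutes_not_in[OF \<pi>, of k] by (cases "k \<in> A") (simp_all add: colperm_def)
  qed
  have mem: "colperm \<rho> z \<in> PiE A (\<lambda>_. PP)" if \<rho>: "\<rho> permutes A" and z: "z \<in> PiE A (\<lambda>_. PP)" for \<rho> z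
  proof (rule PiE_I)
    fix k assume "k \<in> A"
    then have "z k \<in> PP" "z (\<rho> k) \<in> PP"
      using PiE_mem[OF z] permutes_in_image[OF \<rho>, of k] by simp_all
    then show "colperm \<rho> z k \<in> PP" by (simp add: colperm_def grid_def mem_Times_iff)
  next
    fix k assume "k \<notin> A"
    then show "colperm \<rho> z k = undefined"
      using PiE_arb[OF z, of k] permutes_not_in[OF \<rho>, of k] by (simp add: colperm_def)
  qed
  have "(\<Sum>z\<in>PiE A (\<lambda>_. PP). F (?m (colperm \<pi> z))) = (\<Sum>z\<in>PiE A (\<lambda>_. PP). F (?m z))"
  proof (rule sum.reindex_bij_witness[where i = "colperm (inv \<pi>)" and j = "colperm \<pi>"])
    fix z assume z: "z \<in> PiE A (\<lambda>_. PP)"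
    show "colperm \<pi> z \<in> PiE A (\<lambda>_. PP)" "colperm (inv \<pi>) z \<in> PiE A (\<lambda>_. PP)"
      using mem[OF \<pi> z] mem[OF permutes_inv[OF \<pi>] z] .
    show "colperm (inv \<pi>) (colperm \<pi> z) = z" "colperm \<pi> (colperm (inv \<pi>) z) = z"
      by (simp_all only: colperm_colperm permutes_inv_o[OF \<pi>]) (simp_all add: colperm_def)
  qed (rule refl)
  then show ?thesis by (simp only: Av_sum_form[OF A] m)
qed

lemma matching_subset: "matching M \<Longrightarrow> M' \<subseteq> M \<Longrightarrow> matching M'"
  by (auto simp: matching_def intro: inj_on_subset)

lemma matching_fst_eq: "matching M \<Longrightarrow> p \<in> M \<Longrightarrow> p' \<in> M \<Longrightarrow> fst p = fst p' \<Longrightarrow> p = p'"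
  by (auto simp: matching_def dest: inj_onD)

lemma matching_card_fst: "matching M \<Longrightarrow> card (fst ` M) = card M"
  by (simp add: matching_def card_image)

lemma matching_card_snd: "matching M \<Longrightarrow> card (snd ` M) = card M"
  by (simp add: matching_def card_image)

lemma valid_image: "y \<in> valid \<Longrightarrow> y ` S \<subseteq> PP"
  by (auto simp: valid_def)

lemma valid_rows: "y \<in> valid \<Longrightarrow> fst ` y ` S \<subseteq> {1..n}"
  and valid_cols: "y \<in> valid \<Longrightarrow> snd ` y ` S \<subseteq> {1..n}"
  using valid_image[of y S] by (auto simp: grid_def)

text \<open>Relabelling acts transitively on matchings of one size that avoid \<open>I\<close> and
  \<open>J\<close>: a bijection between their edges induces bijections of the rows and of the
  columns used, which extend within the complements of \<open>I\<close> and
  \<open>J\<close>.\<close>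

lemma matching_relabelling:
  assumes R: "matching R" "R \<subseteq> ({1..n} - I) \<times> ({1..n} - J)"
    and R': "matching R'" "R' \<subseteq> ({1..n} - I) \<times> ({1..n} - J)" and card: "card R = card R'"
  obtains \<alpha> \<beta> where "\<alpha> \<in> G" "\<beta> \<in> G" "\<And>i. i \<in> I \<Longrightarrow> \<alpha> i = i" "\<And>j. j \<in> J \<Longrightarrow> \<beta> j = j"
    "relabel \<alpha> \<beta> ` R = R'"
proof -
  have fin: "finite R" "finite R'" by (rule finite_subset[OF R(2)], simp, rule finite_subset[OF R'(2)], simp)
  obtain g where g: "bij_betw g R R'" using finite_same_card_bij[OF fin card] by blast
  have bij: "bij_betw (h \<circ> g \<circ> the_inv_into R h) (h ` R) (h ` R')"
    if "inj_on h R" "inj_on h R'" for h :: "nat \<times> nat \<Rightarrow> nat"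
  proof -
    have "bij_betw (the_inv_into R h) (h ` R) R" "bij_betw h R' (h ` R')"
      using that by (simp_all add: bij_betw_the_inv_into inj_on_imp_bij_betw)
    then show ?thesis using g by (intro bij_betw_trans)
  qed
  have inj: "inj_on fst R" "inj_on fst R'" "inj_on snd R" "inj_on snd R'"
    using R R' by (auto simp: matching_def)
  have sub: "fst ` R \<subseteq> {1..n} - I" "fst ` R' \<subseteq> {1..n} - I" "snd ` R \<subseteq> {1..n} - J" "snd ` R' \<subseteq> {1..n} - J"
    using R(2) R'(2) by (auto simp del: atLeastAtMost_iff)
  obtain \<alpha> where \<alpha>: "\<alpha> permutes {1..n} - I" "\<And>a. a \<in> fst ` R \<Longrightarrow> \<alpha> a = (fst \<circ> g \<circ> the_inv_into R fst) a"
    by (rule extend_bij_to_permutation[OF _ sub(1,2) bij[OF inj(1,2)]]) auto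
  obtain \<beta> where \<beta>: "\<beta> permutes {1..n} - J" "\<And>a. a \<in> snd ` R \<Longrightarrow> \<beta> a = (snd \<circ> g \<circ> the_inv_into R snd) a"
    by (rule extend_bij_to_permutation[OF _ sub(3,4) bij[OF inj(3,4)]]) auto
  have "relabel \<alpha> \<beta> p = g p" if "p \<in> R" for p
    using that \<alpha>(2)[of "fst p"] \<beta>(2)[of "snd p"] inj by (simp add: prod_eq_iff the_inv_into_f_f)
  then have "relabel \<alpha> \<beta> ` R = g ` R" by (rule image_cong[OF refl])
  then have "relabel \<alpha> \<beta> ` R = R'" using g by (simp add: bij_betw_def)
  moreover have "\<alpha> \<in> G" "\<beta> \<in> G"
    unfolding sym_grp_def mem_Collect_eq by (rule permutes_subset[OF \<alpha>(1)], simp, rule permutes_subset[OF \<beta>(1)], simp)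
  ultimately show ?thesis
    using permutes_not_in[OF \<alpha>(1)] permutes_not_in[OF \<beta>(1)] by (intro that) auto
qed

definition distinct_on :: "nat set \<Rightarrow> (nat \<Rightarrow> nat \<times> nat) \<Rightarrow> bool" where
  "distinct_on S y \<longleftrightarrow> inj_on (fst \<circ> y) S \<and> inj_on (snd \<circ> y) S"

lemma distinct_onD:
  assumes "distinct_on S y" "k \<in> S" "k' \<in> S"
  shows "fst (y k) = fst (y k') \<Longrightarrow> k = k'" "snd (y k) = snd (y k') \<Longrightarrow> k = k'"
  using assms unfolding distinct_on_def by (metis comp_apply inj_onD)+

lemma distinct_on_matching:
  assumes "distinct_on S y" shows "matching (y ` S)" "card (y ` S) = card S" "inj_on y S"
proof -
  show "matching (y ` S)" using assms by (auto simp: distinct_on_def matching_def inj_on_def)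
  show "inj_on y S" using assms by (auto simp: distinct_on_def intro: inj_on_imageI2)
  then show "card (y ` S) = card S" by (rule card_image)
qed

lemma matching_distinct_on:
  assumes "finite S" "matching (y ` S)" "card (y ` S) = card S"
  shows "distinct_on S y"
proof -
  have "inj_on y S" using assms by (simp add: eq_card_imp_inj_on)
  then show ?thesis using assms(2) by (auto simp: distinct_on_def matching_def intro: comp_inj_on)
qed

text \<open>Up to the order of the group this averages \<open>s f\<close>, at the edges of
  \<open>y\<close>, over the column permutations fixing \<open>Q\<close>. It is thus a multiple of
  an orthogonal projection, the source of all positivity below.\<close>

definition Z :: "((nat \<Rightarrow> nat) \<Rightarrow> real) \<Rightarrow> nat set \<Rightarrow> nat set \<Rightarrow> (nat \<Rightarrow> nat \<times> nat) \<Rightarrow> real" where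
  "Z f S Q y = (\<Sum>\<pi> | \<pi> permutes S - Q. s f (colperm \<pi> y ` S))"

lemma Z_colperm:
  assumes "\<pi> permutes S - Q"
  shows "Z f S Q (colperm \<pi> y) = Z f S Q y"
  unfolding Z_def colperm_colperm
  using setum_permutations_compose_left[OF assms, of "\<lambda>\<pi>. s f (colperm \<pi> y ` S)"] by simp

lemma colperm_rows: "fst ` colperm \<pi> y ` S = fst ` y ` S"
  by (simp add: colperm_def image_image)

lemma colperm_cols:
  assumes "\<pi> permutes S" shows "snd ` colperm \<pi> y ` S = snd ` y ` S"
proof -
  have "snd ` colperm \<pi> y ` S = (snd \<circ> y) ` \<pi> ` S" by (simp add: colperm_def image_image)
  then show ?thesis by (simp add: permutes_image[OF assms] image_comp)
qed

lemma distinct_on_colperm: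
  assumes "\<pi> permutes S" "distinct_on S y" shows "distinct_on S (colperm \<pi> y)"
proof -
  have "inj_on (snd \<circ> y \<circ> \<pi>) S"
    using assms(2) permutes_image[OF assms(1)]
    by (intro comp_inj_on[of \<pi> S "snd \<circ> y"] permutes_inj_on[OF assms(1)]) (simp add: distinct_on_def)
  moreover have "snd \<circ> colperm \<pi> y = snd \<circ> y \<circ> \<pi>" "fst \<circ> colperm \<pi> y = fst \<circ> y"
    by (simp_all add: colperm_def fun_eq_iff)
  ultimately show ?thesis using assms(2) by (simp only: distinct_on_def)
qed

text \<open>The permutation is read off \<open>P\<close>: \<open>p k\<close> is the edge of
  \<open>P\<close> in the row of \<open>y k\<close>, and \<open>h k\<close> the position whose
  column this edge uses. At positions in \<open>Q\<close> the edge is \<open>y k\<close> itself, so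
  they are fixed.\<close>

lemma perfect_matching_colperm:
  assumes S: "finite S" and y: "distinct_on S y" and Q: "Q \<subseteq> S"
    and P: "matching P" "card P = card S" "P \<subseteq> (fst ` y ` S) \<times> (snd ` y ` S)" "y ` Q \<subseteq> P"
  shows "\<exists>\<pi>. \<pi> permutes S - Q \<and> colperm \<pi> y ` S = P"
proof -
  have inj: "inj_on (fst \<circ> y) S" "inj_on (snd \<circ> y) S" "inj_on fst P" "inj_on snd P"
    using y P by (auto simp: distinct_on_def matching_def)
  have cards: "card (fst ` P) = card ((fst \<circ> y) ` S)" "card (snd ` P) = card ((snd \<circ> y) ` S)"
    unfolding card_image[OF inj(1)] card_image[OF inj(2)] card_image[OF inj(3)] card_image[OF inj(4)]
    using P(2) by simp_all
  have sub: "fst ` P \<subseteq> (fst \<circ> y) ` S" "snd ` P \<subseteq> (snd \<circ> y) ` S"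
    using P(3) by (auto simp: image_comp)
  have im: "fst ` P = (fst \<circ> y) ` S" "snd ` P = (snd \<circ> y) ` S"
    by (rule card_subset_eq[OF finite_imageI[OF S] sub(1) cards(1)],
        rule card_subset_eq[OF finite_imageI[OF S] sub(2) cards(2)])
  define p where "p k = the_inv_into P fst (fst (y k))" for k
  have p: "p k \<in> P" "fst (p k) = fst (y k)" if "k \<in> S" for k
  proof -
    have "fst (y k) \<in> fst ` P" using that im by auto
    then show "p k \<in> P" "fst (p k) = fst (y k)"
      using inj(3) by (auto simp: p_def the_inv_into_into f_the_inv_into_f)
  qed
  have p_unique: "q = p k" if "q \<in> P" "fst q = fst (y k)" for q k
    using that inj(3) by (auto simp: p_def the_inv_into_f_f simp flip: that(2))
  define h where "h k = the_inv_into S (snd \<circ> y) (snd (p k))" for k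
  have h: "h k \<in> S" "snd (y (h k)) = snd (p k)" if "k \<in> S" for k
  proof -
    have m: "snd (p k) \<in> (snd \<circ> y) ` S" using p(1)[OF that] im(2) by auto
    show "h k \<in> S" unfolding h_def by (rule the_inv_into_into[OF inj(2) m order_refl])
    show "snd (y (h k)) = snd (p k)" using f_the_inv_into_f[OF inj(2) m] by (simp add: h_def)
  qed
  define \<pi> where "\<pi> k = (if k \<in> S then h k else k)" for k
  have "inj_on \<pi> S"
  proof (rule inj_onI)
    fix k k' assume k: "k \<in> S" "k' \<in> S" and "\<pi> k = \<pi> k'"
    then have "snd (p k) = snd (p k')" using h(2)[of k] h(2)[of k'] by (simp add: \<pi>_def)
    then have "p k = p k'" using inj(4) p(1) k by (auto dest: inj_onD)
    then show "k = k'" using p(2)[OF k(1)] p(2)[OF k(2)] distinct_onD(1)[OF y k] by simp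
  qed
  moreover have "\<pi> ` S \<subseteq> S" using h(1) by (auto simp: \<pi>_def)
  ultimately have "bij_betw \<pi> S S" using S by (simp add: bij_betw_def endo_inj_surj)
  then have perm: "\<pi> permutes S" by (rule bij_imp_permutes) (simp add: \<pi>_def)
  have fixQ: "\<pi> k = k" if "k \<in> Q" for k
  proof -
    have k: "k \<in> S" using that Q by auto
    have "y k = p k" using that P(4) by (intro p_unique) auto
    then have "(snd \<circ> y) (h k) = (snd \<circ> y) k" using h(2)[OF k] by simp
    then show ?thesis using distinct_onD(2)[OF y h(1)[OF k] k] k by (simp add: \<pi>_def)
  qed
  have "\<pi> permutes S - Q"
    by (rule permutes_superset[OF perm]) (use fixQ in auto)
  moreover have "colperm \<pi> y ` S = P"
  proof
    have eq: "colperm \<pi> y k = p k" if "k \<in> S" for k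
      using that h(2)[OF that] p(2)[OF that] by (simp add: colperm_def \<pi>_def prod_eq_iff)
    then show "colperm \<pi> y ` S \<subseteq> P" using p(1) by auto
    show "P \<subseteq> colperm \<pi> y ` S"
    proof
      fix q assume q: "q \<in> P"
      then obtain k where k: "k \<in> S" "fst q = fst (y k)" using im(1) by fastforce
      then have "q = colperm \<pi> y k" using p_unique[OF q k(2)] eq[OF k(1)] by simp
      then show "q \<in> colperm \<pi> y ` S" using k(1) by blast
    qed
  qed
  ultimately show ?thesis by blast
qed

text \<open>If \<open>f\<close> has no mass on matchings with fewer than \<open>d\<close> edges, only perfect matchings between the
  rows and columns of \<open>y\<close> survive, and they are the column permutations of \<open>y\<close>.\<close>

lemma sum_inside_eq_Z:
  assumes S: "finite S" "card S = d" and yv: "y \<in> valid" and y: "distinct_on S y" and Q: "Q \<subseteq> S"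
    and f: "\<And>M. M \<subseteq> PP \<Longrightarrow> card M < d \<Longrightarrow> s f M = 0"
  shows "(\<Sum>M\<in>Pow ((fst ` y ` S) \<times> (snd ` y ` S)). \<phi> (card M) * s f (y ` Q \<union> M))
    = (\<Sum>X\<in>Pow Q. \<phi> (d - card Q + card X)) * Z f S Q y"
proof -
  define E where "E = (fst ` y ` S) \<times> (snd ` y ` S)"
  have fin: "finite E" using S by (simp add: E_def)
  have EP: "E \<subseteq> PP" unfolding E_def grid_def by (rule Sigma_mono[OF valid_rows[OF yv] valid_cols[OF yv]])
  have inj: "inj_on y S" using distinct_on_matching[OF y] by simp
  then have injQ: "inj_on y Q" using Q by (rule inj_on_subset)
  have yQ: "y ` Q \<subseteq> E"
  proof
    fix p assume "p \<in> y ` Q"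
    then have "p \<in> y ` S" using Q by blast
    then show "p \<in> E" by (simp add: E_def mem_Times_iff)
  qed
  have fQ: "finite Q" by (rule finite_subset[OF Q S(1)])
  define PQ where "PQ = {P \<in> Pow E. y ` Q \<subseteq> P}"
  have finPQ: "finite PQ" using fin by (simp add: PQ_def)
  define c where "c = (\<Sum>X\<in>Pow Q. \<phi> (d - card Q + card X))"
  have perfect: "matching P" "card P = d" if "P \<in> PQ" "s f P \<noteq> 0" for P
  proof -
    show m: "matching P" using that(2) s_zero by blast
    have "card P \<le> card (fst ` y ` S)"
      using that(1) S by (simp flip: matching_card_fst[OF m]) (intro card_mono, auto simp: PQ_def E_def)
    also have "\<dots> \<le> card S" unfolding image_image by (rule card_image_le[OF S(1)])
    finally have "card P \<le> d" using S by simp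
    moreover have "P \<subseteq> PP" using that(1) EP by (auto simp: PQ_def)
    then have "\<not> card P < d" using f that(2) by blast
    ultimately show "card P = d" by simp
  qed
  \<comment> \<open>Group by the union \<open>P\<close> of \<open>M\<close> with the edges at
    \<open>Q\<close>. Given \<open>P\<close>, the set \<open>M\<close> must contain all its other
    edges and is free on those at \<open>Q\<close>; the subset \<open>X\<close> of \<open>Q\<close>
    records this choice.\<close>
  have "(\<Sum>M\<in>Pow E. \<phi> (card M) * s f (y ` Q \<union> M))
      = (\<Sum>P\<in>PQ. \<Sum>M\<in>{M \<in> Pow E. y ` Q \<union> M = P}. \<phi> (card M) * s f (y ` Q \<union> M))"
    using fin finPQ yQ by (intro sum.group[symmetric]) (auto simp: PQ_def)
  also have "\<dots> = (\<Sum>P\<in>PQ. c * s f P)"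
  proof (rule sum.cong[OF refl])
    fix P assume P: "P \<in> PQ"
    have "(\<Sum>M\<in>{M \<in> Pow E. y ` Q \<union> M = P}. \<phi> (card M) * s f (y ` Q \<union> M))
        = (\<Sum>M\<in>{M \<in> Pow E. y ` Q \<union> M = P}. \<phi> (card M)) * s f P"
      by (simp add: sum_distrib_right)
    also have "\<dots> = c * s f P"
    proof (cases "s f P = 0")
      case False
      have cP: "card P = d" using perfect[OF P False] by simp
      have PE: "P \<subseteq> E" "y ` Q \<subseteq> P" using P by (auto simp: PQ_def)
      have finP: "finite P" by (rule finite_subset[OF PE(1) fin])
      have "(\<Sum>M\<in>{M \<in> Pow E. y ` Q \<union> M = P}. \<phi> (card M)) = c"
        unfolding c_def
      proof (rule sum.reindex_bij_witness[where j = "\<lambda>M. {k \<in> Q. y k \<in> M}" and i = "\<lambda>X. (P - y ` Q) \<union> y ` X"])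
        fix M assume M: "M \<in> {M \<in> Pow E. y ` Q \<union> M = P}"
        then have UM: "y ` Q \<union> M = P" by simp
        show eq: "(P - y ` Q) \<union> y ` {k \<in> Q. y k \<in> M} = M" using UM by auto
        show "{k \<in> Q. y k \<in> M} \<in> Pow Q" by auto
        have "card M = card (P - y ` Q) + card (y ` {k \<in> Q. y k \<in> M})"
          by (subst eq[symmetric], subst card_Un_disjoint) (use finP fQ in auto)
        also have "card (P - y ` Q) = d - card Q"
          using PE fQ by (simp add: card_Diff_subset cP card_image[OF injQ])
        also have "card (y ` {k \<in> Q. y k \<in> M}) = card {k \<in> Q. y k \<in> M}"
          by (rule card_image) (rule inj_on_subset[OF injQ], auto)
        finally show "\<phi> (d - card Q + card {k \<in> Q. y k \<in> M}) = \<phi> (card M)" by simp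
      next
        fix X assume X: "X \<in> Pow Q"
        show "{k \<in> Q. y k \<in> (P - y ` Q) \<union> y ` X} = X"
        proof
          show "X \<subseteq> {k \<in> Q. y k \<in> (P - y ` Q) \<union> y ` X}" using X by blast
          show "{k \<in> Q. y k \<in> (P - y ` Q) \<union> y ` X} \<subseteq> X"
          proof
            fix k assume "k \<in> {k \<in> Q. y k \<in> (P - y ` Q) \<union> y ` X}"
            then have k: "k \<in> Q" "y k \<in> y ` X" by auto
            then show "k \<in> X" using X inj_on_image_mem_iff[OF injQ] by blast
          qed
        qed
        show "(P - y ` Q) \<union> y ` X \<in> {M \<in> Pow E. y ` Q \<union> M = P}"
          using X PE by auto
      qed
      then show ?thesis by simp
    qed simp
    finally show "(\<Sum>M\<in>{M \<in> Pow E. y ` Q \<union> M = P}. \<phi> (card M) * s f (y ` Q \<union> M)) = c * s f P" .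
  qed
  also have "\<dots> = c * (\<Sum>P\<in>PQ. s f P)" by (rule sum_distrib_left[symmetric])
  also have "(\<Sum>P\<in>PQ. s f P) = (\<Sum>P\<in>(\<lambda>\<pi>. colperm \<pi> y ` S) ` {\<pi>. \<pi> permutes S - Q}. s f P)"
  proof (rule sum.mono_neutral_right[OF finPQ])
    show "(\<lambda>\<pi>. colperm \<pi> y ` S) ` {\<pi>. \<pi> permutes S - Q} \<subseteq> PQ"
    proof
      fix P assume "P \<in> (\<lambda>\<pi>. colperm \<pi> y ` S) ` {\<pi>. \<pi> permutes S - Q}"
      then obtain \<pi> where \<pi>: "\<pi> permutes S - Q" and P: "P = colperm \<pi> y ` S" by auto
      have \<pi>S: "\<pi> permutes S" by (rule permutes_subset[OF \<pi>]) auto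
      have "fst ` P = fst ` y ` S" "snd ` P = snd ` y ` S"
        unfolding P by (rule colperm_rows, rule colperm_cols[OF \<pi>S])
      then have "P \<subseteq> E" using subset_fst_snd[of P] by (simp only: E_def)
      moreover have "y k \<in> P" if "k \<in> Q" for k
      proof -
        have "colperm \<pi> y k = y k" using that permutes_not_in[OF \<pi>, of k] by (simp add: colperm_def)
        then show ?thesis using that Q unfolding P by (metis imageI subsetD)
      qed
      ultimately show "P \<in> PQ" by (auto simp: PQ_def)
    qed
    show "\<forall>P\<in>PQ - (\<lambda>\<pi>. colperm \<pi> y ` S) ` {\<pi>. \<pi> permutes S - Q}. s f P = 0"
    proof (intro ballI, rule ccontr)
      fix P assume P: "P \<in> PQ - (\<lambda>\<pi>. colperm \<pi> y ` S) ` {\<pi>. \<pi> permutes S - Q}" and "s f P \<noteq> 0"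
      then have "\<exists>\<pi>. \<pi> permutes S - Q \<and> colperm \<pi> y ` S = P"
        using perfect[of P] S by (intro perfect_matching_colperm y Q) (auto simp: PQ_def E_def)
      then show False using P by auto
    qed
  qed
  also have "\<dots> = Z f S Q y"
    unfolding Z_def
  proof (subst sum.reindex)
    show "inj_on (\<lambda>\<pi>. colperm \<pi> y ` S) {\<pi>. \<pi> permutes S - Q}"
    proof (rule inj_onI, rule ext)
      fix \<pi> \<pi>' k assume "\<pi> \<in> {\<pi>. \<pi> permutes S - Q}" "\<pi>' \<in> {\<pi>. \<pi> permutes S - Q}"
        and eq: "colperm \<pi> y ` S = colperm \<pi>' y ` S"
      then have \<pi>: "\<pi> permutes S - Q" "\<pi>' permutes S - Q" by auto
      then have \<pi>S: "\<pi> permutes S" "\<pi>' permutes S" by (auto intro: permutes_subset)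
      show "\<pi> k = \<pi>' k"
      proof (cases "k \<in> S")
        case True
        then have "colperm \<pi> y k \<in> colperm \<pi>' y ` S" using eq by blast
        then obtain k' where k': "k' \<in> S" "fst (y k) = fst (y k')" "snd (y (\<pi> k)) = snd (y (\<pi>' k'))"
          by (auto simp: colperm_def)
        then have "k = k'" using distinct_onD(1)[OF y True] by blast
        moreover have "\<pi> k \<in> S" "\<pi>' k' \<in> S" using True k' \<pi>S by (simp_all add: permutes_in_image)
        ultimately show ?thesis using k'(3) distinct_onD(2)[OF y] by blast
      next
        case False
        then show ?thesis using permutes_not_in[OF \<pi>S(1)] permutes_not_in[OF \<pi>S(2)] by simp
      qed
    qed
  qed simp
  finally show ?thesis by (simp add: E_def c_def)
qed

text \<open>If positions collide, either edges coincide and fewer than \<open>d\<close> remain, or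
  they conflict and no permutation contains them all.\<close>

lemma s_image_zero:
  assumes S: "finite S" "card S = d" and yv: "y \<in> valid" and y: "\<not> distinct_on S y"
    and f: "\<And>M. M \<subseteq> PP \<Longrightarrow> card M < d \<Longrightarrow> s f M = 0"
  shows "s f (y ` S) = 0"
proof (rule ccontr)
  assume nz: "s f (y ` S) \<noteq> 0"
  then have "matching (y ` S)" "\<not> card (y ` S) < d" using s_zero f valid_image[OF yv] by blast+
  moreover have "card (y ` S) \<le> d" using card_image_le[OF S(1), of y] S(2) by simp
  ultimately show False using matching_distinct_on[OF S(1), of y] S(2) y by simp
qed

text \<open>Averaging over column permutations turns the pairing into a square.\<close>

lemma Av_pairing_nonneg:
  assumes A: "finite A" and S: "S \<subseteq> A" and y0: "y0 \<in> valid"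
    and D0: "\<And>y. y \<in> valid \<Longrightarrow> 0 \<le> D y"
    and Dp: "\<And>y \<pi>. y \<in> valid \<Longrightarrow> \<pi> permutes S - Q \<Longrightarrow> D (colperm \<pi> y) = D y"
  shows "0 \<le> Av A (\<lambda>y. D y * s f (y ` S) * Z f S Q y) y0"
proof -
  let ?T = "{\<pi>. \<pi> permutes S - Q}"
  let ?a = "Av A (\<lambda>y. D y * s f (y ` S) * Z f S Q y) y0"
  have fS: "finite S" using A S by (rule finite_subset[rotated])
  have finT: "finite ?T" "card ?T > 0"
    using fS card_permutations[of "S - Q"] by (auto simp: finite_permutations)
  have "real (card ?T) * ?a = (\<Sum>\<pi>\<in>?T. ?a)" by simp
  also have "\<dots> = (\<Sum>\<pi>\<in>?T. Av A (\<lambda>y. D y * Z f S Q y * s f (colperm \<pi> y ` S)) y0)"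
  proof (rule sum.cong[OF refl])
    fix \<pi> assume "\<pi> \<in> ?T"
    then have \<pi>: "\<pi> permutes S - Q" by simp
    have \<pi>A: "\<pi> permutes A" by (rule permutes_subset[OF \<pi>]) (use S in auto)
    have "?a = Av A (\<lambda>y. D (colperm \<pi> y) * s f (colperm \<pi> y ` S) * Z f S Q (colperm \<pi> y)) y0"
      by (rule Av_colperm[OF A \<pi>A, symmetric])
    also have "\<dots> = Av A (\<lambda>y. D y * Z f S Q y * s f (colperm \<pi> y ` S)) y0"
      by (rule Av_cong_valid[OF A y0]) (simp add: Dp[OF _ \<pi>] Z_colperm[OF \<pi>])
    finally show "?a = Av A (\<lambda>y. D y * Z f S Q y * s f (colperm \<pi> y ` S)) y0" .
  qed
  also have "\<dots> = Av A (\<lambda>y. \<Sum>\<pi>\<in>?T. D y * Z f S Q y * s f (colperm \<pi> y ` S)) y0"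
    by (rule Av_sum[symmetric, OF A finT(1)])
  also have "\<dots> = Av A (\<lambda>y. D y * (Z f S Q y)\<^sup>2) y0"
    by (simp only: sum_distrib_left[symmetric] Z_def[symmetric] power2_eq_square mult.assoc)
  also have "\<dots> \<ge> 0" using D0 by (intro Av_nonneg_valid[OF A y0]) auto
  finally show ?thesis using finT(2) by (simp add: zero_le_mult_iff)
qed

end

section \<open>Coupling permutations with independent edges\<close>

context finite_alphabet
begin

lemma Av_prod_indicator:
  assumes "finite A"
  shows "Av A (\<lambda>z. \<Prod>k\<in>A. \<phi> (z k)) y = ((\<Sum>p\<in>Om. \<phi> p) / real (card Om)) ^ card A"
  using assms
proof (induction A arbitrary: y rule: finite_induct)
  case (insert i A)
  have "Av (insert i A) (\<lambda>z. \<Prod>k\<in>insert i A. \<phi> (z k)) y = av i (Av A (\<lambda>z. \<phi> (z i) * (\<Prod>k\<in>A. \<phi> (z k)))) y"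
    using insert.hyps by (simp add: Av_insert)
  also have "Av A (\<lambda>z. \<phi> (z i) * (\<Prod>k\<in>A. \<phi> (z k))) = (\<lambda>z. \<phi> (z i) * ((\<Sum>p\<in>Om. \<phi> p) / real (card Om)) ^ card A)"
  proof
    fix z
    have "Av A (\<lambda>z. \<phi> (z i) * (\<Prod>k\<in>A. \<phi> (z k))) z = \<phi> (z i) * Av A (\<lambda>z. \<Prod>k\<in>A. \<phi> (z k)) z"
      using insert.hyps by (intro Av_mult_indep) auto
    then show "Av A (\<lambda>z. \<phi> (z i) * (\<Prod>k\<in>A. \<phi> (z k))) z = \<phi> (z i) * ((\<Sum>p\<in>Om. \<phi> p) / real (card Om)) ^ card A"
      by (simp only: insert.IH)
  qed
  also have "av i (\<lambda>z. \<phi> (z i) * ((\<Sum>p\<in>Om. \<phi> p) / real (card Om)) ^ card A) y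
      = ((\<Sum>p\<in>Om. \<phi> p) / real (card Om)) ^ card (insert i A)"
    using insert.hyps by (simp add: av_def sum_distrib_right[symmetric])
  finally show ?case .
qed simp

lemma Av_local:
  assumes "finite A" and loc: "\<And>z z'. (\<And>i. i \<in> B \<Longrightarrow> z i = z' i) \<Longrightarrow> F z = F z'"
    and eq: "\<And>i. i \<in> B - A \<Longrightarrow> y i = y' i"
  shows "Av A F y = Av A F y'"
proof -
  have "F (\<lambda>i. if i \<in> A then z i else y i) = F (\<lambda>i. if i \<in> A then z i else y' i)" for z
    by (rule loc) (use eq in auto)
  then show ?thesis by (simp only: Av_sum_form[OF assms(1)])
qed

end

locale coupling = symmetric_group +
  fixes N :: nat
  assumes N2: "2 * N \<le> n"
begin

abbreviation "AA \<equiv> {..<N}"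

section \<open>Kept pairs and the conditional expectation\<close>

definition kept :: "(nat \<Rightarrow> nat \<times> nat) \<Rightarrow> nat set" where
  "kept y = {k. k < N \<and> (\<forall>l<N. l \<noteq> k \<longrightarrow> fst (y l) \<noteq> fst (y k) \<and> snd (y l) \<noteq> snd (y k))}"

text \<open>For valid \<open>y\<close> the denominator is the number of permutations containing the
  kept edges, by \<open>card_U\<close>, so this is a conditional mean.\<close>

definition C :: "((nat \<Rightarrow> nat) \<Rightarrow> real) \<Rightarrow> (nat \<Rightarrow> nat \<times> nat) \<Rightarrow> real" where
  "C f y = s f (y ` kept y) / fact (n - card (kept y))"

lemma kept_cong: "(\<And>i. i < N \<Longrightarrow> z i = z' i) \<Longrightarrow> kept z = kept z'"
  by (auto simp: kept_def)

lemma kept_sub: "kept y \<subseteq> AA"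
  by (auto simp: kept_def)

lemma finite_ker: "finite (kept y)"
  by (rule finite_subset[OF kept_sub]) simp

lemma kept_distinct: "distinct_on (kept y) y"
  unfolding distinct_on_def
proof (intro conjI inj_onI)
  fix k k' assume k: "k \<in> kept y" "k' \<in> kept y"
  show "k = k'" if "(fst \<circ> y) k = (fst \<circ> y) k'" using k that by (force simp: kept_def)
  show "k = k'" if "(snd \<circ> y) k = (snd \<circ> y) k'" using k that by (force simp: kept_def)
qed

lemma kept_matching: "S \<subseteq> kept y \<Longrightarrow> matching (y ` S)"
  using distinct_on_matching(1)[OF kept_distinct] by (rule matching_subset) blast

lemma kept_inj: "inj_on y (kept y)"
  by (rule distinct_on_matching(3)[OF kept_distinct])

lemma kept_relabel:
  assumes "\<alpha> \<in> G" "\<beta> \<in> G"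
  shows "kept (relabel \<alpha> \<beta> \<circ> y) = kept y"
proof -
  have "\<alpha> a = \<alpha> b \<longleftrightarrow> a = b" "\<beta> a = \<beta> b \<longleftrightarrow> a = b" for a b
    using G_inj[OF assms(1)] G_inj[OF assms(2)] by (auto dest: injD)
  then show ?thesis by (simp add: kept_def)
qed

lemma C_one:
  assumes "y \<in> valid"
  shows "C (\<lambda>_. 1) y = 1"
proof -
  have "card (U (y ` kept y)) = fact (n - card (kept y))"
    using card_U[OF kept_matching[OF order_refl] valid_image[OF assms]]
    by (simp only: distinct_on_matching(2)[OF kept_distinct])
  then show ?thesis by (simp add: C_def s_def)
qed

lemma C_square_le:
  assumes "y \<in> valid"
  shows "(C f y)\<^sup>2 \<le> C (\<lambda>\<sigma>. (f \<sigma>)\<^sup>2) y"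
proof -
  have card: "card (U (y ` kept y)) = fact (n - card (kept y))"
    using card_U[OF kept_matching[OF order_refl] valid_image[OF assms]]
    by (simp only: distinct_on_matching(2)[OF kept_distinct])
  have "(\<Sum>\<sigma>\<in>U (y ` kept y). 1 * f \<sigma>)\<^sup>2 \<le> (\<Sum>\<sigma>\<in>U (y ` kept y). 1\<^sup>2) * (\<Sum>\<sigma>\<in>U (y ` kept y). (f \<sigma>)\<^sup>2)"
    by (rule Cauchy_Schwarz_ineq_sum)
  then have "(s f (y ` kept y))\<^sup>2 \<le> fact (n - card (kept y)) * s (\<lambda>\<sigma>. (f \<sigma>)\<^sup>2) (y ` kept y)"
    by (simp add: s_def card)
  then show ?thesis
    by (simp add: C_def power_divide power2_eq_square field_simps)
qed

definition outer :: "nat set \<Rightarrow> (nat \<Rightarrow> nat \<times> nat) \<Rightarrow> nat \<Rightarrow> (nat \<times> nat) set set" where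
  "outer S y l = {R. R \<subseteq> ({1..n} - fst ` y ` S) \<times> ({1..n} - snd ` y ` S) \<and> card R = l}"

definition ev :: "(nat \<Rightarrow> nat \<times> nat) \<Rightarrow> nat set \<Rightarrow> nat set \<Rightarrow> nat \<Rightarrow> real" where
  "ev y S Q l = Av (AA - S) (\<lambda>z. of_bool (kept z \<inter> S = Q \<and> card (kept z - S) = l)) y"

text \<open>Given \<open>y\<close> on \<open>S\<close>: the probability that \<open>Q\<close> is
  what is kept of \<open>S\<close> and that one particular matching of size \<open>l\<close> is kept
  outside, spread over the permutations containing these edges. It does not involve
  \<open>f\<close>.\<close>

definition wt :: "(nat \<Rightarrow> nat \<times> nat) \<Rightarrow> nat set \<Rightarrow> nat set \<Rightarrow> nat \<Rightarrow> real" where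
  "wt y S Q l = ev y S Q l / real (card {R \<in> outer S y l. matching R}) / fact (n - card Q - l)"

lemma finite_outer: "finite (outer S y l)"
  unfolding outer_def by (rule finite_subset[of _ "Pow ({1..n} \<times> {1..n})"]) auto

lemma wt_nonneg: "y \<in> valid \<Longrightarrow> 0 \<le> wt y S Q l"
  unfolding wt_def ev_def by (intro divide_nonneg_nonneg Av_nonneg_valid) auto

text \<open>A kept pair conflicts with no other position, hence with none of \<open>S\<close>,
  whether kept or not. So the rectangle avoids the rows and columns of all of
  \<open>S\<close>.\<close>

lemma kept_outer:
  assumes S: "S \<subseteq> AA" and yv: "y \<in> valid"
    and z: "\<And>i. i \<notin> AA - S \<Longrightarrow> z i = y i" "\<And>i. i \<in> AA - S \<Longrightarrow> z i \<in> PP"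
  shows "z ` (kept z - S) \<in> outer S y l \<longleftrightarrow> card (kept z - S) = l"
proof -
  have "card (z ` (kept z - S)) = card (kept z - S)"
    by (rule card_image) (rule inj_on_subset[OF kept_inj], blast)
  moreover
  have "z k \<in> ({1..n} - fst ` y ` S) \<times> ({1..n} - snd ` y ` S)" if k: "k \<in> kept z - S" for k
  proof -
    have kN: "k \<in> AA - S" using k kept_sub by auto
    have in_grid: "fst (z k) \<in> {1..n}" "snd (z k) \<in> {1..n}" using z(2)[OF kN] by (auto simp: grid_def mem_Times_iff)
    have ne: "fst (y j) \<noteq> fst (z k) \<and> snd (y j) \<noteq> snd (z k)" if j: "j \<in> S" for j
    proof -
      have "j < N" "j \<noteq> k" "z j = y j" using j S k z(1)[of j] by auto
      then show ?thesis using k by (force simp: kept_def)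
    qed
    have "fst (z k) \<notin> fst ` y ` S"
    proof
      assume "fst (z k) \<in> fst ` y ` S"
      then obtain j where "j \<in> S" "fst (z k) = fst (y j)" unfolding image_image by (elim imageE)
      then show False using ne[of j] by simp
    qed
    moreover have "snd (z k) \<notin> snd ` y ` S"
    proof
      assume "snd (z k) \<in> snd ` y ` S"
      then obtain j where "j \<in> S" "snd (z k) = snd (y j)" unfolding image_image by (elim imageE)
      then show False using ne[of j] by simp
    qed
    ultimately show ?thesis using in_grid by (simp only: mem_Times_iff Diff_iff) simp
  qed
  then have "z ` (kept z - S) \<subseteq> ({1..n} - fst ` y ` S) \<times> ({1..n} - snd ` y ` S)"
    by (rule image_subsetI)
  ultimately show ?thesis by (simp only: outer_def mem_Collect_eq) simp
qed

text \<open>A relabelling that fixes the rows and columns of \<open>y\<close> on \<open>S\<close>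
  moves \<open>R\<close> to any other matching of its size in the rectangle and preserves the law of
  the remaining pairs. These matchings are therefore equally likely, and sets that are no matchings
  have probability 0.\<close>

lemma Av_kept_value:
  assumes S: "S \<subseteq> AA" and yv: "y \<in> valid" and R: "R \<in> outer S y l" "matching R"
  shows "Av (AA - S) (\<lambda>z. of_bool (kept z \<inter> S = Q \<and> z ` (kept z - S) = R)) y
    = ev y S Q l / real (card {R \<in> outer S y l. matching R})"
proof -
  define pr where "pr R = Av (AA - S) (\<lambda>z. of_bool (kept z \<inter> S = Q \<and> z ` (kept z - S) = R)) y" for R
  have fin: "finite (AA - S)" by simp
  have eq: "pr R' = pr R" if R': "R' \<in> outer S y l" "matching R'" for R'
  proof -
    obtain \<alpha> \<beta> where ab: "\<alpha> \<in> G" "\<beta> \<in> G" and fix1: "\<And>i. i \<in> fst ` y ` S \<Longrightarrow> \<alpha> i = i"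
      and fix2: "\<And>j. j \<in> snd ` y ` S \<Longrightarrow> \<beta> j = j" and im: "relabel \<alpha> \<beta> ` R = R'"
      using R R' by (elim matching_relabelling[of R "fst ` y ` S" "snd ` y ` S" R', rotated 5]) (auto simp only: outer_def mem_Collect_eq)
    have inj: "inj (relabel \<alpha> \<beta>)" using ab by (intro inj_relabel G_inj)
    have "pr R' = Av (AA - S) (\<lambda>z. of_bool (kept z \<inter> S = Q \<and> z ` (kept z - S) = R')) (relabel \<alpha> \<beta> \<circ> y)"
      unfolding pr_def
    proof (rule Av_local[OF fin, of AA])
      fix z z' :: "nat \<Rightarrow> nat \<times> nat" assume zz: "\<And>i. i \<in> AA \<Longrightarrow> z i = z' i"
      have k: "kept z = kept z'" by (rule kept_cong) (use zz in auto)
      have "z ` (kept z' - S) = z' ` (kept z' - S)"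
        by (rule image_cong[OF refl]) (use zz kept_sub[of z'] in auto)
      then show "of_bool (kept z \<inter> S = Q \<and> z ` (kept z - S) = R') = (of_bool (kept z' \<inter> S = Q \<and> z' ` (kept z' - S) = R') :: real)"
        by (simp only: k)
    next
      fix i assume "i \<in> AA - (AA - S)"
      then have "fst (y i) \<in> fst ` y ` S" "snd (y i) \<in> snd ` y ` S" by auto
      then show "y i = (relabel \<alpha> \<beta> \<circ> y) i"
        by (simp add: prod_eq_iff fix1 fix2)
    qed
    also have "\<dots> = Av (AA - S) (\<lambda>z. of_bool (kept (relabel \<alpha> \<beta> \<circ> z) \<inter> S = Q \<and> (relabel \<alpha> \<beta> \<circ> z) ` (kept (relabel \<alpha> \<beta> \<circ> z) - S) = R')) y"
      by (rule Av_relabel[OF ab fin, symmetric])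
    also have "\<dots> = pr R"
      unfolding pr_def kept_relabel[OF ab] image_comp[symmetric] im[symmetric] inj_image_eq_iff[OF inj] ..
    finally show ?thesis .
  qed
  have zero: "pr R' = 0" if "\<not> matching R'" for R'
  proof -
    have "z ` (kept z - S) \<noteq> R'" for z using that kept_matching[of "kept z - S" z] by auto
    then show ?thesis unfolding pr_def using fin by simp
  qed
  have "ev y S Q l = Av (AA - S) (\<lambda>z. \<Sum>R'\<in>outer S y l. of_bool (kept z \<inter> S = Q \<and> z ` (kept z - S) = R')) y"
    unfolding ev_def
  proof (rule Av_cong[OF fin])
    fix z assume z: "\<And>i. i \<notin> AA - S \<Longrightarrow> z i = y i" "\<And>i. i \<in> AA - S \<Longrightarrow> z i \<in> PP"
    have "(\<Sum>R'\<in>outer S y l. of_bool (kept z \<inter> S = Q \<and> z ` (kept z - S) = R'))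
        = (\<Sum>R'\<in>outer S y l. if z ` (kept z - S) = R' then of_bool (kept z \<inter> S = Q) else (0::real))"
      by (rule sum.cong) auto
    also have "\<dots> = (if z ` (kept z - S) \<in> outer S y l then of_bool (kept z \<inter> S = Q) else 0)"
      using finite_outer by (rule sum.delta')
    also have "z ` (kept z - S) \<in> outer S y l \<longleftrightarrow> card (kept z - S) = l"
      using kept_outer[OF S yv z, of l] by blast
    finally show "of_bool (kept z \<inter> S = Q \<and> card (kept z - S) = l)
        = (\<Sum>R'\<in>outer S y l. of_bool (kept z \<inter> S = Q \<and> z ` (kept z - S) = R') :: real)"
      by simp
  qed
  also have "\<dots> = (\<Sum>R'\<in>outer S y l. pr R')"
    unfolding pr_def by (rule Av_sum[OF fin finite_outer])
  also have "\<dots> = (\<Sum>R'\<in>{R' \<in> outer S y l. matching R'}. pr R)"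
    using zero eq finite_outer by (intro sum.mono_neutral_cong_right) auto
  finally have "ev y S Q l = real (card {R' \<in> outer S y l. matching R'}) * pr R" by simp
  moreover have "card {R' \<in> outer S y l. matching R'} > 0"
    using R finite_outer by (auto simp: card_gt_0_iff)
  ultimately show ?thesis by (simp add: pr_def)
qed

text \<open>By symmetry the pairs kept outside \<open>S\<close> form a uniform matching that avoids the rows and
  columns of the pairs in \<open>S\<close>.\<close>

lemma Av_kept:
  assumes S: "S \<subseteq> AA" and yv: "y \<in> valid"
  shows "Av (AA - S) (\<lambda>z. of_bool (kept z \<inter> S = Q) * C f z) y
    = (\<Sum>l\<le>N. wt y S Q l * (\<Sum>R\<in>outer S y l. s f (y ` Q \<union> R)))"
proof -
  have fin: "finite (AA - S)" by simp
  define h where "h l R z = (of_bool (kept z \<inter> S = Q \<and> z ` (kept z - S) = R) :: real)" for l :: nat and R z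
  define v where "v l R = s f (y ` Q \<union> R) / fact (n - card Q - l)" for l R
  have "Av (AA - S) (\<lambda>z. of_bool (kept z \<inter> S = Q) * C f z) y
      = Av (AA - S) (\<lambda>z. \<Sum>l\<le>N. \<Sum>R\<in>outer S y l. v l R * h l R z) y"
  proof (rule Av_cong[OF fin])
    fix z assume z: "\<And>i. i \<notin> AA - S \<Longrightarrow> z i = y i" "\<And>i. i \<in> AA - S \<Longrightarrow> z i \<in> PP"
    show "of_bool (kept z \<inter> S = Q) * C f z = (\<Sum>l\<le>N. \<Sum>R\<in>outer S y l. v l R * h l R z)"
    proof (cases "kept z \<inter> S = Q")
      case False
      then show ?thesis by (simp add: h_def)
    next
      case True
      define R0 l0 where "R0 = z ` (kept z - S)" and "l0 = card (kept z - S)"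
      have "l0 \<le> card AA" unfolding l0_def using kept_sub by (intro card_mono) auto
      then have l0: "l0 \<in> {..N}" by simp
      have out: "R0 \<in> outer S y l \<longleftrightarrow> l0 = l" for l
        unfolding R0_def l0_def by (rule kept_outer[OF S yv z])
      have "(\<Sum>l\<le>N. \<Sum>R\<in>outer S y l. v l R * h l R z) = (\<Sum>l\<le>N. \<Sum>R\<in>outer S y l. if R0 = R then v l R else 0)"
        by (intro sum.cong refl) (auto simp: h_def True R0_def)
      also have "\<dots> = (\<Sum>l\<le>N. if l0 = l then v l R0 else 0)"
        by (simp only: sum.delta'[OF finite_outer] out)
      also have "\<dots> = v l0 R0" using l0 by (simp add: sum.delta')
      also have "v l0 R0 = C f z"
      proof -
        have "kept z = (kept z \<inter> S) \<union> (kept z - S)" by auto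
        then have "z ` kept z = z ` (kept z \<inter> S) \<union> R0" unfolding R0_def by (metis image_Un)
        moreover have "z ` (kept z \<inter> S) = y ` Q" unfolding True by (rule image_cong) (use z True in auto)
        ultimately have 1: "z ` kept z = y ` Q \<union> R0" by simp
        have "card (kept z) = card (kept z \<inter> S) + card (kept z - S)"
          by (rule card_Int_Diff[OF finite_ker])
        then have 2: "card (kept z) = card Q + l0" by (simp add: True l0_def)
        show ?thesis unfolding C_def v_def 1 2 by simp
      qed
      finally show ?thesis using True by simp
    qed
  qed
  also have "\<dots> = (\<Sum>l\<le>N. \<Sum>R\<in>outer S y l. v l R * Av (AA - S) (h l R) y)"
    by (simp only: Av_sum[OF fin] finite_atMost finite_outer Av_cmult[OF fin])
  also have "\<dots> = (\<Sum>l\<le>N. wt y S Q l * (\<Sum>R\<in>outer S y l. s f (y ` Q \<union> R)))"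
    unfolding sum_distrib_left
  proof (intro sum.cong refl)
    fix l R assume R: "R \<in> outer S y l"
    show "v l R * Av (AA - S) (h l R) y = wt y S Q l * s f (y ` Q \<union> R)"
    proof (cases "matching R")
      case True
      show ?thesis unfolding h_def v_def wt_def Av_kept_value[OF S yv R True] by (simp add: mult_ac)
    next
      case False
      then have "\<not> matching (y ` Q \<union> R)" using matching_subset by blast
      then show ?thesis by (simp add: v_def s_zero)
    qed
  qed
  finally show ?thesis .
qed

definition free :: "nat set \<Rightarrow> (nat \<Rightarrow> nat \<times> nat) \<Rightarrow> nat" where
  "free S y = n - card (fst ` y ` S) - card (snd ` y ` S)"

lemma card_rows_cols:
  assumes "S \<subseteq> AA"
  shows "card (fst ` y ` S) \<le> card S" "card (snd ` y ` S) \<le> card S"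
    "card (fst ` y ` S) + card (snd ` y ` S) \<le> n"
proof -
  have fS: "finite S" by (rule finite_subset[OF assms]) simp
  show 1: "card (fst ` y ` S) \<le> card S" "card (snd ` y ` S) \<le> card S"
    unfolding image_image by (rule card_image_le[OF fS])+
  have "card S \<le> N" using card_mono[OF _ assms] by simp
  then show "card (fst ` y ` S) + card (snd ` y ` S) \<le> n" using 1 N2 by linarith
qed

text \<open>After the Vandermonde exchange only edges in the rows and columns of \<open>S\<close>
  occur, so no matching has more than |S| edges. Both the inherited globalness and the vanishing of
  low levels rest on this.\<close>

lemma Av_kept_inside:
  assumes S: "S \<subseteq> AA" and yv: "y \<in> valid"
  shows "Av (AA - S) (\<lambda>z. of_bool (kept z \<inter> S = Q) * C f z) y
    = (\<Sum>l\<le>N. wt y S Q l * (\<Sum>M\<in>Pow ((fst ` y ` S) \<times> (snd ` y ` S)). vand (free S y) l (card M) * s f (y ` Q \<union> M)))"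
  unfolding Av_kept[OF assms] outer_def free_def
  by (subst sum_outside_eq_sum_inside[OF valid_rows[OF yv] valid_cols[OF yv] card_rows_cols(3)[OF S]]) (rule refl)

lemma Av_C_split:
  assumes S: "S \<subseteq> AA"
  shows "Av (AA - S) (C f) y = (\<Sum>Q\<in>Pow S. Av (AA - S) (\<lambda>z. of_bool (kept z \<inter> S = Q) * C f z) y)"
proof -
  have fS: "finite S" by (rule finite_subset[OF S]) simp
  have "C f z = (\<Sum>Q\<in>Pow S. of_bool (kept z \<inter> S = Q) * C f z)" for z
  proof -
    have "(\<Sum>Q\<in>Pow S. of_bool (kept z \<inter> S = Q) * C f z) = (\<Sum>Q\<in>Pow S. if kept z \<inter> S = Q then C f z else 0)"
      by (rule sum.cong) auto
    then show ?thesis using fS by (simp add: sum.delta')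
  qed
  then have "C f = (\<lambda>z. \<Sum>Q\<in>Pow S. of_bool (kept z \<inter> S = Q) * C f z)" by (rule ext)
  then have "Av (AA - S) (C f) y = Av (AA - S) (\<lambda>z. \<Sum>Q\<in>Pow S. of_bool (kept z \<inter> S = Q) * C f z) y"
    by (rule arg_cong)
  also have "\<dots> = (\<Sum>Q\<in>Pow S. Av (AA - S) (\<lambda>z. of_bool (kept z \<inter> S = Q) * C f z) y)"
    by (rule Av_sum) (use fS in auto)
  finally show ?thesis .
qed

lemma Av_C_inside:
  assumes S: "S \<subseteq> AA" and yv: "y \<in> valid"
  shows "Av (AA - S) (C f) y
    = (\<Sum>Q\<in>Pow S. \<Sum>l\<le>N. \<Sum>M\<in>Pow ((fst ` y ` S) \<times> (snd ` y ` S)).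
        wt y S Q l * vand (free S y) l (card M) * s f (y ` Q \<union> M))"
  by (simp only: Av_C_split[OF S] Av_kept_inside[OF S yv] sum_distrib_left mult.assoc)

lemma inside_matching:
  assumes S: "S \<subseteq> AA" and yv: "y \<in> valid" and Q: "Q \<subseteq> S"
    and M: "M \<subseteq> (fst ` y ` S) \<times> (snd ` y ` S)"
  shows "y ` Q \<union> M \<subseteq> PP" "matching (y ` Q \<union> M) \<Longrightarrow> card (y ` Q \<union> M) \<le> card S"
proof -
  have fS: "finite S" by (rule finite_subset[OF S]) simp
  have "(fst ` y ` S) \<times> (snd ` y ` S) \<subseteq> PP"
    unfolding grid_def by (rule Sigma_mono[OF valid_rows[OF yv] valid_cols[OF yv]])
  then show "y ` Q \<union> M \<subseteq> PP" using M valid_image[OF yv, of Q] by blast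
  assume m: "matching (y ` Q \<union> M)"
  have "fst ` (y ` Q \<union> M) \<subseteq> fst ` y ` S" using M Q by fastforce
  then have "card (fst ` (y ` Q \<union> M)) \<le> card (fst ` y ` S)" using fS by (intro card_mono) auto
  then show "card (y ` Q \<union> M) \<le> card S"
    using card_rows_cols(1)[OF S, of y] by (simp only: matching_card_fst[OF m])
qed

text \<open>The coefficients in \<open>Av_C_inside\<close> are nonnegative and do not depend on
  \<open>F\<close>; inserting the constant 1, whose average is 1, evaluates their total.\<close>

lemma Av_C_le:
  assumes S: "S \<subseteq> AA" and yv: "y \<in> valid"
    and F: "\<And>M. M \<subseteq> PP \<Longrightarrow> matching M \<Longrightarrow> card M \<le> card S \<Longrightarrow> s F M \<le> B * s (\<lambda>_. 1) M"
  shows "Av (AA - S) (C F) y \<le> B"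
proof -
  have "Av (AA - S) (C F) y \<le> (\<Sum>Q\<in>Pow S. \<Sum>l\<le>N. \<Sum>M\<in>Pow ((fst ` y ` S) \<times> (snd ` y ` S)).
        B * (wt y S Q l * vand (free S y) l (card M) * s (\<lambda>_. 1) (y ` Q \<union> M)))"
    unfolding Av_C_inside[OF S yv]
  proof (intro sum_mono)
    fix Q l M assume Q: "Q \<in> Pow S" and M: "M \<in> Pow ((fst ` y ` S) \<times> (snd ` y ` S))"
    have "s F (y ` Q \<union> M) \<le> B * s (\<lambda>_. 1) (y ` Q \<union> M)"
    proof (cases "matching (y ` Q \<union> M)")
      case True
      then show ?thesis using Q M inside_matching[OF S yv, of Q M] by (intro F) auto
    qed (simp add: s_zero)
    then have "wt y S Q l * vand (free S y) l (card M) * s F (y ` Q \<union> M)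
        \<le> wt y S Q l * vand (free S y) l (card M) * (B * s (\<lambda>_. 1) (y ` Q \<union> M))"
      by (intro mult_left_mono mult_nonneg_nonneg wt_nonneg[OF yv] vand_nonneg)
    then show "wt y S Q l * vand (free S y) l (card M) * s F (y ` Q \<union> M)
        \<le> B * (wt y S Q l * vand (free S y) l (card M) * s (\<lambda>_. 1) (y ` Q \<union> M))"
      by (simp only: mult_ac)
  qed
  also have "\<dots> = B * Av (AA - S) (C (\<lambda>_. 1)) y"
    by (simp only: Av_C_inside[OF S yv] sum_distrib_left)
  also have "Av (AA - S) (C (\<lambda>_. 1)) y = Av (AA - S) (\<lambda>_. 1) y"
    by (rule Av_cong_valid[OF _ yv]) (simp_all add: C_one)
  finally show ?thesis by simp
qed

lemma Av_C_zero:
  assumes S: "S \<subseteq> AA" and yv: "y \<in> valid" and f: "\<And>M. M \<subseteq> PP \<Longrightarrow> card M \<le> card S \<Longrightarrow> s f M = 0"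
  shows "Av (AA - S) (C f) y = 0"
  unfolding Av_C_inside[OF S yv]
proof (intro sum.neutral ballI)
  fix Q l M assume Q: "Q \<in> Pow S" and M: "M \<in> Pow ((fst ` y ` S) \<times> (snd ` y ` S))"
  have "s f (y ` Q \<union> M) = 0"
    using Q M inside_matching[OF S yv, of Q M] f[of "y ` Q \<union> M"] s_zero by auto
  then show "wt y S Q l * vand (free S y) l (card M) * s f (y ` Q \<union> M) = 0" by simp
qed

lemma ev_colperm:
  assumes S: "S \<subseteq> AA" and y: "distinct_on S y" and yv: "y \<in> valid" and \<pi>: "\<pi> permutes S"
  shows "ev (colperm \<pi> y) S Q l = ev y S Q l"
proof -
  have fin: "finite (AA - S)" by simp
  have inj: "inj_on (snd \<circ> y) S" using y by (simp add: distinct_on_def)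
  let ?F = "\<lambda>z. of_bool (kept z \<inter> S = Q \<and> card (kept z - S) = l) :: real"
  have b1: "bij_betw (the_inv_into S (snd \<circ> y)) ((snd \<circ> y) ` S) S"
    by (rule bij_betw_the_inv_into[OF inj_on_imp_bij_betw[OF inj]])
  have b2: "bij_betw \<pi> S S" by (rule permutes_imp_bij[OF \<pi>])
  have b3: "bij_betw (snd \<circ> y) S ((snd \<circ> y) ` S)" using inj by (rule inj_on_imp_bij_betw)
  have b: "bij_betw ((snd \<circ> y) \<circ> (\<pi> \<circ> the_inv_into S (snd \<circ> y))) ((snd \<circ> y) ` S) ((snd \<circ> y) ` S)"
    by (rule bij_betw_trans[OF bij_betw_trans[OF b1 b2] b3])
  have sub: "(snd \<circ> y) ` S \<subseteq> {1..n}" using valid_cols[OF yv, of S] by (simp only: image_comp)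
  \<comment> \<open>As the columns of \<open>y\<close> on \<open>S\<close> are distinct, permuting
    them among positions is, on \<open>S\<close>, the same as relabelling them by one \<beta>, and
    relabelling does not change which pairs are kept.\<close>
  obtain \<beta> where \<beta>: "\<beta> permutes {1..n}"
    "\<And>a. a \<in> (snd \<circ> y) ` S \<Longrightarrow> \<beta> a = ((snd \<circ> y) \<circ> (\<pi> \<circ> the_inv_into S (snd \<circ> y))) a"
    by (rule extend_bij_to_permutation[OF finite_atLeastAtMost sub sub b]) blast
  have \<beta>G: "\<beta> \<in> G" using \<beta>(1) by (simp add: sym_grp_def)
  have \<beta>y: "\<beta> (snd (y k)) = snd (y (\<pi> k))" if "k \<in> S" for k
    using \<beta>(2)[of "snd (y k)"] that the_inv_into_f_f[OF inj that] by simp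
  have "ev (colperm \<pi> y) S Q l = Av (AA - S) ?F (relabel id \<beta> \<circ> y)"
    unfolding ev_def
  proof (rule Av_local[OF fin, of AA])
    fix z z' :: "nat \<Rightarrow> nat \<times> nat" assume zz: "\<And>i. i \<in> AA \<Longrightarrow> z i = z' i"
    have "kept z = kept z'" by (rule kept_cong) (use zz in auto)
    then show "?F z = ?F z'" by (simp only:)
  next
    fix i assume "i \<in> AA - (AA - S)"
    then have "i \<in> S" by auto
    then show "colperm \<pi> y i = (relabel id \<beta> \<circ> y) i" by (simp add: colperm_def prod_eq_iff \<beta>y)
  qed
  also have "\<dots> = Av (AA - S) (\<lambda>z. ?F (relabel id \<beta> \<circ> z)) y"
    by (rule Av_relabel[OF G_id \<beta>G fin, symmetric])
  also have "\<dots> = ev y S Q l" unfolding ev_def kept_relabel[OF G_id \<beta>G] ..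
  finally show ?thesis .
qed

lemma free_colperm: "\<pi> permutes S \<Longrightarrow> free S (colperm \<pi> y) = free S y"
  by (simp only: free_def colperm_rows colperm_cols)

lemma wt_colperm:
  assumes "S \<subseteq> AA" "distinct_on S y" "y \<in> valid" "\<pi> permutes S"
  shows "wt (colperm \<pi> y) S Q l = wt y S Q l"
  by (simp only: wt_def ev_colperm[OF assms] outer_def colperm_rows colperm_cols[OF assms(4)])

text \<open>The ratio between the part of the conditional mean with kept set \<open>Q\<close> and
  \<open>Z f S Q\<close>, for \<open>f\<close> without mass below |S|. The default 0 at colliding
  positions loses nothing, since \<open>s f\<close> vanishes there.\<close>

definition coef :: "nat set \<Rightarrow> nat set \<Rightarrow> (nat \<Rightarrow> nat \<times> nat) \<Rightarrow> real" where
  "coef S Q y = (if distinct_on S y then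
     (\<Sum>l\<le>N. wt y S Q l * (\<Sum>X\<in>Pow Q. vand (free S y) l (card S - card Q + card X))) else 0)"

lemma coef_nonneg: "y \<in> valid \<Longrightarrow> 0 \<le> coef S Q y"
  by (auto simp: coef_def intro!: sum_nonneg mult_nonneg_nonneg wt_nonneg vand_nonneg)

lemma coef_colperm:
  assumes S: "S \<subseteq> AA" and yv: "y \<in> valid" and \<pi>: "\<pi> permutes S - Q"
  shows "coef S Q (colperm \<pi> y) = coef S Q y"
proof -
  have \<pi>S: "\<pi> permutes S" by (rule permutes_subset[OF \<pi>]) auto
  have "distinct_on S y" if "distinct_on S (colperm \<pi> y)"
  proof -
    have "distinct_on S (colperm (inv \<pi>) (colperm \<pi> y))"
      by (rule distinct_on_colperm[OF permutes_inv[OF \<pi>S] that])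
    then show ?thesis
      by (simp only: colperm_colperm permutes_inv_o[OF \<pi>S]) (simp add: colperm_def)
  qed
  then have "distinct_on S (colperm \<pi> y) \<longleftrightarrow> distinct_on S y"
    using distinct_on_colperm[OF \<pi>S] by blast
  then show ?thesis
    by (cases "distinct_on S y") (simp_all add: coef_def wt_colperm[OF S _ yv \<pi>S] free_colperm[OF \<pi>S])
qed

text \<open>The part for \<open>Q\<close> is a nonnegative, column-invariant multiple of
  \<open>Z f S Q\<close>, so \<open>Av_pairing_nonneg\<close> makes the pairing a weighted
  square.\<close>

lemma pairing_part_nonneg:
  assumes S: "S \<subseteq> AA" "card S = d" and y0: "y0 \<in> valid" and Q: "Q \<subseteq> S"
    and f: "\<And>M. M \<subseteq> PP \<Longrightarrow> card M < d \<Longrightarrow> s f M = 0"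
  shows "0 \<le> Av AA (\<lambda>y. s f (y ` S) * Av (AA - S) (\<lambda>z. of_bool (kept z \<inter> S = Q) * C f z) y) y0"
proof -
  have fS: "finite S" by (rule finite_subset[OF S(1)]) simp
  have "0 \<le> Av AA (\<lambda>y. coef S Q y * s f (y ` S) * Z f S Q y) y0"
    by (rule Av_pairing_nonneg[OF _ S(1) y0 coef_nonneg coef_colperm[OF S(1)]]) auto
  also have "\<dots> = Av AA (\<lambda>y. s f (y ` S) * Av (AA - S) (\<lambda>z. of_bool (kept z \<inter> S = Q) * C f z) y) y0"
  proof (rule Av_cong_valid[OF _ y0])
    fix y :: "nat \<Rightarrow> nat \<times> nat" assume yv: "y \<in> valid"
    show "coef S Q y * s f (y ` S) * Z f S Q y
        = s f (y ` S) * Av (AA - S) (\<lambda>z. of_bool (kept z \<inter> S = Q) * C f z) y"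
    proof (cases "distinct_on S y")
      case True
      have "Av (AA - S) (\<lambda>z. of_bool (kept z \<inter> S = Q) * C f z) y = coef S Q y * Z f S Q y"
        unfolding Av_kept_inside[OF S(1) yv] coef_def S(2)
        by (simp only: sum_inside_eq_Z[OF fS S(2) yv True Q f] True if_True)
          (simp add: sum_distrib_right mult.assoc)
      then show ?thesis by simp
    next
      case False
      then have "s f (y ` S) = 0" by (rule s_image_zero[OF fS S(2) yv _ f])
      then show ?thesis by simp
    qed
  qed simp
  finally show ?thesis .
qed

text \<open>If all of \<open>S\<close> is kept, a matching containing its edges and confined to its
  rows and columns has no further edge. Hence the left side is a multiple of \<open>s f\<close> at
  these edges; the factor \<open>c\<close> is independent of \<open>f\<close> and is found from f =
  1.\<close>

lemma Av_all_kept: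
  assumes S: "S \<subseteq> AA" and yv: "y \<in> valid" and y: "distinct_on S y"
  shows "Av (AA - S) (\<lambda>z. of_bool (kept z \<inter> S = S) * C f z) y
    = s f (y ` S) / fact (n - card S) * Av (AA - S) (\<lambda>z. of_bool (kept z \<inter> S = S)) y"
proof -
  let ?E = "(fst ` y ` S) \<times> (snd ` y ` S)"
  define c where "c = (\<Sum>l\<le>N. wt y S S l * (\<Sum>M\<in>Pow ?E. vand (free S y) l (card M) * of_bool (M \<subseteq> y ` S)))"
  have s_eq: "s f (y ` S \<union> M) = of_bool (M \<subseteq> y ` S) * s f (y ` S)" if "M \<in> Pow ?E" for M f
  proof (cases "M \<subseteq> y ` S")
    case True
    then have "y ` S \<union> M = y ` S" by blast
    then show ?thesis using True by simp
  next
    case False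
    then obtain p where p: "p \<in> M" "p \<notin> y ` S" by blast
    have "fst p \<in> fst ` y ` S" using that p by auto
    then obtain p' where p': "p' \<in> y ` S" "fst p = fst p'" by blast
    have "\<not> matching (y ` S \<union> M)"
    proof
      assume "matching (y ` S \<union> M)"
      then have "p = p'" by (rule matching_fst_eq) (use p p' in auto)
      then show False using p p' by simp
    qed
    then show ?thesis using False by (simp add: s_zero)
  qed
  have gen: "Av (AA - S) (\<lambda>z. of_bool (kept z \<inter> S = S) * C f z) y = c * s f (y ` S)" for f
    unfolding Av_kept_inside[OF S yv] c_def sum_distrib_right
    by (intro sum.cong refl) (simp add: s_eq sum_distrib_left sum_distrib_right mult_ac)
  have "c * fact (n - card S) = c * s (\<lambda>_. 1) (y ` S)"
    using card_U[OF distinct_on_matching(1)[OF y] valid_image[OF yv]]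
    by (simp add: s_def distinct_on_matching(2)[OF y])
  also have "\<dots> = Av (AA - S) (\<lambda>z. of_bool (kept z \<inter> S = S) * C (\<lambda>_. 1) z) y" by (rule gen[symmetric])
  also have "\<dots> = Av (AA - S) (\<lambda>z. of_bool (kept z \<inter> S = S)) y"
    by (rule Av_cong_valid[OF _ yv]) (simp_all add: C_one)
  finally have "c = Av (AA - S) (\<lambda>z. of_bool (kept z \<inter> S = S)) y / fact (n - card S)"
    by (simp add: field_simps)
  then show ?thesis by (simp add: gen)
qed

text \<open>The probability that the other \<open>N - d\<close> pairs avoid \<open>d\<close> given
  rows and \<open>d\<close> given columns, in which case \<open>d\<close> mutually compatible pairs
  are all kept.\<close>

definition keep_prob :: "nat \<Rightarrow> real" where
  "keep_prob d = ((real (n - d))\<^sup>2 / (real n)\<^sup>2) ^ (N - d)"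

lemma keep_prob_le:
  assumes S: "S \<subseteq> AA" "card S = d" and yv: "y \<in> valid" and y: "distinct_on S y"
  shows "keep_prob d \<le> Av (AA - S) (\<lambda>z. of_bool (kept z \<inter> S = S)) y"
proof -
  define I J where "I = fst ` y ` S" and "J = snd ` y ` S"
  define \<phi> :: "nat \<times> nat \<Rightarrow> real" where "\<phi> p = of_bool (fst p \<notin> I \<and> snd p \<notin> J)" for p
  have fS: "finite S" by (rule finite_subset[OF S(1)]) simp
  have card: "card I = d" "card J = d"
    using y S(2) card_image[of "fst \<circ> y" S] card_image[of "snd \<circ> y" S]
    unfolding I_def J_def image_comp distinct_on_def by (simp_all only:)
  have sub: "I \<subseteq> {1..n}" "J \<subseteq> {1..n}" unfolding I_def J_def by (rule valid_rows[OF yv], rule valid_cols[OF yv])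
  have fin: "finite I" "finite J" using fS by (simp_all add: I_def J_def)
  have "(\<Sum>p\<in>PP. \<phi> p) = (\<Sum>p\<in>({1..n} - I) \<times> ({1..n} - J). 1)"
    by (rule sum.mono_neutral_cong_right) (auto simp: grid_def \<phi>_def)
  also have "\<dots> = real (n - d) * real (n - d)"
    using sub fin card by (simp add: card_cartesian_product card_Diff_subset)
  finally have "(\<Sum>p\<in>PP. \<phi> p) / real (card PP) = (real (n - d))\<^sup>2 / (real n)\<^sup>2"
    by (simp add: grid_def power2_eq_square)
  moreover have "card (AA - S) = N - d" using S fS by (simp add: card_Diff_subset)
  ultimately have "keep_prob d = Av (AA - S) (\<lambda>z. \<Prod>k\<in>AA - S. \<phi> (z k)) y"
    by (simp only: keep_prob_def Av_prod_indicator[of "AA - S" \<phi> y] finite_Diff finite_lessThan)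
  also have "\<dots> \<le> Av (AA - S) (\<lambda>z. of_bool (kept z \<inter> S = S)) y"
  proof (rule Av_mono)
    fix z assume z: "\<And>i. i \<notin> AA - S \<Longrightarrow> z i = y i" "\<And>i. i \<in> AA - S \<Longrightarrow> z i \<in> PP"
    show "(\<Prod>k\<in>AA - S. \<phi> (z k)) \<le> of_bool (kept z \<inter> S = S)"
    proof (cases "\<forall>k\<in>AA - S. \<phi> (z k) = 1")
      case False
      then have "\<exists>k\<in>AA - S. \<phi> (z k) = 0" by (auto simp: \<phi>_def)
      then have eq: "(\<Prod>k\<in>AA - S. \<phi> (z k)) = 0" by (intro prod_zero) auto
      show ?thesis unfolding eq by simp
    next
      case True
      have "k \<in> kept z" if k: "k \<in> S" for k
        unfolding kept_def mem_Collect_eq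
      proof (intro conjI allI impI)
        show "k < N" using k S by auto
        fix l assume l: "l < N" "l \<noteq> k"
        have zk: "z k = y k" using k by (intro z) auto
        have "fst (z l) \<noteq> fst (z k) \<and> snd (z l) \<noteq> snd (z k)"
        proof (cases "l \<in> S")
          case lS: True
          then have "z l = y l" by (intro z) auto
          then show ?thesis using distinct_onD[OF y lS k] l zk by metis
        next
          case False
          then have "fst (z l) \<notin> I" "snd (z l) \<notin> J" using True l by (auto simp: \<phi>_def)
          moreover have "fst (z k) \<in> I" "snd (z k) \<in> J" using k by (auto simp: I_def J_def zk)
          ultimately show ?thesis by metis
        qed
        then show "fst (z l) \<noteq> fst (z k)" "snd (z l) \<noteq> snd (z k)" by auto
      qed
      then have "kept z \<inter> S = S" by blast
      moreover have "(\<Prod>k\<in>AA - S. \<phi> (z k)) = 1" using True by (intro prod.neutral) auto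
      ultimately show ?thesis by simp
    qed
  qed simp
  finally show ?thesis .
qed

text \<open>The pairing splits according to the kept subset \<open>Q\<close> of \<open>S\<close>.
  Every part is nonnegative, and the part \<open>Q = S\<close> alone is an explicit multiple of a
  square.\<close>

lemma pairing_lower_bound:
  assumes S: "S \<subseteq> AA" "card S = d" and y0: "y0 \<in> valid"
    and f: "\<And>M. M \<subseteq> PP \<Longrightarrow> card M < d \<Longrightarrow> s f M = 0"
  shows "keep_prob d / fact (n - d) * Av AA (\<lambda>y. (s f (y ` S))\<^sup>2) y0
    \<le> Av AA (\<lambda>y. s f (y ` S) * Av (AA - S) (C f) y) y0"
proof -
  have fS: "finite S" by (rule finite_subset[OF S(1)]) simp
  define part where "part Q y = Av (AA - S) (\<lambda>z. of_bool (kept z \<inter> S = Q) * C f z) y" for Q y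
  have "keep_prob d / fact (n - d) * Av AA (\<lambda>y. (s f (y ` S))\<^sup>2) y0
      = Av AA (\<lambda>y. keep_prob d / fact (n - d) * (s f (y ` S))\<^sup>2) y0"
    by (simp only: Av_cmult finite_lessThan)
  also have "\<dots> \<le> Av AA (\<lambda>y. s f (y ` S) * part S y) y0"
  proof (rule Av_mono_valid[OF _ y0])
    fix y :: "nat \<Rightarrow> nat \<times> nat" assume yv: "y \<in> valid"
    show "keep_prob d / fact (n - d) * (s f (y ` S))\<^sup>2 \<le> s f (y ` S) * part S y"
    proof (cases "distinct_on S y")
      case True
      have "keep_prob d * ((s f (y ` S))\<^sup>2 / fact (n - d))
          \<le> Av (AA - S) (\<lambda>z. of_bool (kept z \<inter> S = S)) y * ((s f (y ` S))\<^sup>2 / fact (n - d))"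
        by (intro mult_right_mono keep_prob_le[OF S yv True]) simp
      then show ?thesis
        unfolding part_def Av_all_kept[OF S(1) yv True] S(2) by (simp add: power2_eq_square mult_ac)
    next
      case False
      then have "s f (y ` S) = 0" by (rule s_image_zero[OF fS S(2) yv _ f])
      then show ?thesis by simp
    qed
  qed simp
  also have "\<dots> \<le> (\<Sum>Q\<in>Pow S. Av AA (\<lambda>y. s f (y ` S) * part Q y) y0)"
    using fS unfolding part_def
    by (intro member_le_sum pairing_part_nonneg[OF S y0 _ f]) auto
  also have "\<dots> = Av AA (\<lambda>y. \<Sum>Q\<in>Pow S. s f (y ` S) * part Q y) y0"
    by (rule Av_sum[symmetric]) (use fS in auto)
  also have "\<dots> = Av AA (\<lambda>y. s f (y ` S) * Av (AA - S) (C f) y) y0"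
    by (simp only: sum_distrib_left[symmetric] part_def Av_C_split[OF S(1)])
  finally show ?thesis .
qed

lemma level_lower_bound:
  assumes S: "S \<subseteq> AA" "card S = d" and y0: "y0 \<in> valid"
    and f: "\<And>M. M \<subseteq> PP \<Longrightarrow> card M < d \<Longrightarrow> s f M = 0"
  shows "(keep_prob d / fact (n - d))\<^sup>2 * Av AA (\<lambda>y. (s f (y ` S))\<^sup>2) y0
    \<le> Av AA (\<lambda>y. (Av (AA - S) (C f) y)\<^sup>2) y0"
proof -
  define a b c where "a = keep_prob d / fact (n - d)" and "b = Av AA (\<lambda>y. (s f (y ` S))\<^sup>2) y0"
    and "c = Av AA (\<lambda>y. (Av (AA - S) (C f) y)\<^sup>2) y0"
  have a: "0 \<le> a" by (simp add: a_def keep_prob_def)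
  have b: "0 \<le> b" unfolding b_def by (intro Av_nonneg_valid y0) auto
  have c: "0 \<le> c" unfolding c_def by (intro Av_nonneg_valid y0) auto
  have "a * b \<le> Av AA (\<lambda>y. s f (y ` S) * Av (AA - S) (C f) y) y0"
    unfolding a_def b_def by (rule pairing_lower_bound[OF S y0 f])
  then have "(a * b)\<^sup>2 \<le> (Av AA (\<lambda>y. s f (y ` S) * Av (AA - S) (C f) y) y0)\<^sup>2"
    using a b by (intro power_mono) auto
  also have "\<dots> \<le> b * c" unfolding b_def c_def by (rule Av_Cauchy_Schwarz) simp
  finally have "a\<^sup>2 * b * b \<le> c * b" by (simp add: power2_eq_square mult_ac)
  then have "a\<^sup>2 * b \<le> c" using b c by (cases "b = 0") auto
  then show ?thesis by (simp only: a_def b_def c_def)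
qed

end

section \<open>Low-degree functions on the symmetric group\<close>

context symmetric_group
begin

section \<open>Edge sets of fixed size\<close>

lemma finite_PP: "finite PP"
  by (simp add: grid_def)

lemma card_PP: "card PP = n\<^sup>2"
  by (simp add: grid_def power2_eq_square)

lemma valid_exists: obtains y where "y \<in> valid"
proof
  show "(\<lambda>_. (1, 1)) \<in> valid" unfolding valid_def using n1 by (simp add: grid_def)
qed

definition edges :: "nat \<Rightarrow> (nat \<times> nat) set set" where
  "edges d = {M. M \<subseteq> PP \<and> card M = d}"

lemma finite_edges: "finite (edges d)"
  unfolding edges_def by (rule finite_subset[of _ "Pow PP"]) (auto simp: finite_PP)

text \<open>Each set of size \<open>d\<close> is the image of \<open>fact d\<close> injective maps;
  smaller images drop out by the assumption on \<open>g\<close>.\<close>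

lemma sum_over_maps:
  fixes g :: "(nat \<times> nat) set \<Rightarrow> real"
  assumes S: "finite S" "card S = d" and g: "\<And>M. M \<subseteq> PP \<Longrightarrow> card M < d \<Longrightarrow> g M = 0"
  shows "(\<Sum>z\<in>PiE S (\<lambda>_. PP). g (z ` S)) = fact d * (\<Sum>M\<in>edges d. g M)"
proof -
  let ?Z = "PiE S (\<lambda>_. PP)"
  have finZ: "finite ?Z" by (rule finite_PiE[OF S(1) finite_PP])
  have "(\<Sum>z\<in>?Z. g (z ` S)) = (\<Sum>M\<in>Pow PP. \<Sum>z\<in>{z \<in> ?Z. z ` S = M}. g (z ` S))"
    by (rule sum.group[symmetric, OF finZ]) (auto simp: finite_PP PiE_iff)
  also have "\<dots> = (\<Sum>M\<in>Pow PP. of_bool (card M = d) * fact d * g M)"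
  proof (rule sum.cong[OF refl])
    fix M assume M: "M \<in> Pow PP"
    have finM: "finite M" using M finite_PP by (auto intro: finite_subset)
    have sums: "(\<Sum>z\<in>{z \<in> ?Z. z ` S = M}. g (z ` S)) = real (card {z \<in> ?Z. z ` S = M}) * g M" by simp
    show "(\<Sum>z\<in>{z \<in> ?Z. z ` S = M}. g (z ` S)) = of_bool (card M = d) * fact d * g M"
    proof (cases "card M" d rule: linorder_cases)
      case less
      then show ?thesis using g M sums by simp
    next
      case greater
      have "z ` S \<noteq> M" for z using card_image_le[OF S(1), of z] S(2) greater by auto
      then have eq: "{z \<in> ?Z. z ` S = M} = {}" by blast
      show ?thesis unfolding eq using greater by simp
    next
      case equal
      have "{z \<in> ?Z. z ` S = M} = {z \<in> S \<rightarrow>\<^sub>E M. inj_on z S}"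
      proof (intro equalityI subsetI)
        fix z assume "z \<in> {z \<in> ?Z. z ` S = M}"
        then have z: "z \<in> ?Z" "z ` S = M" by auto
        then have "inj_on z S" using S equal by (simp add: eq_card_imp_inj_on)
        moreover have "z \<in> S \<rightarrow>\<^sub>E M" using z by (auto simp: PiE_iff)
        ultimately show "z \<in> {z \<in> S \<rightarrow>\<^sub>E M. inj_on z S}" by blast
      next
        fix z assume "z \<in> {z \<in> S \<rightarrow>\<^sub>E M. inj_on z S}"
        then have z: "z \<in> S \<rightarrow>\<^sub>E M" "inj_on z S" by auto
        have "z ` S = M"
          using z S equal by (intro card_subset_eq[OF finM]) (auto simp: card_image PiE_iff)
        moreover have "z \<in> ?Z" using z M by (auto simp: PiE_iff)
        ultimately show "z \<in> {z \<in> ?Z. z ` S = M}" by blast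
      qed
      then have "card {z \<in> ?Z. z ` S = M} = fact d"
        using card_inj_on_subset_funcset[OF S(1) finM order_refl] S(2) equal fact_prod_rev[of d, where 'a = nat]
        by simp
      then show ?thesis using sums equal by simp
    qed
  qed
  also have "\<dots> = (\<Sum>M\<in>edges d. fact d * g M)"
    unfolding edges_def by (rule sum.mono_neutral_cong_right) (auto simp: finite_PP)
  finally show ?thesis by (simp only: sum_distrib_left)
qed

lemma Av_image:
  assumes A: "finite A" and S: "S \<subseteq> A"
  shows "Av A (\<lambda>y. h (y ` S)) y0 = (\<Sum>z\<in>PiE S (\<lambda>_. PP). h (z ` S)) / (real n ^ 2) ^ card S"
proof -
  have fS: "finite S" by (rule finite_subset[OF S A])
  have "Av (A - S) (\<lambda>y. h (y ` S)) y = h (y ` S)" for y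
  proof -
    have "Av (A - S) (\<lambda>y. h (y ` S)) y = Av (A - S) (\<lambda>_. h (y ` S)) y"
    proof (rule Av_cong)
      fix z assume "\<And>i. i \<notin> A - S \<Longrightarrow> z i = y i"
      then have "z ` S = y ` S" by (intro image_cong) auto
      then show "h (z ` S) = h (y ` S)" by simp
    qed (use A in simp)
    then show ?thesis using A by simp
  qed
  then have eq: "Av (A - S) (\<lambda>y. h (y ` S)) = (\<lambda>y. h (y ` S))" by (rule ext)
  have "S \<union> (A - S) = A" using S by blast
  then have "Av A (\<lambda>y. h (y ` S)) = Av S (Av (A - S) (\<lambda>y. h (y ` S)))"
    using Av_Un[OF fS, of "A - S" "\<lambda>y. h (y ` S)"] A by simp
  then have "Av A (\<lambda>y. h (y ` S)) y0 = Av S (\<lambda>y. h (y ` S)) y0" by (simp only: eq)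
  also have "\<dots> = (\<Sum>z\<in>PiE S (\<lambda>_. PP). h ((\<lambda>i. if i \<in> S then z i else y0 i) ` S)) / real (card PP) ^ card S"
    by (rule Av_sum_form[OF fS])
  also have "\<dots> = (\<Sum>z\<in>PiE S (\<lambda>_. PP). h (z ` S)) / (real n ^ 2) ^ card S"
  proof -
    have "(\<lambda>i. if i \<in> S then z i else y0 i) ` S = z ` S" for z by (rule image_cong) auto
    then show ?thesis by (simp add: card_PP)
  qed
  finally show ?thesis .
qed

lemma Av_image_edges:
  assumes "finite A" "S \<subseteq> A" "card S = d" and g: "\<And>M. M \<subseteq> PP \<Longrightarrow> card M < d \<Longrightarrow> g M = 0"
  shows "Av A (\<lambda>y. g (y ` S)) y0 = fact d * (\<Sum>M\<in>edges d. g M) / (real n ^ 2) ^ d"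
proof -
  have "(\<Sum>z\<in>PiE S (\<lambda>_. PP). g (z ` S)) = fact d * (\<Sum>M\<in>edges d. g M)"
    by (rule sum_over_maps[OF finite_subset[OF assms(2,1)] assms(3) g])
  then show ?thesis by (simp only: Av_image[OF assms(1,2)] assms(3))
qed

text \<open>If B sends \<open>f\<close> to the family of all \<open>s f M\<close> with
  \<open>M\<close> of size \<open>d\<close>, this is B followed by its adjoint for the unnormalised
  inner product; \<open>edge_op_inner\<close> says just that.\<close>

definition edge_op :: "nat \<Rightarrow> ((nat \<Rightarrow> nat) \<Rightarrow> real) \<Rightarrow> (nat \<Rightarrow> nat) \<Rightarrow> real" where
  "edge_op d f \<sigma> = (\<Sum>M\<in>edges d. s f M * of_bool (\<sigma> \<in> U M))"

lemma edge_op_inner: "(\<Sum>\<sigma>\<in>G. edge_op d f \<sigma> * h \<sigma>) = (\<Sum>M\<in>edges d. s f M * s h M)"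
proof -
  have "(\<Sum>\<sigma>\<in>G. edge_op d f \<sigma> * h \<sigma>) = (\<Sum>\<sigma>\<in>G. \<Sum>M\<in>edges d. s f M * (of_bool (\<sigma> \<in> U M) * h \<sigma>))"
    by (simp only: edge_op_def sum_distrib_right mult.assoc)
  also have "\<dots> = (\<Sum>M\<in>edges d. \<Sum>\<sigma>\<in>G. s f M * (of_bool (\<sigma> \<in> U M) * h \<sigma>))" by (rule sum.swap)
  also have "\<dots> = (\<Sum>M\<in>edges d. s f M * s h M)" by (simp only: s_eq_sum_G sum_distrib_left)
  finally show ?thesis .
qed

lemma s_indicator: "s (\<lambda>\<sigma>. of_bool (\<sigma> \<in> U M)) M' = real (card (U (M \<union> M')))"
proof -
  have "s (\<lambda>\<sigma>. of_bool (\<sigma> \<in> U M)) M' = (\<Sum>\<sigma>\<in>U M \<inter> U M'. 1)"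
    unfolding s_def by (rule sum.mono_neutral_cong_right) auto
  then show ?thesis by (simp add: U_Un)
qed

lemma s_KK: "s (edge_op d f) M' = (\<Sum>M\<in>edges d. s f M * real (card (U (M \<union> M'))))"
proof -
  have "s (edge_op d f) M' = (\<Sum>M\<in>edges d. \<Sum>\<sigma>\<in>U M'. s f M * of_bool (\<sigma> \<in> U M))"
    unfolding s_def[of "edge_op d f"] edge_op_def by (rule sum.swap)
  then show ?thesis by (simp only: sum_distrib_left[symmetric] s_def[symmetric] s_indicator)
qed

lemma matching_Un_disjoint:
  assumes "matching A" "matching B" "fst ` A \<inter> fst ` B = {}" "snd ` A \<inter> snd ` B = {}"
  shows "matching (A \<union> B)"
  using assms unfolding matching_def by (auto simp: inj_on_Un)

text \<open>A term with edge set \<open>M\<close> survives only if \<open>M\<close> and the edges of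
  \<open>y\<close> on \<open>S\<close> form a matching together. Then \<open>M\<close> consists of
  the edges at some \<open>Q\<close> and of a set \<open>R\<close> avoiding all rows and columns of
  \<open>S\<close>, and the union has \<open>2 * d - card Q\<close> edges.\<close>

lemma s_KK_expand:
  assumes S: "finite S" "card S = d" and yv: "y \<in> valid" and y: "distinct_on S y"
  shows "s (edge_op d f) (y ` S) = (\<Sum>Q\<in>Pow S. fact (n - (2 * d - card Q)) *
    (\<Sum>R | R \<subseteq> ({1..n} - fst ` y ` S) \<times> ({1..n} - snd ` y ` S) \<and> card R = d - card Q. s f (y ` Q \<union> R)))"
proof -
  define E where "E = ({1..n} - fst ` y ` S) \<times> ({1..n} - snd ` y ` S)"
  define Os where "Os Q = {R. R \<subseteq> E \<and> card R = d - card Q}" for Q :: "nat set"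
  define t where "t M = s f M * real (card (U (M \<union> y ` S)))" for M
  define \<Phi> where "\<Phi> = (\<lambda>(Q, R). y ` Q \<union> R)"
  note ym = distinct_on_matching[OF y]
  have "p \<notin> E" if "p \<in> y ` S" for p using that by (simp add: E_def mem_Times_iff)
  then have E: "E \<subseteq> PP" "E \<inter> y ` S = {}" by (auto simp: E_def grid_def)
  have finE: "finite E" by (rule finite_subset[OF E(1) finite_PP])
  have finOs: "finite (Os Q)" for Q
    unfolding Os_def by (rule finite_subset[of _ "Pow E"]) (auto simp: finE)
  have card_M: "card (y ` Q \<union> R) = card Q + card R" if "Q \<subseteq> S" "R \<subseteq> E" for Q R
  proof -
    have "card (y ` Q \<union> R) = card (y ` Q) + card R"
    proof (rule card_Un_disjoint)
      show "finite (y ` Q)" using finite_subset[OF that(1) S(1)] by simp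
      show "finite R" by (rule finite_subset[OF that(2) finE])
      show "y ` Q \<inter> R = {}" using that E(2) by blast
    qed
    then show ?thesis using card_image[OF inj_on_subset[OF ym(3) that(1)]] by simp
  qed
  have cQ: "card Q \<le> d" if "Q \<subseteq> S" for Q using card_mono[OF S(1) that] S(2) by simp
  have recover: "{k \<in> S. y k \<in> y ` Q \<union> R} = Q" "(y ` Q \<union> R) - y ` S = R" if "Q \<subseteq> S" "R \<subseteq> E" for Q R
  proof -
    have "y k \<in> y ` Q \<union> R \<longleftrightarrow> k \<in> Q" if k: "k \<in> S" for k
    proof -
      have "y k \<notin> E" using E(2) imageI[OF k, of y] by blast
      then have "y k \<notin> R" using \<open>R \<subseteq> E\<close> by blast
      then show ?thesis by (simp add: inj_on_image_mem_iff[OF ym(3) k \<open>Q \<subseteq> S\<close>])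
    qed
    then show "{k \<in> S. y k \<in> y ` Q \<union> R} = Q" using \<open>Q \<subseteq> S\<close> by auto
    show "(y ` Q \<union> R) - y ` S = R" using \<open>Q \<subseteq> S\<close> \<open>R \<subseteq> E\<close> E(2) by blast
  qed
  have "s (edge_op d f) (y ` S) = (\<Sum>M\<in>edges d. t M)" by (simp only: s_KK t_def)
  also have "\<dots> = (\<Sum>M\<in>\<Phi> ` (Sigma (Pow S) Os). t M)"
  proof (rule sum.mono_neutral_right[OF finite_edges])
    show "\<Phi> ` Sigma (Pow S) Os \<subseteq> edges d"
    proof
      fix M assume "M \<in> \<Phi> ` Sigma (Pow S) Os"
      then obtain Q R where M: "Q \<subseteq> S" "R \<subseteq> E" "card R = d - card Q" "M = y ` Q \<union> R"
        by (auto simp: \<Phi>_def Os_def)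
      then have "card M = d" using card_M[OF M(1,2)] cQ[OF M(1)] by simp
      moreover have "M \<subseteq> PP" using M E(1) valid_image[OF yv, of Q] by blast
      ultimately show "M \<in> edges d" by (simp add: edges_def)
    qed
    show "\<forall>M\<in>edges d - \<Phi> ` Sigma (Pow S) Os. t M = 0"
    proof (intro ballI, rule ccontr)
      fix M assume M: "M \<in> edges d - \<Phi> ` Sigma (Pow S) Os" and "t M \<noteq> 0"
      then have "U (M \<union> y ` S) \<noteq> {}" by (auto simp: t_def)
      then have m: "matching (M \<union> y ` S)" by (rule matching_if_U)
      define Q R where "Q = {k \<in> S. y k \<in> M}" and "R = M - y ` S"
      have eq: "M = y ` Q \<union> R" by (auto simp: Q_def R_def)
      have MP: "M \<subseteq> PP" "card M = d" using M by (auto simp: edges_def)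
      have "R \<subseteq> E"
      proof
        fix p assume p: "p \<in> R"
        have "p \<in> PP" using p MP by (auto simp: R_def)
        moreover have "fst p \<notin> fst ` y ` S" "snd p \<notin> snd ` y ` S"
        proof -
          have p': "p \<in> M \<union> y ` S" "p \<notin> y ` S" using p by (auto simp: R_def)
          have inj: "inj_on fst (M \<union> y ` S)" "inj_on snd (M \<union> y ` S)" using m by (auto simp: matching_def)
          show "fst p \<notin> fst ` y ` S" "snd p \<notin> snd ` y ` S"
            using inj_on_image_mem_iff[OF inj(1) p'(1), of "y ` S"] inj_on_image_mem_iff[OF inj(2) p'(1), of "y ` S"] p'(2)
            by simp_all
        qed
        ultimately show "p \<in> E" unfolding E_def grid_def mem_Times_iff Diff_iff by blast
      qed
      moreover have QS: "Q \<subseteq> S" by (auto simp: Q_def)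
      ultimately have "card R = d - card Q" using card_M[of Q R] MP eq by simp
      then have "(Q, R) \<in> Sigma (Pow S) Os" using \<open>R \<subseteq> E\<close> QS by (simp add: Os_def)
      then have "M \<in> \<Phi> ` Sigma (Pow S) Os" unfolding eq by (rule rev_image_eqI) (simp add: \<Phi>_def)
      then show False using M by blast
    qed
  qed
  also have "\<dots> = (\<Sum>x\<in>Sigma (Pow S) Os. t (\<Phi> x))"
  proof (subst sum.reindex)
    show "inj_on \<Phi> (Sigma (Pow S) Os)"
    proof (rule inj_onI)
      fix x x' assume x: "x \<in> Sigma (Pow S) Os" "x' \<in> Sigma (Pow S) Os" and eq: "\<Phi> x = \<Phi> x'"
      obtain Q R where x1: "x = (Q, R)" by (cases x)
      obtain Q' R' where x2: "x' = (Q', R')" by (cases x')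
      note xx = x1 x2
      have QR: "Q \<subseteq> S" "R \<subseteq> E" "Q' \<subseteq> S" "R' \<subseteq> E" using x by (auto simp: xx Os_def)
      have e: "y ` Q \<union> R = y ` Q' \<union> R'" using eq by (simp add: xx \<Phi>_def)
      have "Q = {k \<in> S. y k \<in> y ` Q \<union> R}" by (rule recover(1)[OF QR(1,2), symmetric])
      also have "\<dots> = Q'" unfolding e by (rule recover(1)[OF QR(3,4)])
      finally have Q: "Q = Q'" .
      have "R = (y ` Q \<union> R) - y ` S" by (rule recover(2)[OF QR(1,2), symmetric])
      also have "\<dots> = R'" unfolding e by (rule recover(2)[OF QR(3,4)])
      finally show "x = x'" by (simp only: xx Q)
    qed
  qed simp
  also have "\<dots> = (\<Sum>Q\<in>Pow S. \<Sum>R\<in>Os Q. t (y ` Q \<union> R))"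
  proof -
    have "(\<Sum>Q\<in>Pow S. \<Sum>R\<in>Os Q. t (y ` Q \<union> R)) = (\<Sum>(Q, R)\<in>Sigma (Pow S) Os. t (y ` Q \<union> R))"
      by (rule sum.Sigma) (simp_all add: S(1) finOs)
    moreover have "(\<lambda>x. t (\<Phi> x)) = (\<lambda>(Q, R). t (y ` Q \<union> R))" by (simp add: \<Phi>_def fun_eq_iff)
    ultimately show ?thesis by (simp only:)
  qed
  also have "\<dots> = (\<Sum>Q\<in>Pow S. fact (n - (2 * d - card Q)) * (\<Sum>R\<in>Os Q. s f (y ` Q \<union> R)))"
    unfolding sum_distrib_left
  proof (intro sum.cong refl)
    fix Q R assume Q: "Q \<in> Pow S" and R: "R \<in> Os Q"
    then have QR: "Q \<subseteq> S" "R \<subseteq> E" "card R = d - card Q" by (auto simp: Os_def)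
    show "t (y ` Q \<union> R) = fact (n - (2 * d - card Q)) * s f (y ` Q \<union> R)"
    proof (cases "matching (y ` Q \<union> R)")
      case True
      then have "matching R" by (rule matching_subset) blast
      moreover have notin: "fst p \<notin> fst ` y ` S \<and> snd p \<notin> snd ` y ` S" if "p \<in> R" for p
      proof -
        have "p \<in> E" using that QR(2) by blast
        then show ?thesis by (simp add: E_def mem_Times_iff)
      qed
      have disj: "A \<inter> h ` R = {}" if "\<And>p. p \<in> R \<Longrightarrow> h p \<notin> A" for A and h :: "nat \<times> nat \<Rightarrow> nat"
        using that by blast
      have "fst ` y ` S \<inter> fst ` R = {}" by (rule disj) (use notin in simp)
      moreover have "snd ` y ` S \<inter> snd ` R = {}" by (rule disj) (use notin in simp)
      ultimately have m: "matching (y ` S \<union> R)" using ym(1) by (intro matching_Un_disjoint)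
      have "card (y ` S \<union> R) = 2 * d - card Q" using card_M[OF order_refl QR(2)] QR(3) S(2) cQ[OF QR(1)] by simp
      moreover have "y ` S \<union> R \<subseteq> PP" using QR(2) E(1) valid_image[OF yv] by blast
      ultimately have "card (U (y ` S \<union> R)) = fact (n - (2 * d - card Q))" using card_U[OF m] by simp
      moreover have "(y ` Q \<union> R) \<union> y ` S = y ` S \<union> R" using QR(1) by blast
      ultimately show ?thesis by (simp add: t_def)
    qed (simp add: t_def s_zero)
  qed
  finally show ?thesis by (simp only: E_def Os_def)
qed

text \<open>For K = \<open>edge_op d\<close> this is the inequality K^2 \<ge> (n - d)! K of
  quadratic forms on functions without mass below \<open>d\<close>. The Vandermonde exchange turns
  the expansion into nonnegative multiples of pairings with \<open>Z f S Q\<close>, of which only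
  \<open>Q = S\<close> is retained.\<close>

lemma edge_op_square_lower_bound:
  assumes d: "2 * d \<le> n" and f: "\<And>M. M \<subseteq> PP \<Longrightarrow> card M < d \<Longrightarrow> s f M = 0"
  shows "fact (n - d) * (\<Sum>M\<in>edges d. (s f M)\<^sup>2) \<le> (\<Sum>M\<in>edges d. s f M * s (edge_op d f) M)"
proof -
  define S where "S = {..<d}"
  have S: "finite S" "card S = d" by (auto simp: S_def)
  obtain y0 where y0: "y0 \<in> valid" by (rule valid_exists)
  define c where "c Q = fact (n - (2 * d - card Q)) *
      (\<Sum>X\<in>Pow Q. vand (n - 2 * d) (d - card Q) (d - card Q + card X))" for Q :: "nat set"
  have c0: "0 \<le> c Q" for Q
    unfolding c_def by (intro mult_nonneg_nonneg sum_nonneg vand_nonneg) simp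
  \<comment> \<open>For \<open>Q = S\<close> no outside edges are chosen, so \<open>vand\<close>
    leaves only the empty \<open>X\<close>, with value 1.\<close>
  have cS: "c S = fact (n - d)"
  proof -
    have "(\<Sum>X\<in>Pow S. vand (n - 2 * d) 0 (card X)) = (\<Sum>X\<in>{{} :: nat set}. vand (n - 2 * d) 0 (card X))"
      using S(1) by (intro sum.mono_neutral_right) (auto simp: vand_def dest: finite_subset[OF _ S(1)])
    then have "(\<Sum>X\<in>Pow S. vand (n - 2 * d) 0 (card X)) = 1" by (simp add: vand_def)
    then show ?thesis using S by (simp add: c_def)
  qed
  have expand: "s f (y ` S) * s (edge_op d f) (y ` S) = (\<Sum>Q\<in>Pow S. c Q * s f (y ` S) * Z f S Q y)"
    if yv: "y \<in> valid" for y
  proof (cases "distinct_on S y")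
    case False
    then have "s f (y ` S) = 0" by (rule s_image_zero[OF S yv _ f])
    then show ?thesis by simp
  next
    case True
    have rc: "card (fst ` y ` S) = d" "card (snd ` y ` S) = d"
      using distinct_on_matching[OF True] S(2) by (simp_all add: matching_card_fst matching_card_snd)
    have "(\<Sum>R | R \<subseteq> ({1..n} - fst ` y ` S) \<times> ({1..n} - snd ` y ` S) \<and> card R = d - card Q. s f (y ` Q \<union> R))
        = (\<Sum>X\<in>Pow Q. vand (n - 2 * d) (d - card Q) (d - card Q + card X)) * Z f S Q y" if Q: "Q \<in> Pow S" for Q
    proof -
      have "n - d - d = n - 2 * d" by simp
      then show ?thesis
        using sum_outside_eq_sum_inside[OF valid_rows[OF yv, of S] valid_cols[OF yv, of S], where l = "d - card Q" and f = f and L = "y ` Q"]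
          sum_inside_eq_Z[OF S yv True _ f, where Q = Q and \<phi> = "vand (n - 2 * d) (d - card Q)"] Q d
        unfolding rc by simp
    qed
    then have "s (edge_op d f) (y ` S) = (\<Sum>Q\<in>Pow S. c Q * Z f S Q y)"
      unfolding s_KK_expand[OF S yv True] c_def by (simp add: mult.assoc)
    then show ?thesis by (simp add: sum_distrib_left mult_ac)
  qed
  have "fact (n - d) * Av S (\<lambda>y. (s f (y ` S))\<^sup>2) y0 = Av S (\<lambda>y. c S * s f (y ` S) * Z f S S y) y0"
  proof -
    have "{\<pi>. \<pi> permutes S - S} = {id}" by (auto simp: permutes_empty)
    then have "Z f S S y = s f (y ` S)" for y by (simp add: Z_def colperm_def)
    then have "(\<lambda>y. c S * s f (y ` S) * Z f S S y) = (\<lambda>y. fact (n - d) * (s f (y ` S))\<^sup>2)"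
      by (simp add: cS power2_eq_square mult.assoc)
    then show ?thesis by (simp only: Av_cmult[OF S(1)])
  qed
  also have "\<dots> \<le> (\<Sum>Q\<in>Pow S. Av S (\<lambda>y. c Q * s f (y ` S) * Z f S Q y) y0)"
    using S by (intro member_le_sum Av_pairing_nonneg[OF S(1) order_refl y0]) (auto simp: c0)
  also have "\<dots> = Av S (\<lambda>y. \<Sum>Q\<in>Pow S. c Q * s f (y ` S) * Z f S Q y) y0"
    by (rule Av_sum[symmetric]) (use S in auto)
  also have "\<dots> = Av S (\<lambda>y. s f (y ` S) * s (edge_op d f) (y ` S)) y0"
    by (rule Av_cong_valid[OF S(1) y0]) (simp add: expand)
  finally have "fact (n - d) * Av S (\<lambda>y. (s f (y ` S))\<^sup>2) y0 \<le> Av S (\<lambda>y. s f (y ` S) * s (edge_op d f) (y ` S)) y0" .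
  moreover have "Av S (\<lambda>y. (s f (y ` S))\<^sup>2) y0 = fact d * (\<Sum>M\<in>edges d. (s f M)\<^sup>2) / (real n ^ 2) ^ d"
    by (rule Av_image_edges[OF S(1) order_refl S(2)]) (simp add: f)
  moreover have "Av S (\<lambda>y. s f (y ` S) * s (edge_op d f) (y ` S)) y0
      = fact d * (\<Sum>M\<in>edges d. s f M * s (edge_op d f) M) / (real n ^ 2) ^ d"
    by (rule Av_image_edges[OF S(1) order_refl S(2)]) (simp add: f)
  ultimately have "fact d * (fact (n - d) * (\<Sum>M\<in>edges d. (s f M)\<^sup>2)) / (real n ^ 2) ^ d
      \<le> fact d * (\<Sum>M\<in>edges d. s f M * s (edge_op d f) M) / (real n ^ 2) ^ d" by (simp add: mult_ac)
  then show ?thesis using n1 by (simp add: divide_le_cancel)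
qed

end

text \<open>Orthogonal projection onto \<open>X\<close>, one Gram-Schmidt step for each point of the
  support. The functions in \<open>X\<close> vanishing at \<open>e\<close> form \<open>X'\<close>;
  if this is not all of \<open>X\<close>, some \<open>v\<close> outside it, made orthogonal to
  \<open>X'\<close>, gives the one missing direction \<open>w\<close>.\<close>

lemma finite_support_projection:
  fixes X :: "('a \<Rightarrow> real) set"
  assumes "finite E" "X \<noteq> {}"
    and "\<And>f g c. f \<in> X \<Longrightarrow> g \<in> X \<Longrightarrow> (\<lambda>x. f x + c * g x) \<in> X"
    and "\<And>f x. f \<in> X \<Longrightarrow> x \<notin> E \<Longrightarrow> f x = 0"
  shows "\<exists>p\<in>X. \<forall>g\<in>X. (\<Sum>x\<in>E. (f x - p x) * g x) = 0"
  using assms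
proof (induction E arbitrary: X f rule: finite_induct)
  case empty
  then show ?case by auto
next
  case (insert e E)
  note lin = insert.prems(2)
  show ?case
  proof (cases "\<forall>g\<in>X. g e = 0")
    case True
    have supp: "f x = 0" if "f \<in> X" "x \<notin> E" for f x
      using True insert.prems(3)[of f x] that by (cases "x = e") auto
    have "\<exists>p\<in>X. \<forall>g\<in>X. (\<Sum>x\<in>E. (f x - p x) * g x) = 0"
    proof (rule insert.IH[OF insert.prems(1)])
      show "(\<lambda>x. f x + c * g x) \<in> X" if "f \<in> X" "g \<in> X" for f g c by (rule lin[OF that])
      show "f x = 0" if "f \<in> X" "x \<notin> E" for f x by (rule supp[OF that])
    qed
    then obtain p where p: "p \<in> X" "\<forall>g\<in>X. (\<Sum>x\<in>E. (f x - p x) * g x) = 0" by blast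
    have "(\<Sum>x\<in>insert e E. (f x - p x) * g x) = 0" if "g \<in> X" for g
      using p(2) True that insert.hyps by simp
    then show ?thesis using p(1) by blast
  next
    case False
    then obtain v where v: "v \<in> X" "v e \<noteq> 0" by blast
    define X' where "X' = {g \<in> X. g e = 0}"
    have ne: "X' \<noteq> {}" using lin[OF v(1) v(1), of "-1"] by (auto simp: X'_def)
    have lin': "(\<lambda>x. f x + c * g x) \<in> X'" if "f \<in> X'" "g \<in> X'" for f g c
      using that lin by (simp add: X'_def)
    have supp': "f x = 0" if "f \<in> X'" "x \<notin> E" for f x
      using that insert.prems(3)[of f x] by (auto simp: X'_def)
    define ip where "ip a b = (\<Sum>x\<in>insert e E. a x * b x)" for a b :: "'a \<Rightarrow> real"
    have proj: "\<exists>p\<in>X'. \<forall>g\<in>X'. ip (\<lambda>x. f x - p x) g = 0" for f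
    proof -
      have "\<exists>p\<in>X'. \<forall>g\<in>X'. (\<Sum>x\<in>E. (f x - p x) * g x) = 0"
      proof (rule insert.IH[OF ne])
        show "(\<lambda>x. f x + c * g x) \<in> X'" if "f \<in> X'" "g \<in> X'" for f g c by (rule lin'[OF that])
        show "f x = 0" if "f \<in> X'" "x \<notin> E" for f x by (rule supp'[OF that])
      qed
      then obtain p where p: "p \<in> X'" "\<And>g. g \<in> X' \<Longrightarrow> (\<Sum>x\<in>E. (f x - p x) * g x) = 0" by blast
      have "ip (\<lambda>x. f x - p x) g = 0" if "g \<in> X'" for g
        using p(2)[OF that] that insert.hyps by (simp add: ip_def X'_def)
      then show ?thesis using p(1) by blast
    qed
    obtain p1 where p1: "p1 \<in> X'" "\<And>g. g \<in> X' \<Longrightarrow> ip (\<lambda>x. v x - p1 x) g = 0" using proj[of v] by blast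
    obtain p2 where p2: "p2 \<in> X'" "\<And>g. g \<in> X' \<Longrightarrow> ip (\<lambda>x. f x - p2 x) g = 0" using proj[of f] by blast
    define w where "w x = v x - p1 x" for x
    have w: "w \<in> X" "w e \<noteq> 0" "\<And>g. g \<in> X' \<Longrightarrow> ip w g = 0"
    proof -
      show "w \<in> X" using lin[OF v(1), of p1 "-1"] p1(1) by (simp add: w_def[abs_def] X'_def)
      show "w e \<noteq> 0" using v(2) p1(1) by (simp add: w_def X'_def)
      show "ip w g = 0" if "g \<in> X'" for g using p1(2)[OF that] by (simp add: w_def[abs_def])
    qed
    have "ip w w > 0"
      unfolding ip_def using insert.hyps w(2)
      by (intro sum_pos2[of _ e]) (auto simp: zero_less_mult_iff not_less_iff_gr_or_eq)
    define c where "c = ip (\<lambda>x. f x - p2 x) w / ip w w"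
    define p where "p x = p2 x + c * w x" for x
    have ip_p: "ip (\<lambda>x. f x - p x) g = ip (\<lambda>x. f x - p2 x) g - c * ip w g" for g
      by (simp add: ip_def p_def sum_subtractf[symmetric] sum_distrib_left algebra_simps del: sum.insert)
    have "p \<in> X" using lin[of p2 w c] p2(1) w(1) by (simp add: p_def[abs_def] X'_def)
    moreover have "ip (\<lambda>x. f x - p x) g = 0" if g: "g \<in> X" for g
    proof -
      define a where "a = g e / w e"
      define g' where "g' x = g x + (- a) * w x" for x
      have "g' \<in> X'" using lin[OF g w(1), of "- a"] w(2) by (simp add: X'_def g'_def[abs_def] a_def)
      then have "ip (\<lambda>x. f x - p x) g' = 0" using p2(2) w(3) by (simp add: ip_p)
      moreover have "ip (\<lambda>x. f x - p x) w = 0" using \<open>ip w w > 0\<close> by (simp add: ip_p c_def)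
      moreover have "ip (\<lambda>x. f x - p x) g = ip (\<lambda>x. f x - p x) g' + a * ip (\<lambda>x. f x - p x) w"
        by (simp add: ip_def g'_def sum.distrib[symmetric] sum_distrib_left algebra_simps del: sum.insert)
      ultimately show ?thesis by simp
    qed
    ultimately show ?thesis by (auto simp: ip_def)
  qed
qed

context symmetric_group
begin

section \<open>Degree spaces and their orthogonal layers\<close>

definition edges_le :: "nat \<Rightarrow> (nat \<times> nat) set set" where
  "edges_le d = {M. M \<subseteq> PP \<and> card M \<le> d}"

lemma finite_edges_le: "finite (edges_le d)"
  unfolding edges_le_def by (rule finite_subset[of _ "Pow PP"]) (auto simp: finite_PP)

definition W :: "nat \<Rightarrow> ((nat \<Rightarrow> nat) \<Rightarrow> real) set" where
  "W d = {f. \<exists>a. f = (\<lambda>\<sigma>. \<Sum>M\<in>edges_le d. a M * of_bool (\<sigma> \<in> U M))}"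

lemma W_lin:
  assumes "f \<in> W d" "g \<in> W d" shows "(\<lambda>\<sigma>. f \<sigma> + c * g \<sigma>) \<in> W d"
proof -
  obtain a b where "f = (\<lambda>\<sigma>. \<Sum>M\<in>edges_le d. a M * of_bool (\<sigma> \<in> U M))"
    "g = (\<lambda>\<sigma>. \<Sum>M\<in>edges_le d. b M * of_bool (\<sigma> \<in> U M))" using assms by (auto simp: W_def)
  then have "(\<lambda>\<sigma>. f \<sigma> + c * g \<sigma>) = (\<lambda>\<sigma>. \<Sum>M\<in>edges_le d. (a M + c * b M) * of_bool (\<sigma> \<in> U M))"
    by (simp add: sum.distrib sum_distrib_left algebra_simps)
  then show ?thesis unfolding W_def by (intro CollectI exI)
qed

lemma W_zero: "(\<lambda>_. 0) \<in> W d"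
  unfolding W_def by (rule CollectI, rule exI[of _ "\<lambda>_. 0"]) simp

lemma W_indicator:
  assumes "M \<in> edges_le d" shows "(\<lambda>\<sigma>. of_bool (\<sigma> \<in> U M)) \<in> W d"
proof -
  have "of_bool (\<sigma> \<in> U M) = (\<Sum>M'\<in>edges_le d. of_bool (M' = M) * of_bool (\<sigma> \<in> U M') :: real)" for \<sigma>
  proof -
    have "(\<Sum>M'\<in>edges_le d. of_bool (M' = M) * of_bool (\<sigma> \<in> U M') :: real)
        = (\<Sum>M'\<in>edges_le d. if M' = M then of_bool (\<sigma> \<in> U M) else 0)"
      by (rule sum.cong) auto
    then show ?thesis using assms finite_edges_le by (simp add: sum.delta)
  qed
  then show ?thesis unfolding W_def by (intro CollectI exI ext)
qed

lemma W_sum: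
  assumes "finite I" "\<And>i. i \<in> I \<Longrightarrow> h i \<in> W d"
  shows "(\<lambda>\<sigma>. \<Sum>i\<in>I. c i * h i \<sigma>) \<in> W d"
  using assms
proof (induction I rule: finite_induct)
  case (insert i I)
  have "(\<lambda>\<sigma>. (\<Sum>i\<in>I. c i * h i \<sigma>) + c i * h i \<sigma>) \<in> W d" by (rule W_lin) (use insert in auto)
  then show ?case using insert.hyps by (simp add: add.commute)
qed (simp add: W_zero)

lemma W_supp:
  assumes "f \<in> W d" "\<sigma> \<notin> G" shows "f \<sigma> = 0"
proof -
  have "\<sigma> \<notin> U M" for M using assms(2) by (simp add: U_def)
  then show ?thesis using assms(1) by (auto simp: W_def)
qed

lemma W_inner:
  assumes "f \<in> W d" and h: "\<And>M. M \<subseteq> PP \<Longrightarrow> card M \<le> d \<Longrightarrow> s h M = 0"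
  shows "(\<Sum>\<sigma>\<in>G. h \<sigma> * f \<sigma>) = 0"
proof -
  obtain a where f: "f = (\<lambda>\<sigma>. \<Sum>M\<in>edges_le d. a M * of_bool (\<sigma> \<in> U M))" using assms by (auto simp: W_def)
  have "(\<Sum>\<sigma>\<in>G. h \<sigma> * f \<sigma>) = (\<Sum>\<sigma>\<in>G. \<Sum>M\<in>edges_le d. a M * (of_bool (\<sigma> \<in> U M) * h \<sigma>))"
    by (simp add: f sum_distrib_left mult_ac)
  also have "\<dots> = (\<Sum>M\<in>edges_le d. \<Sum>\<sigma>\<in>G. a M * (of_bool (\<sigma> \<in> U M) * h \<sigma>))" by (rule sum.swap)
  also have "\<dots> = (\<Sum>M\<in>edges_le d. a M * s h M)" by (simp only: s_eq_sum_G sum_distrib_left)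
  also have "\<dots> = 0" by (rule sum.neutral) (auto simp: edges_le_def h)
  finally show ?thesis .
qed

lemma s_lin: "s (\<lambda>\<sigma>. f \<sigma> + c * g \<sigma>) M = s f M + c * s g M"
  by (simp add: s_def sum.distrib sum_distrib_left)

text \<open>The condition on \<open>s f M\<close> is orthogonality to the indicators that span the
  lower degrees.\<close>

definition pure :: "nat \<Rightarrow> ((nat \<Rightarrow> nat) \<Rightarrow> real) set" where
  "pure d = {f \<in> W d. \<forall>M. M \<subseteq> PP \<longrightarrow> card M < d \<longrightarrow> s f M = 0}"

lemma pure_lin: "f \<in> pure d \<Longrightarrow> g \<in> pure d \<Longrightarrow> (\<lambda>\<sigma>. f \<sigma> + c * g \<sigma>) \<in> pure d"
  unfolding pure_def by (simp add: W_lin s_lin)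

lemma W_mono: "d \<le> e \<Longrightarrow> f \<in> W d \<Longrightarrow> f \<in> W e"
proof -
  assume de: "d \<le> e" and "f \<in> W d"
  then obtain a where f: "f = (\<lambda>\<sigma>. \<Sum>M\<in>edges_le d. a M * of_bool (\<sigma> \<in> U M))" by (auto simp: W_def)
  show "f \<in> W e" unfolding f
    by (rule W_sum[OF finite_edges_le], rule W_indicator) (use de in \<open>auto simp: edges_le_def\<close>)
qed

lemma edge_op_W: "edge_op d f \<in> W d"
  unfolding edge_op_def[abs_def]
  by (rule W_sum[OF finite_edges], rule W_indicator) (auto simp: edges_def edges_le_def)

lemma sum_left_translate:
  assumes "\<tau> \<in> G" shows "(\<Sum>\<sigma>\<in>G. f (\<tau> \<circ> \<sigma>)) = (\<Sum>\<sigma>\<in>G. f \<sigma>)"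
  using sum_G_reindex[OF G_id assms, of f] by simp

text \<open>A left-invariant kernel acts by convolution on the right, so it maps functions orthogonal to
  all matchings of a given size to such functions.\<close>

lemma s_kernel:
  assumes k: "\<And>\<omega> \<tau> \<sigma>. \<omega> \<in> G \<Longrightarrow> \<tau> \<in> G \<Longrightarrow> \<sigma> \<in> G \<Longrightarrow> k (\<omega> \<circ> \<tau>) (\<omega> \<circ> \<sigma>) = k \<tau> \<sigma>"
    and h: "\<And>\<sigma>. \<sigma> \<in> G \<Longrightarrow> h \<sigma> = (\<Sum>\<tau>\<in>G. f \<tau> * k \<tau> \<sigma>)"
  shows "s h M = (\<Sum>\<omega>\<in>G. k id \<omega> * s f (relabel \<omega> id ` M))"
proof -
  have "s h M = (\<Sum>\<sigma>\<in>G. \<Sum>\<tau>\<in>G. of_bool (\<sigma> \<in> U M) * (f \<tau> * k \<tau> \<sigma>))"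
    unfolding s_eq_sum_G by (intro sum.cong refl) (simp add: h sum_distrib_left)
  also have "\<dots> = (\<Sum>\<tau>\<in>G. \<Sum>\<sigma>\<in>G. of_bool (\<sigma> \<in> U M) * (f \<tau> * k \<tau> \<sigma>))" by (rule sum.swap)
  also have "\<dots> = (\<Sum>\<tau>\<in>G. \<Sum>\<omega>\<in>G. k id \<omega> * (of_bool (\<tau> \<in> U (relabel \<omega> id ` M)) * f \<tau>))"
  proof (rule sum.cong[OF refl])
    fix \<tau> assume \<tau>: "\<tau> \<in> G"
    have "(\<Sum>\<sigma>\<in>G. of_bool (\<sigma> \<in> U M) * (f \<tau> * k \<tau> \<sigma>))
        = (\<Sum>\<omega>\<in>G. of_bool (\<tau> \<circ> \<omega> \<in> U M) * (f \<tau> * k \<tau> (\<tau> \<circ> \<omega>)))"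
      by (rule sum_left_translate[OF \<tau>, symmetric])
    also have "\<dots> = (\<Sum>\<omega>\<in>G. k id \<omega> * (of_bool (\<tau> \<in> U (relabel \<omega> id ` M)) * f \<tau>))"
    proof (rule sum.cong[OF refl])
      fix \<omega> assume \<omega>: "\<omega> \<in> G"
      have "k \<tau> (\<tau> \<circ> \<omega>) = k id \<omega>" using k[OF \<tau> G_id \<omega>] by simp
      moreover have "\<tau> \<circ> \<omega> \<in> U M \<longleftrightarrow> \<tau> \<in> U (relabel \<omega> id ` M)"
        using \<tau> G_comp[OF \<tau> \<omega>] by (simp add: U_def)
      ultimately show "of_bool (\<tau> \<circ> \<omega> \<in> U M) * (f \<tau> * k \<tau> (\<tau> \<circ> \<omega>))
          = k id \<omega> * (of_bool (\<tau> \<in> U (relabel \<omega> id ` M)) * f \<tau>)" by simp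
    qed
    finally show "(\<Sum>\<sigma>\<in>G. of_bool (\<sigma> \<in> U M) * (f \<tau> * k \<tau> \<sigma>))
        = (\<Sum>\<omega>\<in>G. k id \<omega> * (of_bool (\<tau> \<in> U (relabel \<omega> id ` M)) * f \<tau>))" .
  qed
  also have "\<dots> = (\<Sum>\<omega>\<in>G. \<Sum>\<tau>\<in>G. k id \<omega> * (of_bool (\<tau> \<in> U (relabel \<omega> id ` M)) * f \<tau>))" by (rule sum.swap)
  also have "\<dots> = (\<Sum>\<omega>\<in>G. k id \<omega> * s f (relabel \<omega> id ` M))" by (simp only: s_eq_sum_G sum_distrib_left)
  finally show ?thesis .
qed

lemma relabel_edges:
  assumes ab: "\<alpha> \<in> G" "\<beta> \<in> G" and M: "M \<subseteq> PP"
  shows "relabel \<alpha> \<beta> ` M \<subseteq> PP" "card (relabel \<alpha> \<beta> ` M) = card M"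
proof -
  have "relabel \<alpha> \<beta> p \<in> PP" if "p \<in> PP" for p
    using that G_mem[OF ab(1), of "fst p"] G_mem[OF ab(2), of "snd p"]
    by (simp only: grid_def mem_Times_iff relabel_simps)
  then show "relabel \<alpha> \<beta> ` M \<subseteq> PP" using M by blast
  have "inj (relabel \<alpha> \<beta>)" using ab by (intro inj_relabel G_inj)
  then show "card (relabel \<alpha> \<beta> ` M) = card M" by (intro card_image) (rule inj_on_subset, auto)
qed

lemma s_kernel_zero:
  assumes k: "\<And>\<omega> \<tau> \<sigma>. \<omega> \<in> G \<Longrightarrow> \<tau> \<in> G \<Longrightarrow> \<sigma> \<in> G \<Longrightarrow> k (\<omega> \<circ> \<tau>) (\<omega> \<circ> \<sigma>) = k \<tau> \<sigma>"
    and h: "\<And>\<sigma>. \<sigma> \<in> G \<Longrightarrow> h \<sigma> = (\<Sum>\<tau>\<in>G. f \<tau> * k \<tau> \<sigma>)"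
    and f: "\<And>M. M \<subseteq> PP \<Longrightarrow> card M < d \<Longrightarrow> s f M = 0" and M: "M \<subseteq> PP" "card M < d"
  shows "s h M = 0"
proof -
  have "s h M = (\<Sum>\<omega>\<in>G. k id \<omega> * s f (relabel \<omega> id ` M))" by (rule s_kernel[OF k h])
  also have "\<dots> = 0"
    by (rule sum.neutral) (simp add: f relabel_edges[OF _ G_id M(1)] M(2))
  finally show ?thesis .
qed

lemma sum_edges_relabel:
  assumes ab: "\<alpha> \<in> G" "\<beta> \<in> G"
  shows "(\<Sum>M\<in>edges d. g (relabel \<alpha> \<beta> ` M)) = (\<Sum>M\<in>edges d. g M)"
proof (rule sum.reindex_bij_witness[where j = "\<lambda>M. relabel \<alpha> \<beta> ` M" and i = "\<lambda>M. relabel (inv \<alpha>) (inv \<beta>) ` M"])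
  fix M assume M: "M \<in> edges d"
  show "relabel \<alpha> \<beta> ` M \<in> edges d" "relabel (inv \<alpha>) (inv \<beta>) ` M \<in> edges d"
    using M relabel_edges[OF ab, of M] relabel_edges[OF G_inv[OF ab(1)] G_inv[OF ab(2)], of M]
    by (simp_all add: edges_def)
  have "relabel (inv \<alpha>) (inv \<beta>) (relabel \<alpha> \<beta> p) = p" "relabel \<alpha> \<beta> (relabel (inv \<alpha>) (inv \<beta>) p) = p" for p
    using G_inv_simps[OF ab(1)] G_inv_simps[OF ab(2)] by (simp_all add: prod_eq_iff)
  then show "relabel (inv \<alpha>) (inv \<beta>) ` relabel \<alpha> \<beta> ` M = M" "relabel \<alpha> \<beta> ` relabel (inv \<alpha>) (inv \<beta>) ` M = M"
    by (simp_all add: image_image)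
qed (rule refl)

lemma edge_op_kernel:
  "edge_op d f \<sigma> = (\<Sum>\<tau>\<in>G. f \<tau> * (\<Sum>M\<in>edges d. of_bool (\<tau> \<in> U M) * of_bool (\<sigma> \<in> U M)))"
proof -
  have "edge_op d f \<sigma> = (\<Sum>M\<in>edges d. \<Sum>\<tau>\<in>G. f \<tau> * (of_bool (\<tau> \<in> U M) * of_bool (\<sigma> \<in> U M)))"
    unfolding edge_op_def s_eq_sum_G sum_distrib_right by (simp only: mult_ac)
  also have "\<dots> = (\<Sum>\<tau>\<in>G. \<Sum>M\<in>edges d. f \<tau> * (of_bool (\<tau> \<in> U M) * of_bool (\<sigma> \<in> U M)))" by (rule sum.swap)
  finally show ?thesis by (simp only: sum_distrib_left)
qed

text \<open>Relabelling columns permutes the edge sets of size \<open>d\<close>, so the kernel of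
  the operator is left-invariant and \<open>s_kernel_zero\<close> applies.\<close>

lemma edge_op_pure:
  assumes "f \<in> pure d" shows "edge_op d f \<in> pure d"
proof -
  define k where "k \<tau> \<sigma> = (\<Sum>M\<in>edges d. of_bool (\<tau> \<in> U M) * of_bool (\<sigma> \<in> U M) :: real)" for \<tau> \<sigma>
  have "k (\<omega> \<circ> \<tau>) (\<omega> \<circ> \<sigma>) = k \<tau> \<sigma>" if "\<omega> \<in> G" "\<tau> \<in> G" "\<sigma> \<in> G" for \<omega> \<tau> \<sigma>
  proof -
    have "k (\<omega> \<circ> \<tau>) (\<omega> \<circ> \<sigma>) = (\<Sum>M\<in>edges d. of_bool (\<omega> \<circ> \<tau> \<in> U (relabel id \<omega> ` M)) * of_bool (\<omega> \<circ> \<sigma> \<in> U (relabel id \<omega> ` M)))"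
      unfolding k_def
      by (rule sum_edges_relabel[OF G_id that(1), of "\<lambda>M. of_bool (\<omega> \<circ> \<tau> \<in> U M) * of_bool (\<omega> \<circ> \<sigma> \<in> U M)", symmetric])
    then show ?thesis
      using U_relabel[OF G_id that(1,2)] U_relabel[OF G_id that(1,3)] by (simp add: k_def)
  qed
  then have "s (edge_op d f) M = 0" if "M \<subseteq> PP" "card M < d" for M
    by (rule s_kernel_zero[of k "edge_op d f" f d M]) (use that assms edge_op_kernel in \<open>auto simp: k_def pure_def\<close>)
  then show ?thesis by (simp add: pure_def edge_op_W)
qed

text \<open>With the sums over \<open>edges d\<close> also 0, \<open>f\<close> is orthogonal to all
  of \<open>W d\<close>, in particular to itself.\<close>

lemma pure_eq_zero:
  assumes f: "f \<in> pure d" and e: "\<And>M. M \<in> edges d \<Longrightarrow> s f M = 0"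
  shows "f = (\<lambda>_. 0)"
proof
  fix \<sigma>
  have fW: "f \<in> W d" using f by (simp add: pure_def)
  have "(\<Sum>\<sigma>\<in>G. f \<sigma> * f \<sigma>) = 0"
  proof (rule W_inner[OF fW])
    fix M assume "M \<subseteq> PP" "card M \<le> d"
    then show "s f M = 0" using f e[of M] by (cases "card M = d") (auto simp: pure_def edges_def)
  qed
  then have "\<forall>\<sigma>\<in>G. f \<sigma> * f \<sigma> = 0" by (subst (asm) sum_nonneg_eq_0_iff) auto
  then show "f \<sigma> = 0" using W_supp[OF fW] by (cases "\<sigma> \<in> G") auto
qed

lemma edge_op_lin: "edge_op d (\<lambda>\<sigma>. f \<sigma> + c * g \<sigma>) = (\<lambda>\<sigma>. edge_op d f \<sigma> + c * edge_op d g \<sigma>)"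
  by (rule ext) (simp add: edge_op_def s_lin sum.distrib sum_distrib_left algebra_simps)

text \<open>An injective self-adjoint operator in finite dimension is onto. Concretely, the residual
  \<open>g\<close> of projecting \<open>f\<close> onto the range is orthogonal to its own image, so
  the sum of all \<open>(s g M)\<^sup>2\<close> is 0.\<close>

lemma edge_op_surj:
  assumes f: "f \<in> pure d" shows "\<exists>h\<in>pure d. f = edge_op d h"
proof -
  have "\<exists>p\<in>edge_op d ` pure d. \<forall>g\<in>edge_op d ` pure d. (\<Sum>x\<in>G. (f x - p x) * g x) = 0"
  proof (rule finite_support_projection[OF finite_G])
    show "edge_op d ` pure d \<noteq> {}" using f by blast
    show "(\<lambda>x. f x + c * g x) \<in> edge_op d ` pure d" if "f \<in> edge_op d ` pure d" "g \<in> edge_op d ` pure d" for f g c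
      using that by (auto simp: edge_op_lin[symmetric] pure_lin)
    show "f x = 0" if "f \<in> edge_op d ` pure d" "x \<notin> G" for f x
      using that W_supp[OF edge_op_W] by auto
  qed
  then obtain h where h: "h \<in> pure d" and orth: "\<And>g. g \<in> pure d \<Longrightarrow> (\<Sum>x\<in>G. (f x - edge_op d h x) * edge_op d g x) = 0"
    by auto
  define g where "g x = f x + (-1) * edge_op d h x" for x
  have g: "g \<in> pure d" unfolding g_def[abs_def] by (rule pure_lin[OF f edge_op_pure[OF h]])
  have "(\<Sum>x\<in>G. edge_op d g x * g x) = 0" using orth[OF g] by (simp add: g_def mult.commute)
  then have "(\<Sum>M\<in>edges d. s g M * s g M) = 0" by (simp add: edge_op_inner)
  then have "\<forall>M\<in>edges d. s g M * s g M = 0" by (subst (asm) sum_nonneg_eq_0_iff) (auto simp: finite_edges)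
  then have "g = (\<lambda>_. 0)" by (intro pure_eq_zero[OF g]) simp
  then have "f = edge_op d h" by (auto simp: g_def fun_eq_iff)
  then show ?thesis using h by blast
qed

text \<open>From K^2 \<ge> (n - d)! K for K = \<open>edge_op d\<close> one factor K can be cancelled
  because K maps onto \<open>pure d\<close>. The substitution f = K h and Cauchy-Schwarz carry this
  out.\<close>

theorem pure_edge_mass:
  assumes d: "2 * d \<le> n" and f: "f \<in> pure d"
  shows "fact (n - d) * (\<Sum>\<sigma>\<in>G. (f \<sigma>)\<^sup>2) \<le> (\<Sum>M\<in>edges d. (s f M)\<^sup>2)"
proof -
  obtain h where h: "h \<in> pure d" and fh: "f = edge_op d h" using edge_op_surj[OF f] by blast
  define F a b where "F = (\<Sum>\<sigma>\<in>G. (f \<sigma>)\<^sup>2)" and "a = (\<Sum>M\<in>edges d. (s h M)\<^sup>2)" and "b = (\<Sum>M\<in>edges d. (s f M)\<^sup>2)"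
  have nn: "0 \<le> F" "0 \<le> b" by (simp_all add: F_def b_def sum_nonneg)
  have F: "F = (\<Sum>M\<in>edges d. s h M * s f M)"
    using edge_op_inner[of d h f] by (simp add: F_def fh[symmetric] power2_eq_square)
  have 1: "fact (n - d) * a \<le> F"
    unfolding F a_def fh by (rule edge_op_square_lower_bound[OF d]) (use h in \<open>simp add: pure_def\<close>)
  have "F\<^sup>2 \<le> a * b" unfolding F a_def b_def by (rule Cauchy_Schwarz_ineq_sum)
  then have "fact (n - d) * F\<^sup>2 \<le> fact (n - d) * (a * b)" by (intro mult_left_mono) auto
  also have "\<dots> = (fact (n - d) * a) * b" by (rule mult.assoc[symmetric])
  also have "\<dots> \<le> F * b" using 1 nn by (intro mult_right_mono)
  finally have "F * (fact (n - d) * F) \<le> F * b" by (simp add: power2_eq_square mult_ac)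
  then have "fact (n - d) * F \<le> b" using nn by (cases "F = 0") auto
  then show ?thesis by (simp only: F_def b_def)
qed

lemma W_Suc_decompose:
  assumes f: "f \<in> W (Suc d)"
  obtains p g where "p \<in> W d" "g \<in> pure (Suc d)" "f = (\<lambda>\<sigma>. g \<sigma> + p \<sigma>)"
proof -
  have "\<exists>p\<in>W d. \<forall>g\<in>W d. (\<Sum>x\<in>G. (f x - p x) * g x) = 0"
  proof (rule finite_support_projection[OF finite_G])
    show "W d \<noteq> {}" using W_zero[of d] by blast
    show "(\<lambda>x. f x + c * g x) \<in> W d" if "f \<in> W d" "g \<in> W d" for f g c by (rule W_lin[OF that])
    show "f x = 0" if "f \<in> W d" "x \<notin> G" for f x by (rule W_supp[OF that])
  qed
  then obtain p where p: "p \<in> W d" "\<And>g. g \<in> W d \<Longrightarrow> (\<Sum>x\<in>G. (f x - p x) * g x) = 0" by blast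
  define g where "g x = f x + (-1) * p x" for x
  have "g \<in> W (Suc d)" unfolding g_def[abs_def] by (rule W_lin[OF f W_mono[OF _ p(1)]]) simp
  moreover have "s g M = 0" if "M \<subseteq> PP" "card M < Suc d" for M
  proof -
    have "M \<in> edges_le d" using that by (simp add: edges_le_def)
    then have "(\<Sum>x\<in>G. (f x - p x) * of_bool (x \<in> U M)) = 0" by (intro p(2) W_indicator)
    then show ?thesis by (simp add: s_eq_sum_G g_def mult.commute)
  qed
  ultimately have "g \<in> pure (Suc d)" by (simp add: pure_def)
  then show ?thesis using p(1) by (intro that[of p g]) (auto simp: g_def)
qed

text \<open>On permutations the variables take the values 0 and 1, so a monomial depends only on its
  support, of size at most its degree, and is the indicator of \<open>U\<close> there.\<close>

lemma V_le_sub_W: "V_le n d \<subseteq> W d"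
proof
  fix f assume "f \<in> V_le n d"
  then obtain MM :: "(nat \<times> nat \<Rightarrow> nat) set" and c :: "(nat \<times> nat \<Rightarrow> nat) \<Rightarrow> real"
    where f0: "f \<in> L2_sym n" and fin: "finite MM" and deg: "\<forall>m\<in>MM. (\<Sum>v\<in>{1..n} \<times> {1..n}. m v) \<le> d"
      and f: "\<forall>\<sigma>\<in>sym_grp n. f \<sigma> = (\<Sum>m\<in>MM. c m * (\<Prod>(i, j)\<in>{1..n} \<times> {1..n}. x_ind i j \<sigma> ^ m (i, j)))"
    unfolding V_le_def by blast
  define supp where "supp m = {v \<in> PP. m v \<noteq> 0}" for m :: "nat \<times> nat \<Rightarrow> nat"
  have supp: "supp m \<in> edges_le d" if "m \<in> MM" for m
  proof -
    have "card (supp m) = (\<Sum>v\<in>supp m. 1)" by simp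
    also have "\<dots> \<le> (\<Sum>v\<in>supp m. m v)" by (rule sum_mono) (auto simp: supp_def)
    also have "\<dots> \<le> (\<Sum>v\<in>PP. m v)" by (rule sum_mono2) (auto simp: supp_def finite_PP)
    also have "\<dots> \<le> d" using deg that by (simp add: grid_def)
    finally show ?thesis by (auto simp: edges_le_def supp_def)
  qed
  have mono: "(\<Prod>(i, j)\<in>{1..n} \<times> {1..n}. x_ind i j \<sigma> ^ m (i, j)) = of_bool (\<sigma> \<in> U (supp m))"
    if \<sigma>: "\<sigma> \<in> G" for \<sigma> m
  proof -
    have "(\<Prod>(i, j)\<in>{1..n} \<times> {1..n}. x_ind i j \<sigma> ^ m (i, j)) = (\<Prod>v\<in>PP. of_bool (m v = 0 \<or> \<sigma> (fst v) = snd v) :: real)"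
      unfolding grid_def by (rule prod.cong[OF refl]) (auto simp: x_ind_def)
    also have "\<dots> = of_bool (\<sigma> \<in> U (supp m))"
    proof (cases "\<sigma> \<in> U (supp m)")
      case True
      have "m v = 0 \<or> \<sigma> (fst v) = snd v" if "v \<in> PP" for v
        using True that unfolding U_def supp_def by blast
      then show ?thesis using True by (intro trans[OF prod.neutral]) auto
    next
      case False
      then obtain v where "v \<in> PP" "m v \<noteq> 0" "\<sigma> (fst v) \<noteq> snd v" using \<sigma> by (auto simp: U_def supp_def)
      then have "(\<Prod>v\<in>PP. of_bool (m v = 0 \<or> \<sigma> (fst v) = snd v) :: real) = 0"
        by (intro prod_zero) (auto simp: finite_PP intro!: bexI[of _ v])
      then show ?thesis using False by simp
    qed
    finally show ?thesis .
  qed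
  have "f = (\<lambda>\<sigma>. \<Sum>m\<in>MM. c m * of_bool (\<sigma> \<in> U (supp m)))"
  proof
    fix \<sigma>
    show "f \<sigma> = (\<Sum>m\<in>MM. c m * of_bool (\<sigma> \<in> U (supp m)))"
    proof (cases "\<sigma> \<in> G")
      case True
      have "f \<sigma> = (\<Sum>m\<in>MM. c m * (\<Prod>(i, j)\<in>{1..n} \<times> {1..n}. x_ind i j \<sigma> ^ m (i, j)))"
        using f True by blast
      then show ?thesis by (simp only: mono[OF True])
    next
      case False
      then have "\<sigma> \<notin> U (supp m)" for m by (simp add: U_def)
      then show ?thesis using f0 False by (simp add: L2_sym_def)
    qed
  qed
  also have "\<dots> \<in> W d" by (rule W_sum[OF fin W_indicator[OF supp]])
  finally show "f \<in> W d" .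
qed

end

section \<open>The operator on the symmetric group\<close>

context finite_alphabet
begin

lemma noise_Lq_contraction:
  assumes A: "finite A" and \<rho>: "0 \<le> \<rho>" "\<rho> \<le> 1" and q: "q \<ge> 1" and y: "y \<in> valid"
  shows "set is \<subseteq> A \<Longrightarrow> Av A (\<lambda>z. \<bar>noise \<rho> is g z\<bar> powr q) y \<le> Av A (\<lambda>z. \<bar>g z\<bar> powr q) y"
proof (induction "is")
  case (Cons i js)
  let ?h = "noise \<rho> js g"
  have "Av A (\<lambda>z. \<bar>noise \<rho> (i # js) g z\<bar> powr q) y
      \<le> Av A (\<lambda>z. \<rho> * \<bar>?h z\<bar> powr q + (1 - \<rho>) * av i (\<lambda>z. \<bar>?h z\<bar> powr q) z) y"
  proof (rule Av_mono_valid[OF A y])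
    fix z assume z: "z \<in> valid"
    have "\<bar>Av {i} (\<lambda>z. 1 * ?h z) z\<bar> powr q \<le> Av {i} (\<lambda>z. 1 * \<bar>?h z\<bar> powr q) z"
      by (rule Av_Jensen_powr[OF _ z q]) auto
    then have 1: "\<bar>av i ?h z\<bar> powr q \<le> av i (\<lambda>z. \<bar>?h z\<bar> powr q) z" by (simp add: av_eq_Av)
    have "\<bar>nz \<rho> i ?h z\<bar> \<le> \<bar>\<rho> * ?h z\<bar> + \<bar>(1 - \<rho>) * av i ?h z\<bar>"
      unfolding nz_def by (rule abs_triangle_ineq)
    also have "\<dots> = (1 - (1 - \<rho>)) *\<^sub>R \<bar>?h z\<bar> + (1 - \<rho>) *\<^sub>R \<bar>av i ?h z\<bar>"
      using \<rho> by (simp add: abs_mult)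
    finally have "\<bar>nz \<rho> i ?h z\<bar> powr q \<le> ((1 - (1 - \<rho>)) *\<^sub>R \<bar>?h z\<bar> + (1 - \<rho>) *\<^sub>R \<bar>av i ?h z\<bar>) powr q"
      using q by (intro powr_mono2) auto
    also have "\<dots> \<le> (1 - (1 - \<rho>)) * \<bar>?h z\<bar> powr q + (1 - \<rho>) * \<bar>av i ?h z\<bar> powr q"
      by (rule convex_onD[OF convex_on_powr_nonneg[OF q]]) (use \<rho> in auto)
    also have "\<dots> \<le> \<rho> * \<bar>?h z\<bar> powr q + (1 - \<rho>) * av i (\<lambda>z. \<bar>?h z\<bar> powr q) z"
      using 1 \<rho> by (simp add: mult_left_mono)
    finally show "\<bar>noise \<rho> (i # js) g z\<bar> powr q \<le> \<rho> * \<bar>?h z\<bar> powr q + (1 - \<rho>) * av i (\<lambda>z. \<bar>?h z\<bar> powr q) z"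
      by simp
  qed
  also have "\<dots> = Av A (\<lambda>z. \<bar>?h z\<bar> powr q) y"
  proof -
    have "Av A (av i (\<lambda>z. \<bar>?h z\<bar> powr q)) y = Av A (\<lambda>z. \<bar>?h z\<bar> powr q) y"
      using Cons.prems A by (simp add: Av_absorb)
    then show ?thesis by (simp only: Av_add[OF A] Av_cmult[OF A]) (simp add: algebra_simps)
  qed
  also have "\<dots> \<le> Av A (\<lambda>z. \<bar>g z\<bar> powr q) y" using Cons by simp
  finally show ?case .
qed simp

text \<open>Relabelling also moves the fixed coordinates that are not averaged; locality shows that
  they have no influence.\<close>

definition local_on :: "nat set \<Rightarrow> ((nat \<Rightarrow> 'w) \<Rightarrow> real) \<Rightarrow> bool" where
  "local_on B F \<longleftrightarrow> (\<forall>z z'. (\<forall>i\<in>B. z i = z' i) \<longrightarrow> F z = F z')"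

lemma local_onD: "local_on B F \<Longrightarrow> (\<And>i. i \<in> B \<Longrightarrow> z i = z' i) \<Longrightarrow> F z = F z'"
  unfolding local_on_def by blast

lemma local_on_av:
  assumes F: "local_on B F" shows "local_on B (av j F)"
  unfolding local_on_def
proof (intro allI impI)
  fix z z' :: "nat \<Rightarrow> 'w" assume eq: "\<forall>i\<in>B. z i = z' i"
  have "F (z(j := w)) = F (z'(j := w))" for w by (rule local_onD[OF F]) (use eq in simp)
  then show "av j F z = av j F z'" by (simp add: av_def)
qed

lemma local_on_noise:
  assumes F: "local_on B F" shows "local_on B (noise \<rho> is F)"
proof (induction "is")
  case Nil
  show ?case unfolding noise_Nil by (rule F)
next
  case (Cons i js)
  show ?case
    unfolding local_on_def noise_Cons nz_def
  proof (intro allI impI)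
    fix z z' :: "nat \<Rightarrow> 'w" assume "\<forall>i\<in>B. z i = z' i"
    then have "noise \<rho> js F z = noise \<rho> js F z'" "av i (noise \<rho> js F) z = av i (noise \<rho> js F) z'"
      using Cons.IH local_on_av[OF Cons.IH, of i] unfolding local_on_def by blast+
    then show "\<rho> * noise \<rho> js F z + (1 - \<rho>) * av i (noise \<rho> js F) z
        = \<rho> * noise \<rho> js F z' + (1 - \<rho>) * av i (noise \<rho> js F) z'" by (simp only:)
  qed
qed

end

context coupling
begin

lemma noise_relabel:
  assumes ab: "\<alpha> \<in> G" "\<beta> \<in> G"
  shows "noise \<rho> is (\<lambda>z. F (relabel \<alpha> \<beta> \<circ> z)) y = noise \<rho> is F (relabel \<alpha> \<beta> \<circ> y)"
proof (induction "is" arbitrary: y)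
  case Nil
  show ?case unfolding noise_Nil ..
next
  case (Cons i js)
  have fin: "finite {i}" by simp
  have e: "noise \<rho> js (\<lambda>z. F (relabel \<alpha> \<beta> \<circ> z)) = (\<lambda>z. noise \<rho> js F (relabel \<alpha> \<beta> \<circ> z))"
    by (rule ext) (rule Cons.IH)
  have h: "av i (\<lambda>z. noise \<rho> js F (relabel \<alpha> \<beta> \<circ> z)) y = av i (noise \<rho> js F) (relabel \<alpha> \<beta> \<circ> y)"
    unfolding av_eq_Av by (rule Av_relabel[OF ab fin, where F = "noise \<rho> js F"])
  show ?case unfolding noise_Cons nz_def e h ..
qed

text \<open>A full average still takes a point as its argument. The functions concerned depend only
  on positions below \<open>N\<close>, so any valid point serves.\<close>

definition base :: "nat \<Rightarrow> nat \<times> nat" where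
  "base = (\<lambda>_. (1, 1))"

lemma base_valid: "base \<in> valid"
  unfolding valid_def base_def using n1 by (simp add: grid_def)

text \<open>The density of the law of \<sigma> given \<open>y\<close> against the uniform law;
  averaging it against a function of \<open>y\<close> gives the adjoint of \<open>C\<close>.\<close>

definition kern :: "(nat \<Rightarrow> nat \<times> nat) \<Rightarrow> (nat \<Rightarrow> nat) \<Rightarrow> real" where
  "kern y \<sigma> = fact n * of_bool (\<sigma> \<in> U (y ` kept y)) / fact (n - card (kept y))"

definition T_op :: "real \<Rightarrow> ((nat \<Rightarrow> nat) \<Rightarrow> real) \<Rightarrow> (nat \<Rightarrow> nat) \<Rightarrow> real" where
  "T_op \<rho> f \<sigma> = (if \<sigma> \<in> G then Av AA (\<lambda>y. kern y \<sigma> * noise \<rho> [0..<N] (C f) y) base else 0)"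

lemma set_idx: "set [0..<N] = AA"
  by auto

lemma kern_nonneg: "0 \<le> kern y \<sigma>"
  by (simp add: kern_def)

lemma sum_kern: "(\<Sum>\<sigma>\<in>G. kern y \<sigma> * h \<sigma>) = fact n * C h y"
proof -
  have "(\<Sum>\<sigma>\<in>G. kern y \<sigma> * h \<sigma>) = (\<Sum>\<sigma>\<in>G. fact n / fact (n - card (kept y)) * (of_bool (\<sigma> \<in> U (y ` kept y)) * h \<sigma>))"
    by (rule sum.cong[OF refl]) (simp only: kern_def times_divide_eq_left mult.assoc)
  also have "\<dots> = fact n / fact (n - card (kept y)) * s h (y ` kept y)"
    by (simp only: s_eq_sum_G sum_distrib_left)
  finally show ?thesis by (simp add: C_def)
qed

lemma sum_Av_kern:
  "(\<Sum>\<sigma>\<in>G. Av AA (\<lambda>y. kern y \<sigma> * g y) base * h \<sigma>) = fact n * Av AA (\<lambda>y. g y * C h y) base"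
proof -
  have "(\<Sum>\<sigma>\<in>G. Av AA (\<lambda>y. kern y \<sigma> * g y) base * h \<sigma>)
      = (\<Sum>\<sigma>\<in>G. Av AA (\<lambda>y. h \<sigma> * (kern y \<sigma> * g y)) base)"
    by (simp add: Av_cmult mult.commute)
  also have "\<dots> = Av AA (\<lambda>y. \<Sum>\<sigma>\<in>G. h \<sigma> * (kern y \<sigma> * g y)) base"
    by (rule Av_sum[symmetric]) auto
  also have "(\<lambda>y. \<Sum>\<sigma>\<in>G. h \<sigma> * (kern y \<sigma> * g y)) = (\<lambda>y. fact n * (g y * C h y))"
  proof
    fix y
    have "(\<Sum>\<sigma>\<in>G. h \<sigma> * (kern y \<sigma> * g y)) = g y * (\<Sum>\<sigma>\<in>G. kern y \<sigma> * h \<sigma>)"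
      by (simp add: sum_distrib_left mult_ac)
    then show "(\<Sum>\<sigma>\<in>G. h \<sigma> * (kern y \<sigma> * g y)) = fact n * (g y * C h y)"
      by (simp add: sum_kern)
  qed
  also have "Av AA (\<lambda>y. fact n * (g y * C h y)) base = fact n * Av AA (\<lambda>y. g y * C h y) base"
    by (rule Av_cmult) simp
  finally show ?thesis .
qed

lemma T_op_inner: "(\<Sum>\<sigma>\<in>G. T_op \<rho> f \<sigma> * h \<sigma>) = fact n * Av AA (\<lambda>y. noise \<rho> [0..<N] (C f) y * C h y) base"
  by (simp add: T_op_def sum_Av_kern)

lemma T_op_self_adjoint: "(\<Sum>\<sigma>\<in>G. T_op \<rho> f \<sigma> * h \<sigma>) = (\<Sum>\<sigma>\<in>G. f \<sigma> * T_op \<rho> h \<sigma>)"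
proof -
  have "Av AA (\<lambda>y. noise \<rho> [0..<N] (C f) y * C h y) base = Av AA (\<lambda>y. C f y * noise \<rho> [0..<N] (C h) y) base"
    by (rule noise_self_adjoint) auto
  also have "\<dots> = Av AA (\<lambda>y. noise \<rho> [0..<N] (C h) y * C f y) base" by (simp only: mult.commute)
  finally have "(\<Sum>\<sigma>\<in>G. T_op \<rho> f \<sigma> * h \<sigma>) = (\<Sum>\<sigma>\<in>G. T_op \<rho> h \<sigma> * f \<sigma>)" by (simp only: T_op_inner)
  then show ?thesis by (simp only: mult.commute)
qed

lemma C_lin: "C (\<lambda>\<sigma>. f \<sigma> + c * g \<sigma>) = (\<lambda>y. C f y + c * C g y)"
  by (rule ext) (simp add: C_def s_lin add_divide_distrib)

lemma T_op_lin: "T_op \<rho> (\<lambda>\<sigma>. f \<sigma> + c * g \<sigma>) = (\<lambda>\<sigma>. T_op \<rho> f \<sigma> + c * T_op \<rho> g \<sigma>)"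
proof
  fix \<sigma>
  have "(\<lambda>y. kern y \<sigma> * noise \<rho> [0..<N] (C (\<lambda>\<sigma>. f \<sigma> + c * g \<sigma>)) y)
      = (\<lambda>y. kern y \<sigma> * noise \<rho> [0..<N] (C f) y + c * (kern y \<sigma> * noise \<rho> [0..<N] (C g) y))"
    by (simp add: C_lin noise_add noise_cmult algebra_simps)
  then show "T_op \<rho> (\<lambda>\<sigma>. f \<sigma> + c * g \<sigma>) \<sigma> = T_op \<rho> f \<sigma> + c * T_op \<rho> g \<sigma>"
    by (simp add: T_op_def Av_add Av_cmult)
qed

lemma C_local:
  assumes "\<And>i. i \<in> AA \<Longrightarrow> z i = z' i" shows "C f z = C f z'" "kern z \<sigma> = kern z' \<sigma>"
proof -
  have k: "kept z = kept z'" by (rule kept_cong) (use assms in auto)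
  have "z ` kept z' = z' ` kept z'" by (rule image_cong[OF refl]) (use assms kept_sub[of z'] in auto)
  then show "C f z = C f z'" "kern z \<sigma> = kern z' \<sigma>" by (simp_all only: C_def kern_def k)
qed

lemma C_relabel:
  assumes ab: "\<alpha> \<in> G" "\<beta> \<in> G"
  shows "C (\<lambda>\<sigma>. f (\<beta> \<circ> \<sigma> \<circ> inv \<alpha>)) y = C f (relabel \<alpha> \<beta> \<circ> y)"
  by (simp only: C_def kept_relabel[OF ab] image_comp[symmetric] s_relabel[OF ab])

lemma kern_relabel:
  assumes ab: "\<alpha> \<in> G" "\<beta> \<in> G" and \<sigma>: "\<sigma> \<in> G"
  shows "kern (relabel \<alpha> \<beta> \<circ> y) (\<beta> \<circ> \<sigma> \<circ> inv \<alpha>) = kern y \<sigma>"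
  by (simp only: kern_def kept_relabel[OF ab] image_comp[symmetric] U_relabel[OF ab \<sigma>])

lemma Av_base_relabel:
  assumes ab: "\<alpha> \<in> G" "\<beta> \<in> G"
    and F: "\<And>z z'. (\<And>i. i \<in> AA \<Longrightarrow> z i = z' i) \<Longrightarrow> F z = F z'"
  shows "Av AA (\<lambda>z. F (relabel \<alpha> \<beta> \<circ> z)) base = Av AA F base"
proof -
  have "Av AA (\<lambda>z. F (relabel \<alpha> \<beta> \<circ> z)) base = Av AA F (relabel \<alpha> \<beta> \<circ> base)"
    by (rule Av_relabel[OF ab, where F = F]) simp
  also have "\<dots> = Av AA F base" by (rule Av_local[where B = AA]) (simp, rule F, simp_all)
  finally show ?thesis .
qed

lemma T_op_relabel:
  assumes ab: "\<alpha> \<in> G" "\<beta> \<in> G" and \<sigma>: "\<sigma> \<in> G"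
  shows "T_op \<rho> (\<lambda>\<sigma>. f (\<beta> \<circ> \<sigma> \<circ> inv \<alpha>)) \<sigma> = T_op \<rho> f (\<beta> \<circ> \<sigma> \<circ> inv \<alpha>)"
proof -
  have \<sigma>': "\<beta> \<circ> \<sigma> \<circ> inv \<alpha> \<in> G" using ab \<sigma> by (intro G_comp G_inv)
  define F where "F y = kern y (\<beta> \<circ> \<sigma> \<circ> inv \<alpha>) * noise \<rho> [0..<N] (C f) y" for y
  have "C (\<lambda>\<sigma>. f (\<beta> \<circ> \<sigma> \<circ> inv \<alpha>)) = (\<lambda>y. C f (relabel \<alpha> \<beta> \<circ> y))" by (rule ext) (rule C_relabel[OF ab])
  then have "T_op \<rho> (\<lambda>\<sigma>. f (\<beta> \<circ> \<sigma> \<circ> inv \<alpha>)) \<sigma> = Av AA (\<lambda>y. F (relabel \<alpha> \<beta> \<circ> y)) base"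
    using \<sigma> by (simp only: T_op_def F_def kern_relabel[OF ab \<sigma>] noise_relabel[OF ab] if_True)
  also have "\<dots> = Av AA F base"
  proof (rule Av_base_relabel[OF ab])
    fix z z' :: "nat \<Rightarrow> nat \<times> nat" assume zz: "\<And>i. i \<in> AA \<Longrightarrow> z i = z' i"
    have "local_on AA (C f)" unfolding local_on_def by (intro allI impI C_local(1)) blast
    then have "noise \<rho> [0..<N] (C f) z = noise \<rho> [0..<N] (C f) z'"
      by (rule local_onD[OF local_on_noise]) (rule zz)
    then show "F z = F z'" by (simp only: F_def C_local(2)[OF zz])
  qed
  also have "\<dots> = T_op \<rho> f (\<beta> \<circ> \<sigma> \<circ> inv \<alpha>)" using \<sigma>' by (simp add: T_op_def F_def[abs_def])
  finally show ?thesis .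
qed

text \<open>In other words, \<sigma> is uniform once \<open>y\<close> is averaged out. By
  relabelling, the density is the same at every permutation, and its sum is
  \<open>fact n\<close>.\<close>

lemma Av_kern:
  assumes \<sigma>: "\<sigma> \<in> G" shows "Av AA (\<lambda>y. kern y \<sigma>) base = 1"
proof -
  define c where "c \<sigma> = Av AA (\<lambda>y. kern y \<sigma>) base" for \<sigma>
  have eq: "c \<tau> = c id" if \<tau>: "\<tau> \<in> G" for \<tau>
  proof -
    have "kern (relabel id \<tau> \<circ> y) \<tau> = kern y id" for y
      using kern_relabel[OF G_id \<tau> G_id, of y] by simp
    then have "c id = Av AA (\<lambda>y. kern (relabel id \<tau> \<circ> y) \<tau>) base" by (simp only: c_def)
    also have "\<dots> = c \<tau>" unfolding c_def by (rule Av_base_relabel[OF G_id \<tau>]) (rule C_local(2))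
    finally show ?thesis by simp
  qed
  have "(\<Sum>\<tau>\<in>G. c \<tau>) = fact n * Av AA (C (\<lambda>_. 1)) base"
    using sum_Av_kern[of "\<lambda>_. 1" "\<lambda>_. 1"] by (simp add: c_def)
  also have "Av AA (C (\<lambda>_. 1)) base = Av AA (\<lambda>_. 1) base"
    by (rule Av_cong_valid[OF _ base_valid]) (simp_all add: C_one)
  finally have "(\<Sum>\<tau>\<in>G. c id) = fact n" by (simp add: eq)
  then have "c id = 1" by (simp add: card_G)
  then show ?thesis using eq[OF \<sigma>] by (simp add: c_def)
qed

lemma Av_C: "Av AA (C h) base = (\<Sum>\<sigma>\<in>G. h \<sigma>) / fact n"
  using sum_Av_kern[of "\<lambda>_. 1" h] by (simp add: Av_kern)

text \<open>By \<open>Av_kern\<close> the kernel is a probability density in \<open>y\<close> for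
  each \<sigma>, so Jensen applies; summing over \<sigma> returns the uniform law of
  \<open>y\<close>.\<close>

lemma T_op_Lq:
  assumes q: "q \<ge> 1"
  shows "(\<Sum>\<sigma>\<in>G. \<bar>T_op \<rho> f \<sigma>\<bar> powr q) \<le> fact n * Av AA (\<lambda>y. \<bar>noise \<rho> [0..<N] (C f) y\<bar> powr q) base"
proof -
  have "(\<Sum>\<sigma>\<in>G. \<bar>T_op \<rho> f \<sigma>\<bar> powr q) \<le> (\<Sum>\<sigma>\<in>G. Av AA (\<lambda>y. kern y \<sigma> * \<bar>noise \<rho> [0..<N] (C f) y\<bar> powr q) base * 1)"
  proof (rule sum_mono)
    fix \<sigma> assume \<sigma>: "\<sigma> \<in> G"
    show "\<bar>T_op \<rho> f \<sigma>\<bar> powr q \<le> Av AA (\<lambda>y. kern y \<sigma> * \<bar>noise \<rho> [0..<N] (C f) y\<bar> powr q) base * 1"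
      using Av_Jensen_powr[OF _ base_valid q kern_nonneg Av_kern[OF \<sigma>]] \<sigma> by (simp add: T_op_def)
  qed
  also have "\<dots> = fact n * Av AA (\<lambda>y. \<bar>noise \<rho> [0..<N] (C f) y\<bar> powr q * C (\<lambda>_. 1) y) base"
    by (rule sum_Av_kern)
  also have "Av AA (\<lambda>y. \<bar>noise \<rho> [0..<N] (C f) y\<bar> powr q * C (\<lambda>_. 1) y) base
      = Av AA (\<lambda>y. \<bar>noise \<rho> [0..<N] (C f) y\<bar> powr q) base"
    by (rule Av_cong_valid[OF _ base_valid]) (simp_all add: C_one)
  finally show ?thesis .
qed

lemma unif_expectation_eq:
  assumes "finite A" "A \<noteq> {}" shows "unif_expectation A f = (\<Sum>x\<in>A. f x) / real (card A)"
  using assms by (simp add: unif_expectation_def integral_pmf_of_set)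

lemma G_ne: "G \<noteq> {}"
  using G_id by blast

lemma sym_inner_eq: "sym_inner n f g = (\<Sum>\<sigma>\<in>G. f \<sigma> * g \<sigma>) / fact n"
  by (simp add: sym_inner_def unif_expectation_eq G_ne card_G)

lemma unif_norm_powr:
  assumes "finite A" "A \<noteq> {}" "q > 0"
  shows "unif_norm A q f powr q = (\<Sum>x\<in>A. \<bar>f x\<bar> powr q) / real (card A)"
proof -
  have "0 \<le> (\<Sum>x\<in>A. \<bar>f x\<bar> powr q) / real (card A)" by (simp add: sum_nonneg)
  then show ?thesis using assms(3) by (simp add: unif_norm_def unif_expectation_eq[OF assms(1,2)] powr_powr sum_nonneg)
qed

lemma unif_norm_2:
  assumes "finite A" "A \<noteq> {}"
  shows "(unif_norm A 2 f)\<^sup>2 = (\<Sum>x\<in>A. (f x)\<^sup>2) / real (card A)"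
proof -
  have "0 \<le> unif_norm A 2 f" by (simp add: unif_norm_def)
  then have "(unif_norm A 2 f)\<^sup>2 = unif_norm A 2 f powr 2" by simp
  then show ?thesis using unif_norm_powr[OF assms, of 2 f] by simp
qed

lemma sym_norm_2: "(sym_norm n 2 f)\<^sup>2 = (\<Sum>\<sigma>\<in>G. (f \<sigma>)\<^sup>2) / fact n"
  by (simp add: sym_norm_def unif_norm_2 G_ne card_G)

text \<open>The edges of \<open>M\<close>, listed in any order, form a pair of distinct tuples whose
  umvirate is \<open>U M\<close>. Clearing the denominator gives the comparison with the constant 1
  that \<open>Av_C_le\<close> asks for.\<close>

lemma global_edges:
  assumes glob: "is_global n r \<gamma> f" and M: "M \<subseteq> PP" "matching M"
  shows "s (\<lambda>\<sigma>. (f \<sigma>)\<^sup>2) M \<le> (r ^ card M * \<gamma>)\<^sup>2 * s (\<lambda>_. 1) M"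
proof -
  have finM: "finite M" by (rule finite_subset[OF M(1) finite_PP])
  obtain xs where xs: "set xs = M" "distinct xs" using finite_distinct_list[OF finM] by blast
  have len: "length xs = card M" using xs distinct_card by fastforce
  have sub: "fst ` M \<subseteq> {1..n}" "snd ` M \<subseteq> {1..n}" using M(1) by (auto simp: grid_def)
  have t: "map fst xs \<in> distinct_tuples n (card M)" "map snd xs \<in> distinct_tuples n (card M)"
    using xs len sub M(2) by (simp_all add: distinct_tuples_def distinct_map matching_def)
  have eq: "umvirate n (map fst xs) (map snd xs) = U M"
    by (simp add: umvirate_def U_def xs(1)[symmetric] all_set_conv_all_nth cong: conj_cong)
  have ne: "U M \<noteq> {}" by (rule U_nonempty[OF M(2,1)])
  have c: "real (card (U M)) > 0" using ne by (simp add: card_gt_0_iff)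
  have "unif_norm (U M) 2 f \<le> r ^ card M * \<gamma>"
    using glob t unfolding is_global_def eq[symmetric] by blast
  moreover have "0 \<le> unif_norm (U M) 2 f" by (simp add: unif_norm_def)
  ultimately have "(unif_norm (U M) 2 f)\<^sup>2 \<le> (r ^ card M * \<gamma>)\<^sup>2" by (intro power_mono)
  then show ?thesis using c by (simp add: unif_norm_2[OF finite_U ne] s_def divide_le_eq mult.commute)
qed

theorem T_op_hypercontractive:
  assumes \<rho>: "0 < \<rho>" "\<rho> < 1" and r: "r > 0" and \<gamma>: "\<gamma> > 0" and glob: "is_global n r \<gamma> f"
    and q: "q \<ge> 2" and \<rho>q: "\<rho> \<le> ln q / (16 * r * q)"
  shows "sym_norm n q (T_op (\<rho> / 2) f) powr q \<le> \<gamma> powr (q - 2) * (sym_norm n 2 f)\<^sup>2"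
proof -
  let ?h = "noise (\<rho> / 2) [0..<N] (C f)"
  have q1: "q \<ge> 1" "q > 0" using q by auto
  have Cf: "Av AA (\<lambda>y. (C f y)\<^sup>2) base \<le> (sym_norm n 2 f)\<^sup>2"
  proof -
    have "Av AA (\<lambda>y. (C f y)\<^sup>2) base \<le> Av AA (C (\<lambda>\<sigma>. (f \<sigma>)\<^sup>2)) base"
      by (rule Av_mono_valid[OF _ base_valid]) (simp_all add: C_square_le)
    then show ?thesis by (simp only: Av_C sym_norm_2)
  qed
  have "Av AA (\<lambda>y. \<bar>?h y\<bar> powr q) base \<le> \<gamma> powr (q - 2) * Av AA (\<lambda>y. (C f y)\<^sup>2) base"
  proof (cases "r \<ge> 1")
    case True
    have "\<rho> * r \<le> ln q / (16 * r * q) * r" using \<rho>q r by (intro mult_right_mono) auto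
    then have "\<rho> * r \<le> ln q / (16 * q)" using r by simp
    \<comment> \<open>Here the halved rate pays for the derivatives: 1 + r \<le> 2 r since r \<ge>
      1.\<close>
    moreover have "\<rho> / 2 * (1 + r) \<le> \<rho> * r"
    proof -
      have "\<rho> / 2 * (1 + r) \<le> \<rho> / 2 * (2 * r)" using True \<rho> by (intro mult_left_mono) auto
      then show ?thesis by simp
    qed
    ultimately have \<rho>': "\<rho> / 2 * (1 + r) \<le> ln q / (16 * q)" by simp
    have "Av (set [0..<N]) (\<lambda>z. \<bar>?h z\<bar> powr q) base
        \<le> \<gamma> powr (q - 2) * Av (set [0..<N]) (\<lambda>z. (C f z)\<^sup>2) base"
    proof (rule noise_hypercontractive[OF q True _ \<rho>' _ \<gamma> base_valid])
      fix S and y :: "nat \<Rightarrow> nat \<times> nat" assume "S \<subseteq> set [0..<N]" and yv: "y \<in> valid"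
      then have S: "S \<subseteq> AA" by (simp only: set_idx)
      have "Av (AA - S) (\<lambda>z. (C f z)\<^sup>2) y \<le> Av (AA - S) (C (\<lambda>\<sigma>. (f \<sigma>)\<^sup>2)) y"
        by (rule Av_mono_valid[OF _ yv]) (simp_all add: C_square_le)
      also have "\<dots> \<le> (r ^ card S * \<gamma>)\<^sup>2"
      proof (rule Av_C_le[OF S yv])
        fix M assume M: "M \<subseteq> PP" "matching M" "card M \<le> card S"
        have "s (\<lambda>\<sigma>. (f \<sigma>)\<^sup>2) M \<le> (r ^ card M * \<gamma>)\<^sup>2 * s (\<lambda>_. 1) M" by (rule global_edges[OF glob M(1,2)])
        also have "\<dots> \<le> (r ^ card S * \<gamma>)\<^sup>2 * s (\<lambda>_. 1) M"
        proof (intro mult_right_mono power_mono)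
          show "r ^ card M \<le> r ^ card S" by (rule power_increasing[OF M(3) True])
        qed (use r \<gamma> in \<open>auto simp: s_def\<close>)
        finally show "s (\<lambda>\<sigma>. (f \<sigma>)\<^sup>2) M \<le> (r ^ card S * \<gamma>)\<^sup>2 * s (\<lambda>_. 1) M" .
      qed
      finally show "Av (set [0..<N] - S) (\<lambda>z. (C f z)\<^sup>2) y \<le> (r ^ card S * \<gamma>)\<^sup>2" by (simp only: set_idx)
    qed (use \<rho> in auto)
    then show ?thesis by (simp only: set_idx)
  next
    case False
    \<comment> \<open>Restricting to the whole graph of \<sigma> isolates one value of
      \<open>f\<close>, so globalness with r < 1 bounds |f| by \<gamma> everywhere.\<close>
    have f\<gamma>: "(f \<sigma>)\<^sup>2 \<le> \<gamma>\<^sup>2" if \<sigma>: "\<sigma> \<in> G" for \<sigma>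
    proof -
      have M: "graph \<sigma> \<subseteq> PP" using G_mem[OF \<sigma>] by (auto simp: graph_def grid_def simp del: atLeastAtMost_iff)
      have in_U: "\<sigma> \<in> U (graph \<sigma>)" using \<sigma> by (auto simp: U_def graph_def)
      then have m: "matching (graph \<sigma>)" by (intro matching_if_U) blast
      have "card (graph \<sigma>) = n" unfolding graph_def by (subst card_image) (auto simp: inj_on_def)
      then have "card (U (graph \<sigma>)) = 1" using card_U[OF m M] by simp
      then have "U (graph \<sigma>) = {\<sigma>}" using in_U by (auto simp: card_1_singleton_iff)
      then have "(f \<sigma>)\<^sup>2 \<le> (r ^ n * \<gamma>)\<^sup>2"
        using global_edges[OF glob M m] \<open>card (graph \<sigma>) = n\<close> by (simp add: s_def)
      also have "\<dots> \<le> (1 * \<gamma>)\<^sup>2" using False r \<gamma> by (intro power_mono mult_right_mono power_le_one) auto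
      finally show ?thesis by simp
    qed
    have C\<gamma>: "\<bar>C f y\<bar> \<le> \<gamma>" if yv: "y \<in> valid" for y
    proof -
      have "C (\<lambda>\<sigma>. (f \<sigma>)\<^sup>2) y \<le> C (\<lambda>_. \<gamma>\<^sup>2 * 1) y"
        unfolding C_def s_def by (intro divide_right_mono sum_mono) (auto simp: U_def f\<gamma>)
      also have "\<dots> = \<gamma>\<^sup>2 * C (\<lambda>_. 1) y" by (simp add: C_def s_def)
      finally have "(C f y)\<^sup>2 \<le> \<gamma>\<^sup>2" using C_square_le[OF yv, of f] C_one[OF yv] by simp
      then show ?thesis using \<gamma> by (metis abs_le_square_iff abs_of_pos)
    qed
    have "Av AA (\<lambda>y. \<bar>?h y\<bar> powr q) base \<le> Av AA (\<lambda>y. \<bar>C f y\<bar> powr q) base"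
      by (rule noise_Lq_contraction[OF _ _ _ q1(1) base_valid]) (use \<rho> in auto)
    also have "\<dots> \<le> Av AA (\<lambda>y. \<gamma> powr (q - 2) * (C f y)\<^sup>2) base"
    proof (rule Av_mono_valid[OF _ base_valid])
      fix y :: "nat \<Rightarrow> nat \<times> nat" assume yv: "y \<in> valid"
      show "\<bar>C f y\<bar> powr q \<le> \<gamma> powr (q - 2) * (C f y)\<^sup>2"
      proof (cases "C f y = 0")
        case False
        then have "\<bar>C f y\<bar> powr q = \<bar>C f y\<bar> powr (q - 2) * (C f y)\<^sup>2" by (simp add: powr_diff)
        also have "\<dots> \<le> \<gamma> powr (q - 2) * (C f y)\<^sup>2"
          using C\<gamma>[OF yv] q by (intro mult_right_mono powr_mono2) auto
        finally show ?thesis .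
      qed (use q in auto)
    qed simp
    also have "\<dots> = \<gamma> powr (q - 2) * Av AA (\<lambda>y. (C f y)\<^sup>2) base" by (rule Av_cmult) simp
    finally show ?thesis .
  qed
  also have "\<dots> \<le> \<gamma> powr (q - 2) * (sym_norm n 2 f)\<^sup>2" using Cf by (intro mult_left_mono) auto
  finally have "Av AA (\<lambda>y. \<bar>?h y\<bar> powr q) base \<le> \<gamma> powr (q - 2) * (sym_norm n 2 f)\<^sup>2" .
  moreover have "sym_norm n q (T_op (\<rho> / 2) f) powr q \<le> Av AA (\<lambda>y. \<bar>?h y\<bar> powr q) base"
    using T_op_Lq[OF q1(1), of "\<rho> / 2" f] q1 unfolding sym_norm_def
    by (simp add: unif_norm_powr G_ne card_G divide_le_eq mult.commute)
  ultimately show ?thesis by simp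
qed

lemma T_op_zero: "T_op \<rho> (\<lambda>_. 0) = (\<lambda>_. 0)"
  using T_op_lin[of \<rho> "\<lambda>_. 0" "-1" "\<lambda>_. 0"] by (simp add: fun_eq_iff)

lemma T_op_linear: "linear_operator_L2 n (T_op \<rho>)"
  unfolding linear_operator_L2_def
proof (intro conjI ballI allI)
  show "T_op \<rho> \<in> L2_sym n \<rightarrow> L2_sym n" by (simp add: L2_sym_def T_op_def)
  show "T_op \<rho> (\<lambda>\<sigma>. f \<sigma> + g \<sigma>) = (\<lambda>\<sigma>. T_op \<rho> f \<sigma> + T_op \<rho> g \<sigma>)" for f g
    using T_op_lin[of \<rho> f 1 g] by simp
  show "T_op \<rho> (\<lambda>\<sigma>. a * f \<sigma>) = (\<lambda>\<sigma>. a * T_op \<rho> f \<sigma>)" for a f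
    using T_op_lin[of \<rho> "\<lambda>_. 0" a f] by (simp add: T_op_zero)
qed

lemma T_op_self_adjoint_L2: "self_adjoint_L2 n (T_op \<rho>)"
  unfolding self_adjoint_L2_def sym_inner_eq T_op_self_adjoint by simp

lemma T_op_left:
  assumes \<sigma>: "\<sigma> \<in> G" shows "T_op \<rho> (left_act \<sigma> f) = left_act \<sigma> (T_op \<rho> f)"
proof
  fix x
  show "T_op \<rho> (left_act \<sigma> f) x = left_act \<sigma> (T_op \<rho> f) x"
  proof (cases "x \<in> G")
    case True
    then show ?thesis using T_op_relabel[OF G_id G_inv[OF \<sigma>] True, of \<rho> f] by (simp add: left_act_def)
  next
    case False
    have "inv \<sigma> \<circ> x \<notin> G"
    proof
      assume "inv \<sigma> \<circ> x \<in> G"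
      then have "\<sigma> \<circ> (inv \<sigma> \<circ> x) \<in> G" by (rule G_comp[OF \<sigma>])
      moreover have "\<sigma> \<circ> (inv \<sigma> \<circ> x) = x" by (auto simp: G_inv_simps[OF \<sigma>])
      ultimately show False using False by simp
    qed
    then show ?thesis using False by (simp add: left_act_def T_op_def)
  qed
qed

lemma T_op_right:
  assumes \<sigma>: "\<sigma> \<in> G" shows "T_op \<rho> (right_act \<sigma> f) = right_act \<sigma> (T_op \<rho> f)"
proof
  fix x
  have inv2: "inv (inv \<sigma>) = \<sigma>" using \<sigma> by (simp add: sym_grp_def inv_inv_eq permutes_bij)
  show "T_op \<rho> (right_act \<sigma> f) x = right_act \<sigma> (T_op \<rho> f) x"
  proof (cases "x \<in> G")
    case True
    then show ?thesis using T_op_relabel[OF G_inv[OF \<sigma>] G_id True, of \<rho> f] by (simp add: right_act_def inv2)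
  next
    case False
    have "x \<circ> \<sigma> \<notin> G"
    proof
      assume "x \<circ> \<sigma> \<in> G"
      then have "(x \<circ> \<sigma>) \<circ> inv \<sigma> \<in> G" by (rule G_comp[OF _ G_inv[OF \<sigma>]])
      moreover have "(x \<circ> \<sigma>) \<circ> inv \<sigma> = x" by (auto simp: G_inv_simps[OF \<sigma>])
      ultimately show False using False by simp
    qed
    then show ?thesis using False by (simp add: right_act_def T_op_def)
  qed
qed

lemma T_op_commutes: "commutes_with_actions n (T_op \<rho>)"
  unfolding commutes_with_actions_def by (simp add: T_op_left T_op_right)

end

section \<open>Numerical estimates and the lower bound\<close>

lemma fact_add_ge: "fact j * real j ^ k \<le> fact (j + k)"
proof (induction k)
  case (Suc k)
  have "fact j * real j ^ Suc k = real j * (fact j * real j ^ k)" by simp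
  also have "\<dots> \<le> real (Suc (j + k)) * fact (j + k)" by (rule mult_mono[OF _ Suc.IH]) auto
  finally show ?case by (simp only: add_Suc_right fact_Suc of_nat_mult)
qed simp

lemma fact_ge: "k \<le> m \<Longrightarrow> fact (m - k) * real (m - k) ^ k \<le> fact m"
  using fact_add_ge[of "m - k" k] by simp

text \<open>A reversed Bernoulli inequality, bought with the factor 2: for t = 1/n the product of
  \<open>(1 - 2 * t) ^ e\<close> and \<open>(1 + 2 * t) ^ e\<close> is at most 1, and Bernoulli
  bounds the second factor below. It makes the survival probability exponential in
  \<open>e\<close>.\<close>

lemma one_minus_ge_power:
  assumes "2 * e \<le> n" "n \<ge> 2"
  shows "(1 - 2 / real n) ^ e \<le> 1 - real e / real n"
proof -
  define t where "t = 1 / real n"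
  have t: "0 < t" "2 * t \<le> 1" "2 * real e * t \<le> 1"
    using assms by (auto simp: t_def field_simps)
  have b: "1 + real e * (2 * t) \<le> (1 + 2 * t) ^ e" using t by (intro Bernoulli_inequality) auto
  have "(1 - 2 * t) ^ e * (1 + real e * (2 * t)) \<le> (1 - 2 * t) ^ e * (1 + 2 * t) ^ e"
    using t b by (intro mult_left_mono) auto
  also have "\<dots> = ((1 - 2 * t) * (1 + 2 * t)) ^ e" by (rule power_mult_distrib[symmetric])
  also have "\<dots> \<le> 1"
    using t mult_mono[of "2 * t" 1 "2 * t" 1] by (intro power_le_one) (auto simp: algebra_simps)
  also have "1 \<le> (1 - real e * t) * (1 + real e * (2 * t))"
  proof -
    have "0 \<le> real e * t * (1 - 2 * real e * t)" using t by (intro mult_nonneg_nonneg) auto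
    then show ?thesis by (simp add: algebra_simps)
  qed
  finally have "(1 - 2 * t) ^ e * (1 + real e * (2 * t)) \<le> (1 - real e * t) * (1 + real e * (2 * t))" .
  moreover have "0 < 1 + real e * (2 * t)" using t by (intro add_pos_nonneg) auto
  ultimately show ?thesis by (simp add: t_def mult_le_cancel_right)
qed

context coupling
begin

text \<open>All losses together: \<open>fact n\<close> from \<open>T_op_inner\<close>, the binomial
  coefficient from the choice of \<open>S\<close>, the square from \<open>level_lower_bound\<close>,
  \<open>fact d\<close> and the power of n from \<open>Av_image_edges\<close>, and
  \<open>fact (n - d)\<close> from \<open>pure_edge_mass\<close>.\<close>

definition mass :: "nat \<Rightarrow> real" where
  "mass d = fact n * real (N choose d) * (keep_prob d / fact (n - d))\<^sup>2 * fact d * fact (n - d) / (real n ^ 2) ^ d"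

text \<open>By the semigroup law the quadratic form at rate \<rho> is a squared norm at rate sqrt
  \<rho>. Levels below \<open>d\<close> vanish by \<open>Av_C_zero\<close>, and level
  \<open>d\<close> is bounded below by the same amount for every \<open>S\<close>.\<close>

lemma T_op_pure_lower:
  assumes f: "f \<in> pure d" and d: "2 * d \<le> n" and \<rho>: "0 \<le> \<rho>"
  shows "mass d * \<rho> ^ d * (\<Sum>\<sigma>\<in>G. (f \<sigma>)\<^sup>2) \<le> (\<Sum>\<sigma>\<in>G. T_op \<rho> f \<sigma> * f \<sigma>)"
proof -
  define F \<tau> where "F = (\<Sum>\<sigma>\<in>G. (f \<sigma>)\<^sup>2)" and "\<tau> = sqrt \<rho>"
  have \<tau>: "0 \<le> \<tau>" "\<tau> * \<tau> = \<rho>" using \<rho> by (simp_all add: \<tau>_def)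
  have \<tau>d: "\<tau> ^ (2 * d) = \<rho> ^ d" using \<tau>(2) by (simp add: power_mult power2_eq_square)
  have zero: "s f M = 0" if "M \<subseteq> PP" "card M < d" for M using f that by (simp add: pure_def)
  define b where "b = fact d * (fact (n - d) * F) / (real n ^ 2) ^ d"
  have lev: "(keep_prob d / fact (n - d))\<^sup>2 * b \<le> Av AA (\<lambda>y. (Av (AA - S) (C f) y)\<^sup>2) base"
    if S: "S \<subseteq> AA" "card S = d" for S
  proof -
    have "b \<le> fact d * (\<Sum>M\<in>edges d. (s f M)\<^sup>2) / (real n ^ 2) ^ d"
      unfolding b_def F_def by (intro divide_right_mono mult_left_mono pure_edge_mass[OF d f]) auto
    also have "\<dots> = Av AA (\<lambda>y. (s f (y ` S))\<^sup>2) base"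
      by (rule Av_image_edges[OF _ S, symmetric]) (simp_all add: zero)
    finally have "(keep_prob d / fact (n - d))\<^sup>2 * b \<le> (keep_prob d / fact (n - d))\<^sup>2 * Av AA (\<lambda>y. (s f (y ` S))\<^sup>2) base"
      by (intro mult_left_mono) auto
    also have "\<dots> \<le> Av AA (\<lambda>y. (Av (AA - S) (C f) y)\<^sup>2) base"
      by (rule level_lower_bound[OF S base_valid zero])
    finally show ?thesis .
  qed
  have "card {S. S \<subseteq> AA \<and> card S = d} = N choose d" by (simp add: n_subsets)
  then have "real (N choose d) * ((keep_prob d / fact (n - d))\<^sup>2 * b)
      = (\<Sum>S | S \<subseteq> AA \<and> card S = d. (keep_prob d / fact (n - d))\<^sup>2 * b)" by simp
  also have "\<dots> \<le> (\<Sum>S | S \<subseteq> AA \<and> card S = d. Av AA (\<lambda>y. (Av (AA - S) (C f) y)\<^sup>2) base)"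
    by (rule sum_mono) (simp add: lev)
  finally have 1: "real (N choose d) * ((keep_prob d / fact (n - d))\<^sup>2 * b)
      \<le> (\<Sum>S | S \<subseteq> AA \<and> card S = d. Av AA (\<lambda>y. (Av (AA - S) (C f) y)\<^sup>2) base)" .
  have 2: "\<tau> ^ (2 * d) * (\<Sum>S | S \<subseteq> set [0..<N] \<and> card S = d. Av (set [0..<N]) (\<lambda>y. (Av (set [0..<N] - S) (C f) y)\<^sup>2) base)
      \<le> Av (set [0..<N]) (\<lambda>y. (noise \<tau> [0..<N] (C f) y)\<^sup>2) base"
  proof (rule noise_lower_bound[OF _ base_valid \<tau>(1)])
    fix S and y :: "nat \<Rightarrow> nat \<times> nat" assume S: "S \<subseteq> set [0..<N]" "card S < d" and y: "y \<in> valid"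
    show "Av (set [0..<N] - S) (C f) y = 0"
      unfolding set_idx by (rule Av_C_zero[OF _ y]) (use S zero in \<open>auto simp: set_idx\<close>)
  qed simp
  have "\<rho> ^ d * (real (N choose d) * ((keep_prob d / fact (n - d))\<^sup>2 * b))
      \<le> \<rho> ^ d * (\<Sum>S | S \<subseteq> AA \<and> card S = d. Av AA (\<lambda>y. (Av (AA - S) (C f) y)\<^sup>2) base)"
    using 1 \<rho> by (intro mult_left_mono) auto
  also have "\<dots> \<le> Av AA (\<lambda>y. (noise \<tau> [0..<N] (C f) y)\<^sup>2) base"
    using 2 by (simp only: set_idx \<tau>d)
  also have "\<dots> = Av AA (\<lambda>y. noise \<tau> [0..<N] (noise \<tau> [0..<N] (C f)) y * C f y) base"
    unfolding power2_eq_square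
    by (rule noise_self_adjoint[symmetric]) (simp_all only: set_idx finite_lessThan order_refl)
  also have "\<dots> = Av AA (\<lambda>y. noise \<rho> [0..<N] (C f) y * C f y) base"
    by (simp only: noise_mult \<tau>(2))
  finally have "fact n * (\<rho> ^ d * (real (N choose d) * ((keep_prob d / fact (n - d))\<^sup>2 * b)))
      \<le> (\<Sum>\<sigma>\<in>G. T_op \<rho> f \<sigma> * f \<sigma>)"
    by (simp only: T_op_inner) (rule mult_left_mono, auto)
  moreover have "fact n * (\<rho> ^ d * (real (N choose d) * ((keep_prob d / fact (n - d))\<^sup>2 * b))) = mass d * \<rho> ^ d * F"
    by (simp add: mass_def b_def mult_ac)
  ultimately show ?thesis by (simp only: F_def)
qed

lemma T_op_sum:
  assumes "finite I"
  shows "T_op \<rho> (\<lambda>\<sigma>. \<Sum>i\<in>I. c i * h i \<sigma>) = (\<lambda>\<sigma>. \<Sum>i\<in>I. c i * T_op \<rho> (h i) \<sigma>)"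
  using assms
proof (induction I rule: finite_induct)
  case (insert i I)
  have "T_op \<rho> (\<lambda>\<sigma>. (\<Sum>i\<in>I. c i * h i \<sigma>) + c i * h i \<sigma>) = (\<lambda>\<sigma>. (\<Sum>i\<in>I. c i * T_op \<rho> (h i) \<sigma>) + c i * T_op \<rho> (h i) \<sigma>)"
    by (simp only: T_op_lin insert.IH)
  then show ?case using insert.hyps by (simp add: add.commute)
qed (simp add: T_op_zero)

text \<open>As \<open>T_op\<close> commutes with the left action, its matrix \<open>k\<close> in the
  basis of point masses is left-invariant, and \<open>s_kernel_zero\<close> applies.\<close>

lemma T_op_pure_zero:
  assumes f: "f \<in> pure d" and M: "M \<subseteq> PP" "card M < d"
  shows "s (T_op \<rho> f) M = 0"
proof -
  define \<delta> :: "(nat \<Rightarrow> nat) \<Rightarrow> (nat \<Rightarrow> nat) \<Rightarrow> real" where "\<delta> \<tau> x = of_bool (x = \<tau>)" for \<tau> x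
  define k where "k \<tau> = T_op \<rho> (\<delta> \<tau>)" for \<tau>
  have fW: "f \<in> W d" using f by (simp add: pure_def)
  show ?thesis
  proof (rule s_kernel_zero[where k = k and f = f and d = d])
    fix \<omega> \<tau> \<sigma> assume G: "\<omega> \<in> G" "\<tau> \<in> G" "\<sigma> \<in> G"
    have "inv \<omega> \<circ> x = \<tau> \<longleftrightarrow> x = \<omega> \<circ> \<tau>" for x
    proof
      assume "inv \<omega> \<circ> x = \<tau>"
      then have "\<omega> \<circ> \<tau> = \<omega> \<circ> (inv \<omega> \<circ> x)" by simp
      also have "\<dots> = x" by (auto simp: G_inv_simps[OF G(1)])
      finally show "x = \<omega> \<circ> \<tau>" by simp
    next
      assume "x = \<omega> \<circ> \<tau>"
      then show "inv \<omega> \<circ> x = \<tau>" by (auto simp: G_inv_simps[OF G(1)])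
    qed
    then have "\<delta> (\<omega> \<circ> \<tau>) = left_act \<omega> (\<delta> \<tau>)" by (auto simp: \<delta>_def left_act_def fun_eq_iff[where f = "\<delta> _"])
    then have "k (\<omega> \<circ> \<tau>) (\<omega> \<circ> \<sigma>) = left_act \<omega> (T_op \<rho> (\<delta> \<tau>)) (\<omega> \<circ> \<sigma>)"
      by (simp only: k_def T_op_left[OF G(1)])
    moreover have "inv \<omega> \<circ> (\<omega> \<circ> \<sigma>) = \<sigma>" by (auto simp: G_inv_simps[OF G(1)])
    ultimately show "k (\<omega> \<circ> \<tau>) (\<omega> \<circ> \<sigma>) = k \<tau> \<sigma>" by (simp only: k_def left_act_def)
  next
    fix \<sigma> assume "\<sigma> \<in> G"
    have "f x = (\<Sum>\<tau>\<in>G. f \<tau> * \<delta> \<tau> x)" for x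
    proof -
      have "(\<Sum>\<tau>\<in>G. f \<tau> * \<delta> \<tau> x) = (\<Sum>\<tau>\<in>G. if x = \<tau> then f \<tau> else 0)"
        by (rule sum.cong) (auto simp: \<delta>_def)
      then show ?thesis using W_supp[OF fW, of x] by (simp add: sum.delta')
    qed
    then have "f = (\<lambda>x. \<Sum>\<tau>\<in>G. f \<tau> * \<delta> \<tau> x)" by (rule ext)
    then have "T_op \<rho> f = T_op \<rho> (\<lambda>x. \<Sum>\<tau>\<in>G. f \<tau> * \<delta> \<tau> x)" by (rule arg_cong)
    then show "T_op \<rho> f \<sigma> = (\<Sum>\<tau>\<in>G. f \<tau> * k \<tau> \<sigma>)" by (simp only: T_op_sum[OF finite_G] k_def)
  next
    show "s f M = 0" if "M \<subseteq> PP" "card M < d" for M using f that by (simp add: pure_def)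
  qed (fact M)+
qed

text \<open>The induction splits off the part orthogonal to lower degrees.
  \<open>T_op_pure_zero\<close> and self-adjointness remove the cross terms, and b \<le> 1 lets the
  remainder use its better bound \<open>b ^ d\<close>.\<close>

theorem T_op_lower_bound:
  assumes D: "2 * D \<le> n" and \<rho>: "0 \<le> \<rho>" and b: "0 \<le> b" "b \<le> 1"
    and mass: "\<And>e. e \<le> D \<Longrightarrow> b ^ e \<le> mass e * \<rho> ^ e"
  shows "d \<le> D \<Longrightarrow> f \<in> W d \<Longrightarrow> b ^ d * (\<Sum>\<sigma>\<in>G. (f \<sigma>)\<^sup>2) \<le> (\<Sum>\<sigma>\<in>G. T_op \<rho> f \<sigma> * f \<sigma>)"
proof (induction d arbitrary: f)
  case 0
  have "f \<in> pure 0" using 0 by (simp add: pure_def)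
  have "b ^ 0 * (\<Sum>\<sigma>\<in>G. (f \<sigma>)\<^sup>2) \<le> mass 0 * \<rho> ^ 0 * (\<Sum>\<sigma>\<in>G. (f \<sigma>)\<^sup>2)"
    by (intro mult_right_mono mass sum_nonneg) auto
  also have "\<dots> \<le> (\<Sum>\<sigma>\<in>G. T_op \<rho> f \<sigma> * f \<sigma>)" by (rule T_op_pure_lower[OF \<open>f \<in> pure 0\<close> _ \<rho>]) simp
  finally show ?case .
next
  case (Suc d)
  obtain p g where p: "p \<in> W d" and g: "g \<in> pure (Suc d)" and f: "f = (\<lambda>\<sigma>. g \<sigma> + p \<sigma>)"
    using W_Suc_decompose[OF Suc.prems(2)] by blast
  have gp: "(\<Sum>\<sigma>\<in>G. g \<sigma> * p \<sigma>) = 0"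
    by (rule W_inner[OF p]) (use g in \<open>simp add: pure_def\<close>)
  have Tgp: "(\<Sum>\<sigma>\<in>G. T_op \<rho> g \<sigma> * p \<sigma>) = 0"
    by (rule W_inner[OF p]) (rule T_op_pure_zero[OF g], auto)
  have Tpg: "(\<Sum>\<sigma>\<in>G. T_op \<rho> p \<sigma> * g \<sigma>) = 0"
  proof -
    have "(\<Sum>\<sigma>\<in>G. T_op \<rho> p \<sigma> * g \<sigma>) = (\<Sum>\<sigma>\<in>G. p \<sigma> * T_op \<rho> g \<sigma>)" by (rule T_op_self_adjoint)
    also have "\<dots> = (\<Sum>\<sigma>\<in>G. T_op \<rho> g \<sigma> * p \<sigma>)" by (simp only: mult.commute)
    finally show ?thesis by (simp only: Tgp)
  qed
  have "T_op \<rho> f = (\<lambda>\<sigma>. T_op \<rho> g \<sigma> + T_op \<rho> p \<sigma>)" using T_op_lin[of \<rho> g 1 p] by (simp add: f)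
  then have "(\<Sum>\<sigma>\<in>G. T_op \<rho> f \<sigma> * f \<sigma>) = (\<Sum>\<sigma>\<in>G. T_op \<rho> g \<sigma> * g \<sigma>) + (\<Sum>\<sigma>\<in>G. T_op \<rho> g \<sigma> * p \<sigma>)
      + (\<Sum>\<sigma>\<in>G. T_op \<rho> p \<sigma> * g \<sigma>) + (\<Sum>\<sigma>\<in>G. T_op \<rho> p \<sigma> * p \<sigma>)"
    by (simp add: f sum.distrib[symmetric] algebra_simps)
  then have T: "(\<Sum>\<sigma>\<in>G. T_op \<rho> f \<sigma> * f \<sigma>) = (\<Sum>\<sigma>\<in>G. T_op \<rho> g \<sigma> * g \<sigma>) + (\<Sum>\<sigma>\<in>G. T_op \<rho> p \<sigma> * p \<sigma>)"
    by (simp only: Tgp Tpg add_0_right)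
  have "(\<Sum>\<sigma>\<in>G. (f \<sigma>)\<^sup>2) = (\<Sum>\<sigma>\<in>G. (g \<sigma>)\<^sup>2) + 2 * (\<Sum>\<sigma>\<in>G. g \<sigma> * p \<sigma>) + (\<Sum>\<sigma>\<in>G. (p \<sigma>)\<^sup>2)"
    by (simp add: f power2_eq_square sum.distrib[symmetric] sum_distrib_left algebra_simps)
  then have F: "(\<Sum>\<sigma>\<in>G. (f \<sigma>)\<^sup>2) = (\<Sum>\<sigma>\<in>G. (g \<sigma>)\<^sup>2) + (\<Sum>\<sigma>\<in>G. (p \<sigma>)\<^sup>2)" by (simp add: gp)
  have "b ^ Suc d * (\<Sum>\<sigma>\<in>G. (g \<sigma>)\<^sup>2) \<le> mass (Suc d) * \<rho> ^ Suc d * (\<Sum>\<sigma>\<in>G. (g \<sigma>)\<^sup>2)"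
    by (intro mult_right_mono mass sum_nonneg Suc.prems(1)) auto
  also have "\<dots> \<le> (\<Sum>\<sigma>\<in>G. T_op \<rho> g \<sigma> * g \<sigma>)"
    by (rule T_op_pure_lower[OF g _ \<rho>]) (rule order_trans[OF mult_le_mono2[OF Suc.prems(1)] D])
  finally have 1: "b ^ Suc d * (\<Sum>\<sigma>\<in>G. (g \<sigma>)\<^sup>2) \<le> (\<Sum>\<sigma>\<in>G. T_op \<rho> g \<sigma> * g \<sigma>)" .
  have "b ^ Suc d * (\<Sum>\<sigma>\<in>G. (p \<sigma>)\<^sup>2) \<le> b ^ d * (\<Sum>\<sigma>\<in>G. (p \<sigma>)\<^sup>2)"
    using b by (intro mult_right_mono power_decreasing sum_nonneg) auto
  also have "\<dots> \<le> (\<Sum>\<sigma>\<in>G. T_op \<rho> p \<sigma> * p \<sigma>)" using Suc.prems(1) by (intro Suc.IH p) simp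
  finally show ?case using 1 by (simp only: T F distrib_left)
qed

lemma mass_lower_bound:
  assumes N: "N = n div 16" and e: "real e \<le> real n / 10 ^ 5"
  shows "(1 / 36) ^ e \<le> mass e"
proof (cases "e = 0")
  case True
  then show ?thesis using n1 by (simp add: mass_def keep_prob_def power2_eq_square)
next
  \<comment> \<open>A positive degree forces n \<ge> 100000, which makes the rounding in
    \<open>n div 16\<close> negligible.\<close>
  case False
  then have n5: "real n \<ge> 100000" using e by (simp add: field_simps)
  have e1: "real e * 100000 \<le> real n" using e by (simp add: field_simps)
  have "real (n div 16) \<ge> real n / 16 - 1" by linarith
  then have N1: "real N \<ge> real n / 16 - 1" by (simp only: N)
  have N16: "16 * real N \<le> real n" unfolding N by linarith
  have e2: "2 * real e \<le> real n" using e1 by simp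
  have en2: "2 * e \<le> n" using e2 by linarith
  have n2: "2 \<le> n" using n5 by simp
  have en: "e \<le> n" "2 * e \<le> n" "2 \<le> n" using en2 n2 by simp_all
  have "real e \<le> real N" using N1 e1 n5 by linarith
  then have eN: "e \<le> N" by simp
  define u where "u = real (n - e) / real n"
  have u1: "u = 1 - real e / real n" using en n1 by (simp add: u_def of_nat_diff diff_divide_distrib)
  have u: "0 \<le> u" "u \<le> 1" using n1 by (simp_all add: u_def divide_le_eq_1)
  \<comment> \<open>The exponent \<open>4 * N\<close> arises because \<open>keep_prob\<close> is a
    power of a square and enters squared; N \<le> n/16 makes 8 N / n at most 1/2.\<close>
  have "1 / 2 \<le> 1 + real (4 * N) * (- (2 / real n))" using N16 n5 by (simp add: field_simps)
  also have "\<dots> \<le> (1 + (- (2 / real n))) ^ (4 * N)" using n5 by (intro Bernoulli_inequality) simp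
  finally have h: "1 / 2 \<le> (1 - 2 / real n) ^ (4 * N)" by simp
  have "(1 / 2) ^ e \<le> ((1 - 2 / real n) ^ (4 * N)) ^ e" using h by (intro power_mono) auto
  also have "\<dots> = ((1 - 2 / real n) ^ e) ^ (4 * N)" by (simp only: power_mult[symmetric] mult.commute)
  also have "\<dots> \<le> u ^ (4 * N)"
    using one_minus_ge_power[OF en(2,3)] n5 unfolding u1 by (intro power_mono) (auto simp: field_simps)
  also have "\<dots> \<le> u ^ (4 * (N - e))" using u by (intro power_decreasing) auto
  also have "\<dots> = (keep_prob e)\<^sup>2"
    by (simp add: keep_prob_def u_def power_divide power_mult[symmetric] mult.commute mult.left_commute)
  finally have keep: "(1 / 2) ^ e \<le> (keep_prob e)\<^sup>2" .
  have c1: "real (N - e) ^ e \<le> real (N choose e) * fact e"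
  proof -
    have "fact (N - e) * real (N - e) ^ e \<le> fact N" by (rule fact_ge[OF eN])
    also have "fact N = real (fact e * fact (N - e) * (N choose e))"
      by (simp only: binomial_fact_lemma[OF eN] of_nat_fact)
    also have "\<dots> = fact (N - e) * (real (N choose e) * fact e)" by (simp add: mult_ac)
    finally show ?thesis by (simp add: mult_le_cancel_left)
  qed
  have c2: "real (n - e) ^ e \<le> fact n / fact (n - e)"
    using fact_ge[OF en(1)] by (simp add: field_simps)
  have "(1 / 36) ^ e \<le> (real (N - e) / real n * (real (n - e) / real n) * (1 / 2)) ^ e"
  proof (rule power_mono)
    have a1: "1 / 17 \<le> real (N - e) / real n" using N1 e1 n5 eN by (simp add: field_simps of_nat_diff)
    have a2: "17 / 18 \<le> real (n - e) / real n" using e1 n5 en by (simp add: field_simps of_nat_diff)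
    have "1 / 36 = (1 / 17) * (17 / 18) * (1 / 2 :: real)" by simp
    also have "\<dots> \<le> real (N - e) / real n * (real (n - e) / real n) * (1 / 2)"
      by (intro mult_mono a1 a2) simp_all
    finally show "1 / 36 \<le> real (N - e) / real n * (real (n - e) / real n) * (1 / 2)" .
  qed simp
  also have "\<dots> = real (N - e) ^ e * real (n - e) ^ e * (1 / 2) ^ e / (real n ^ 2) ^ e"
    by (simp add: power_mult_distrib power_divide power2_eq_square)
  also have "\<dots> \<le> (real (N choose e) * fact e) * (fact n / fact (n - e)) * (keep_prob e)\<^sup>2 / (real n ^ 2) ^ e"
    using c1 c2 keep by (intro divide_right_mono mult_mono) auto
  also have "\<dots> = mass e"
    by (simp add: mass_def power_divide power2_eq_square field_simps)
  finally show ?thesis .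
qed

end

theorem theorem1p10:
  fixes n :: nat
  assumes "n \<ge> 1"
  shows "\<exists>T :: real \<Rightarrow> ((nat \<Rightarrow> nat) \<Rightarrow> real) \<Rightarrow> ((nat \<Rightarrow> nat) \<Rightarrow> real).
    (\<forall>\<rho> \<in> {0<..<1}. linear_operator_L2 n (T \<rho>) \<and> self_adjoint_L2 n (T \<rho>)) \<and>
    (\<forall>\<rho> \<in> {0<..<1}. \<forall>(d::nat) f. f \<in> V_le n d \<longrightarrow> real d \<le> real n / 10 ^ 5 \<longrightarrow>
       sym_inner n (T \<rho> f) f \<ge> (\<rho> / 72) ^ d * (sym_norm n 2 f)\<^sup>2) \<and>
    (\<forall>\<rho> \<in> {0<..<1}. \<forall>f \<in> L2_sym n. \<forall>(r::real) (\<gamma>::real) (q::real).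
       r > 0 \<longrightarrow> \<gamma> > 0 \<longrightarrow> is_global n r \<gamma> f \<longrightarrow> q \<ge> 2 \<longrightarrow> \<rho> \<le> ln q / (16 * r * q) \<longrightarrow>
       (sym_norm n q (T \<rho> f)) powr q \<le> \<gamma> powr (q - 2) * (sym_norm n 2 f)\<^sup>2) \<and>
    (\<forall>\<rho> \<in> {0<..<1}. commutes_with_actions n (T \<rho>))"
proof -
  interpret coupling n "n div 16"
    by unfold_locales (use assms in auto)
  have lower: "(\<rho> / 72) ^ d * (sym_norm n 2 f)\<^sup>2 \<le> sym_inner n (T_op (\<rho> / 2) f) f"
    if \<rho>: "0 < \<rho>" "\<rho> < 1" and f: "f \<in> V_le n d" and d: "real d \<le> real n / 10 ^ 5" for \<rho> d f
  proof -
    have "(\<rho> / 72) ^ d * (\<Sum>\<sigma>\<in>sym_grp n. (f \<sigma>)\<^sup>2) \<le> (\<Sum>\<sigma>\<in>sym_grp n. T_op (\<rho> / 2) f \<sigma> * f \<sigma>)"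
    proof (rule T_op_lower_bound[where D = d])
      show "2 * d \<le> n" using d by (simp add: field_simps)
      show "f \<in> W d" using V_le_sub_W f by blast
      fix e assume "e \<le> d"
      then have "real e \<le> real n / 10 ^ 5" using d by simp
      then have "(1 / 36) ^ e * (\<rho> / 2) ^ e \<le> mass e * (\<rho> / 2) ^ e"
        using \<rho> by (intro mult_right_mono mass_lower_bound) auto
      \<comment> \<open>72 is the 36 of \<open>mass_lower_bound\<close> times the 2 of the halved
        noise rate.\<close>
      moreover have "(1 / 36) ^ e * (\<rho> / 2) ^ e = (\<rho> / 72) ^ e" by (simp flip: power_mult_distrib)
      ultimately show "(\<rho> / 72) ^ e \<le> mass e * (\<rho> / 2) ^ e" by simp
    qed (use \<rho> in auto)
    then have "(\<rho> / 72) ^ d * (\<Sum>\<sigma>\<in>sym_grp n. (f \<sigma>)\<^sup>2) / fact n \<le> (\<Sum>\<sigma>\<in>sym_grp n. T_op (\<rho> / 2) f \<sigma> * f \<sigma>) / fact n"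
      by (intro divide_right_mono) auto
    then show ?thesis by (simp add: sym_norm_2 sym_inner_eq)
  qed
  show ?thesis
    by (rule exI[of _ "\<lambda>\<rho>. T_op (\<rho> / 2)"])
       (auto intro!: lower T_op_linear T_op_self_adjoint_L2 T_op_commutes T_op_hypercontractive)
qed

end
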